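(* Let $A:\hat\Sigma_{\mathbf M}\to\mathbb R$ be a Lipschitz continuous function. Then there exist a function $\phi^+\in\mathcal H$, unique up to an additive constant, and a unique constant $\lambda^+\in\mathbb R$ such that $$\mathcal G^+(\phi^+)=\phi^++\lambda^+ .$$
   Context: Let $\mathbf M:\{1,\dots,r\}\times\{1,\dots,r\}\to\{0,1\}$ be an irreducible symmetric transition matrix. Let $\Sigma_{\mathbf M}=\{(x_0,x_1,\dots)\in\{1,\dots,r\}^{\mathbb Z_+}:\mathbf M(x_j,x_{j+1})=1\ \forall j\}$, with left shift $\sigma(x_0,x_1,x_2,\dots)=(x_1,x_2,\dots)$, and let $\Sigma^*_{\mathbf M}$ be the dual subshift of sequences $(\dots,x_1,x_0)$ with $\mathbf M(x_{j+1},x_j)=1$ for all $j$. As $\mathbf M$ is symmetric, $\mathbf x=(x_0,x_1,\dots)\mapsto\mathbf x^*=(\dots,x_1,x_0)$ is a bijection $\Sigma_{\mathbf M}\to\Sigma^*_{\mathbf M}$. Fix $\Lambda\in(0,1)$; for $\mathbf x\neq\mathbf y$ in $\Sigma_{\mathbf M}$ put $d(\mathbf x,\mathbf y)=\Lambda^k$ with $k=\min\{j:x_j\neq y_j\}$ (and $d(\mathbf x,\mathbf x)=0$), and put $d^*(\mathbf x^*,\mathbf y^* )=d(\mathbf x,\mathbf y)$. Functions on $\Sigma_{\mathbf M}$ and on $\Sigma^*_{\mathbf M}$ are identified by $f^*(\mathbf x^* )=f(\mathbf x)$; $\mathcal H$ is the space of Lipschitz continuous real functions on $\Sigma_{\mathbf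 M}$ (equivalently $\Sigma^*_{\mathbf M}$). Let $\hat\Sigma_{\mathbf M}=\{(\mathbf y^*,\mathbf x)\in\Sigma^*_{\mathbf M}\times\Sigma_{\mathbf M}:\mathbf M(y_0,x_0)=1\}$ with the product metric $\max\{d^*,d\}$. In every expression where $\mathbf y^*$ is fixed and $\mathbf x$ ranges over all of $\Sigma_{\mathbf M}$, $A(\mathbf y^*,\mathbf x)$ means $A(\mathbf y^*,\mathbf x)\mathbf M(y_0,x_0)$, i.e. $A$ is extended by $0$ to pairs with $\mathbf M(y_0,x_0)=0$. Let $\mathcal M_\sigma$ be the set of $\sigma$-invariant Borel probability measures on $\Sigma_{\mathbf M}$ and $h_\mu(\sigma)$ the Kolmogorov–Sinai entropy. The map $\mathcal G^+=\mathcal G^+_A:\mathcal H\to\mathcal H$ is $$\mathcal G^+(\phi)(\mathbf y^* )=\sup_{\mu\in\mathcal M_\sigma}\Big[\int_{\Sigma_{\mathbf M}}\big(A(\mathbf y^*,\mathbf x)+\phi(\mathbf x)\big)\,d\mu(\mathbf x)+h_\mu(\sigma)\Big],\qquad \mathbf y^*\in\Sigma^*_{\mathbf M}.$$ *)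

theory Defs
  imports "HOL-Probability.Probability"
begin

section \<open>Transition matrices and subshifts\<close>

text \<open>The alphabet is an arbitrary (nonempty) finite type.\<close>

definition transition_matrix :: "real^'r^'r \<Rightarrow> bool" where
  "transition_matrix M \<longleftrightarrow> (\<forall>i j. M $ i $ j \<in> {0, 1})"

definition irreducible_matrix :: "real^'r^'r \<Rightarrow> bool" where
  "irreducible_matrix M \<longleftrightarrow> (\<forall>i j. \<exists>n\<ge>1. (((**) M ^^ n) (mat 1)) $ i $ j > 0)"

definition subshift :: "real^'r^'r \<Rightarrow> (nat \<Rightarrow> 'r) set" where
  "subshift M = {x. \<forall>j. M $ x j $ x (Suc j) = 1}"

text \<open>
  A left-infinite sequence \<open>(\<dots>, x\<^sub>1, x\<^sub>0)\<close> is also given by its coordinate function \<open>j \<mapsto> x\<^sub>j\<close>.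
  With this encoding the bijection \<open>x \<mapsto> x*\<close> between \<open>subshift M\<close> and \<open>dual_subshift M\<close>
  (for symmetric \<open>M\<close>) is the identity map, so \<open>d*\<close> is \<open>d\<close>, and \<open>f*\<close> is \<open>f\<close>.
\<close>

definition dual_subshift :: "real^'r^'r \<Rightarrow> (nat \<Rightarrow> 'r) set" where
  "dual_subshift M = {x. \<forall>j. M $ x (Suc j) $ x j = 1}"

lemma dual_subshift_eq: "transpose M = M \<Longrightarrow> dual_subshift M = subshift M"
proof -
  assume "transpose M = M"
  then have "M $ i $ j = M $ j $ i" for i j
    by (metis transpose_def vec_lambda_beta)
  then have "M $ x (Suc j) $ x j = M $ x j $ x (Suc j)" for x :: "nat \<Rightarrow> 'a" and j .
  then show ?thesis unfolding dual_subshift_def subshift_def by simp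
qed

definition shift :: "(nat \<Rightarrow> 'r) \<Rightarrow> (nat \<Rightarrow> 'r)" where
  "shift x = (\<lambda>j. x (Suc j))"

text \<open>Pairs \<open>(y*, x)\<close> that can be glued to a bi-infinite admissible sequence.\<close>

definition hat_subshift :: "real^'r^'r \<Rightarrow> ((nat \<Rightarrow> 'r) \<times> (nat \<Rightarrow> 'r)) set" where
  "hat_subshift M = {(y, x) \<in> dual_subshift M \<times> subshift M. M $ y 0 $ x 0 = 1}"


section \<open>Metrics and Lipschitz functions\<close>

definition seq_dist :: "real \<Rightarrow> (nat \<Rightarrow> 'r) \<Rightarrow> (nat \<Rightarrow> 'r) \<Rightarrow> real" where
  "seq_dist \<Lambda> x y = (if x = y then 0 else \<Lambda> ^ (LEAST j. x j \<noteq> y j))"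

definition pair_dist ::
  "real \<Rightarrow> (nat \<Rightarrow> 'r) \<times> (nat \<Rightarrow> 'r) \<Rightarrow> (nat \<Rightarrow> 'r) \<times> (nat \<Rightarrow> 'r) \<Rightarrow> real" where
  "pair_dist \<Lambda> p q = max (seq_dist \<Lambda> (fst p) (fst q)) (seq_dist \<Lambda> (snd p) (snd q))"

lemma seq_dist_ultra:
  assumes "0 < \<Lambda>" "\<Lambda> < 1"
  shows "seq_dist \<Lambda> x z \<le> max (seq_dist \<Lambda> x y) (seq_dist \<Lambda> y z)"
proof (cases "x = z")
  case True
  then show ?thesis using assms by (simp add: seq_dist_def le_max_iff_disj)
next
  case False
  define k where "k = (LEAST j. x j \<noteq> z j)"
  have *: "\<Lambda> ^ k \<le> seq_dist \<Lambda> u v" if "u k \<noteq> v k" for u v :: "nat \<Rightarrow> 'a"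
  proof -
    have "(LEAST j. u j \<noteq> v j) \<le> k"
      using that by (rule Least_le)
    then have "\<Lambda> ^ k \<le> \<Lambda> ^ (LEAST j. u j \<noteq> v j)"
      using assms by (intro power_decreasing) simp_all
    moreover have "u \<noteq> v" using that by blast
    ultimately show ?thesis by (simp add: seq_dist_def)
  qed
  have "\<exists>j. x j \<noteq> z j" using False by blast
  then have "x k \<noteq> z k" unfolding k_def by (rule LeastI_ex)
  then have "x k \<noteq> y k \<or> y k \<noteq> z k" by metis
  then have "\<Lambda> ^ k \<le> max (seq_dist \<Lambda> x y) (seq_dist \<Lambda> y z)"
    using *[of x y] *[of y z] by (metis le_max_iff_disj)
  moreover have "seq_dist \<Lambda> x z = \<Lambda> ^ k"
    unfolding seq_dist_def k_def using False by (rule if_not_P)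
  ultimately show ?thesis by metis
qed

lemma Metric_space_seq_dist:
  assumes "0 < \<Lambda>" "\<Lambda> < 1"
  shows "Metric_space S (seq_dist \<Lambda>)"
proof
  show nonneg: "0 \<le> seq_dist \<Lambda> x y" for x y :: "nat \<Rightarrow> 'r"
    using assms by (simp add: seq_dist_def)
  show "seq_dist \<Lambda> x y = seq_dist \<Lambda> y x" for x y :: "nat \<Rightarrow> 'r"
    by (simp add: seq_dist_def eq_commute)
  show "seq_dist \<Lambda> x y = 0 \<longleftrightarrow> x = y" for x y :: "nat \<Rightarrow> 'r"
    using assms by (simp add: seq_dist_def)
  show "seq_dist \<Lambda> x z \<le> seq_dist \<Lambda> x y + seq_dist \<Lambda> y z" for x y z :: "nat \<Rightarrow> 'r"
    using seq_dist_ultra[OF assms, of x z y] nonneg[of x y] nonneg[of y z] by linarith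
qed

lemma Metric_space_pair_dist:
  assumes "0 < \<Lambda>" "\<Lambda> < 1"
  shows "Metric_space S (pair_dist \<Lambda>)"
proof -
  interpret D: Metric_space UNIV "seq_dist \<Lambda> :: (nat \<Rightarrow> 'a) \<Rightarrow> _"
    by (rule Metric_space_seq_dist[OF assms])
  show ?thesis
  proof
    fix p q r :: "(nat \<Rightarrow> 'a) \<times> (nat \<Rightarrow> 'a)"
    show "0 \<le> pair_dist \<Lambda> p q"
      unfolding pair_dist_def by (rule max.coboundedI1) (rule D.nonneg)
    show "pair_dist \<Lambda> p q = pair_dist \<Lambda> q p"
      unfolding pair_dist_def D.commute[of "fst p"] D.commute[of "snd p"] ..
    have "seq_dist \<Lambda> (fst p) (fst q) = 0 \<longleftrightarrow> fst p = fst q"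
         "seq_dist \<Lambda> (snd p) (snd q) = 0 \<longleftrightarrow> snd p = snd q"
      by (rule D.zero; rule UNIV_I)+
    then show "pair_dist \<Lambda> p q = 0 \<longleftrightarrow> p = q"
      using D.nonneg[of "fst p" "fst q"] D.nonneg[of "snd p" "snd q"]
      unfolding pair_dist_def prod_eq_iff by linarith
    have "seq_dist \<Lambda> (fst p) (fst r) \<le> seq_dist \<Lambda> (fst p) (fst q) + seq_dist \<Lambda> (fst q) (fst r)"
         "seq_dist \<Lambda> (snd p) (snd r) \<le> seq_dist \<Lambda> (snd p) (snd q) + seq_dist \<Lambda> (snd q) (snd r)"
      by (rule D.triangle; rule UNIV_I)+
    then show "pair_dist \<Lambda> p r \<le> pair_dist \<Lambda> p q + pair_dist \<Lambda> q r"
      by (auto simp add: pair_dist_def max_def)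
  qed
qed

definition subshift_metric :: "real \<Rightarrow> real^'r^'r \<Rightarrow> (nat \<Rightarrow> 'r) metric" where
  "subshift_metric \<Lambda> M = metric (subshift M, seq_dist \<Lambda>)"

definition hat_metric :: "real \<Rightarrow> real^'r^'r \<Rightarrow> ((nat \<Rightarrow> 'r) \<times> (nat \<Rightarrow> 'r)) metric" where
  "hat_metric \<Lambda> M = metric (hat_subshift M, pair_dist \<Lambda>)"

lemma subshift_metric_simps [simp]:
  assumes "0 < \<Lambda>" "\<Lambda> < 1"
  shows "mspace (subshift_metric \<Lambda> M) = subshift M"
    and "mdist (subshift_metric \<Lambda> M) = seq_dist \<Lambda>"
  unfolding subshift_metric_def
  by (rule Metric_space.mspace_metric Metric_space.mdist_metric,
      rule Metric_space_seq_dist[OF assms])+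

lemma hat_metric_simps [simp]:
  assumes "0 < \<Lambda>" "\<Lambda> < 1"
  shows "mspace (hat_metric \<Lambda> M) = hat_subshift M"
    and "mdist (hat_metric \<Lambda> M) = pair_dist \<Lambda>"
  unfolding hat_metric_def
  by (rule Metric_space.mspace_metric Metric_space.mdist_metric,
      rule Metric_space_pair_dist[OF assms])+

text \<open>
  The space \<open>\<H>\<close>. Its elements are functions on \<open>subshift M\<close>: values elsewhere are arbitrary,
  and two elements are to be compared on \<open>subshift M\<close> only.
\<close>

definition lipschitz_functions :: "real \<Rightarrow> real^'r^'r \<Rightarrow> ((nat \<Rightarrow> 'r) \<Rightarrow> real) set" where
  "lipschitz_functions \<Lambda> M =
     {\<phi>. Lipschitz_continuous_map (subshift_metric \<Lambda> M) euclidean_metric \<phi>}"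


section \<open>Invariant measures and entropy\<close>

definition subshift_borel :: "real \<Rightarrow> real^'r^'r \<Rightarrow> (nat \<Rightarrow> 'r) measure" where
  "subshift_borel \<Lambda> M =
     sigma (subshift M) {U. openin (mtopology_of (subshift_metric \<Lambda> M)) U}"

definition invariant_measures :: "real \<Rightarrow> real^'r^'r \<Rightarrow> (nat \<Rightarrow> 'r) measure set" where
  "invariant_measures \<Lambda> M =
     {\<mu>. prob_space \<mu> \<and> sets \<mu> = sets (subshift_borel \<Lambda> M) \<and>
         shift \<in> measurable \<mu> \<mu> \<and> distr \<mu> \<mu> shift = \<mu>}"

definition partition_entropy :: "'a measure \<Rightarrow> 'a set set \<Rightarrow> real" where
  "partition_entropy \<mu> P = - (\<Sum>B\<in>P. measure \<mu> B * ln (measure \<mu> B))"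

text \<open>The common refinement of the preimages of \<open>P\<close> under \<open>T ^^ i\<close>, \<open>i < n\<close>, for a partition \<open>P\<close> of \<open>S\<close>.\<close>

definition dynamical_refinement ::
  "'a set \<Rightarrow> ('a \<Rightarrow> 'a) \<Rightarrow> 'a set set \<Rightarrow> nat \<Rightarrow> 'a set set" where
  "dynamical_refinement S T P n =
     {S \<inter> (\<Inter>i<n. (T ^^ i) -` B i) | B. \<forall>i<n. B i \<in> P} - {{}}"

definition entropy_wrt_partition :: "'a measure \<Rightarrow> ('a \<Rightarrow> 'a) \<Rightarrow> 'a set set \<Rightarrow> real" where
  "entropy_wrt_partition \<mu> T P =
     lim (\<lambda>n. partition_entropy \<mu> (dynamical_refinement (space \<mu>) T P n) / real n)"

definition ks_entropy :: "'a measure \<Rightarrow> ('a \<Rightarrow> 'a) \<Rightarrow> ereal" where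
  "ks_entropy \<mu> T =
     (SUP P \<in> {P. finite P \<and> P \<subseteq> sets \<mu> \<and> partition_on (space \<mu>) P}.
        ereal (entropy_wrt_partition \<mu> T P))"


section \<open>The operator \<open>\<G>\<^sup>+\<close>\<close>

definition zero_extension ::
  "real^'r^'r \<Rightarrow> ((nat \<Rightarrow> 'r) \<times> (nat \<Rightarrow> 'r) \<Rightarrow> real) \<Rightarrow> (nat \<Rightarrow> 'r) \<Rightarrow> (nat \<Rightarrow> 'r) \<Rightarrow> real" where
  "zero_extension M A y x = A (y, x) * M $ y 0 $ x 0"

text \<open>
  The supremum is taken in the extended reals, so that an identity
  \<open>G_plus \<Lambda> M A \<phi> y = ereal c\<close> includes the finiteness of the supremum.
\<close>

definition G_plus ::
  "real \<Rightarrow> real^'r^'r \<Rightarrow> ((nat \<Rightarrow> 'r) \<times> (nat \<Rightarrow> 'r) \<Rightarrow> real) \<Rightarrow>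
     ((nat \<Rightarrow> 'r) \<Rightarrow> real) \<Rightarrow> (nat \<Rightarrow> 'r) \<Rightarrow> ereal" where
  "G_plus \<Lambda> M A \<phi> y =
     (SUP \<mu> \<in> invariant_measures \<Lambda> M.
        ereal (\<integral>x. zero_extension M A y x + \<phi> x \<partial>\<mu>) + ks_entropy \<mu> shift)"

text \<open>\<open>\<phi> \<in> \<H>\<close> satisfies \<open>\<G>\<^sup>+(\<phi>) = \<phi> + \<lambda>\<close>, as functions on the dual subshift.\<close>

definition G_plus_solution ::
  "real \<Rightarrow> real^'r^'r \<Rightarrow> ((nat \<Rightarrow> 'r) \<times> (nat \<Rightarrow> 'r) \<Rightarrow> real) \<Rightarrow>
     ((nat \<Rightarrow> 'r) \<Rightarrow> real) \<Rightarrow> real \<Rightarrow> bool" where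
  "G_plus_solution \<Lambda> M A \<phi> c \<longleftrightarrow>
     \<phi> \<in> lipschitz_functions \<Lambda> M \<and>
     (\<forall>y \<in> dual_subshift M. G_plus \<Lambda> M A \<phi> y = ereal (\<phi> y + c))"

end

theory Submission
  imports Defs
begin

text \<open>
  By the variational principle, \<open>\<G>\<^sup>+(\<phi>)(y)\<close> is the topological pressure of the potential
  \<open>A(y, \<cdot>) + \<phi>\<close>, where \<open>A\<close> is extended by 0. The pressure \<open>P(f)\<close> of a Lipschitz potential \<open>f\<close> is
  the logarithm of the leading eigenvalue of its Ruelle transfer operator. Everything follows from
  three properties of \<open>P\<close>: it is monotone, it satisfies \<open>P(f + c) = P(f) + c\<close>, and it is strict, that
  is, \<open>f \<le> g\<close> and \<open>P(f) = P(g)\<close> imply \<open>f = g\<close>.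

  Uniqueness. Let \<open>\<phi>\<close> and \<open>\<psi>\<close> be solutions with constants \<open>c\<close> and \<open>c'\<close>, and let \<open>\<phi> - \<psi>\<close> be maximal at
  \<open>y\<close>, with value \<open>t\<close>. Then \<open>A(y, \<cdot>) + \<phi> \<le> A(y, \<cdot>) + \<psi> + t\<close>, and comparing pressures gives \<open>c \<le> c'\<close>. By
  symmetry \<open>c = c'\<close>, so both sides have the same pressure, and strictness gives \<open>\<phi> = \<psi> + t\<close>
  (\<open>pressure_problem_unique\<close>).

  Existence. \<open>\<G>\<^sup>+\<close> is nonexpansive in the uniform norm and maps everything into functions with a fixed
  Lipschitz constant and bounded oscillation. The fixed points of the contractions
  \<open>\<phi> \<mapsto> \<G>\<^sup>+((1 - e) \<phi>)\<close>, normalized by constants, therefore have a limit as \<open>e\<close> tends to 0, and this limit is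
  a solution (\<open>additive_eigenfunction\<close>, \<open>pressure_problem_solvable\<close>). The same argument, applied to the
  logarithm of the transfer operator, yields the eigenfunctions that define \<open>P\<close>
  (\<open>log_transfer_eigenfunction\<close>); there the Lipschitz constant is controlled by the contraction of inverse
  branches, and the oscillation by irreducibility.

  Strictness. At a maximum point of the difference of the logarithms of two eigenfunctions, equality of
  the eigenvalues forces equality in all summands of the transfer operator, hence equality of the
  potentials at all predecessors, which are again maximum points. Backward orbits are dense
  (\<open>eigenvalue_comparison\<close>).

  Variational principle. A coboundary and a constant turn \<open>f\<close> into a potential \<open>g\<close> whose transfer operator
  fixes the function 1; it remains to see that the supremum of \<open>h\<^sub>\<mu> + \<integral>g d\<mu>\<close> is 0. The upper bound holds
  for cylinder partitions by the Gibbs inequality, and passes to all finite Borel partitions because these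
  are approximated in conditional entropy by cylinders (\<open>ks_entropy_upper\<close>). For the lower bound, a
  Banach limit of Cesaro means of powers of the transfer operator is an invariant measure which satisfies
  \<open>\<mu>(C) \<le> const * exp (g + g \<circ> \<sigma> + \<dots> + g \<circ> \<sigma>\<^bsup>n - 1\<^esup>)\<close> on cylinders \<open>C\<close> of length \<open>n\<close>, so that its entropy is at
  least \<open>- \<integral>g d\<mu>\<close> (\<open>gibbs_measure_exists\<close>, \<open>ks_entropy_lower\<close>).
\<close>

section \<open>Limits along a common filter\<close>

text \<open>
  A substitute for the extraction of convergent subsequences that works for uncountably many
  sequences at once: by Tychonoff the points \<open>(a i k)\<^sub>i\<close> have a cluster point in a product of compact
  intervals, and \<open>F\<close> is the trace of its neighbourhood filter on the indices \<open>k\<close>. It serves three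
  times: for compactness of the subshift, for an Arzela-Ascoli argument, and for a Banach limit of
  Cesaro means.
\<close>

lemma bounded_family_converges_along_filter:
  fixes a :: "'i \<Rightarrow> nat \<Rightarrow> real"
  obtains F where "F \<noteq> bot" "F \<le> sequentially"
    "\<And>i. bounded (range (a i)) \<Longrightarrow> \<exists>l. (a i \<longlongrightarrow> l) F"
proof -
  define b where "b = (\<lambda>i k. if bounded (range (a i)) then a i k else 0)"
  have "bounded (range (b i))" for i
    by (cases "bounded (range (a i))") (auto simp: b_def)
  then have "\<forall>i. \<exists>B. \<forall>k. \<bar>b i k\<bar> \<le> B"
    by (metis bounded_real rangeI)
  then obtain B where B: "\<And>i k. \<bar>b i k\<bar> \<le> B i"
    by metis
  define K where "K = (\<Pi>\<^sub>E i\<in>UNIV. {- B i..B i})"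
  have "compact K"
  proof -
    have "compactin (product_topology (\<lambda>i::'i. euclidean) UNIV) K"
      unfolding K_def compactin_PiE by auto
    then show ?thesis
      by (simp add: euclidean_product_topology)
  qed
  define X where "X = (\<lambda>k i. b i k)"
  define G where "G = filtermap X sequentially"
  have XK: "X k \<in> K" for k
    using B unfolding K_def X_def by (auto simp: abs_le_iff) (metis minus_le_iff)
  then have "G \<noteq> bot" "eventually (\<lambda>x. x \<in> K) G"
    by (auto simp: G_def filtermap_bot_iff eventually_filtermap)
  then obtain v where v: "inf (nhds v) G \<noteq> bot"
    using \<open>compact K\<close> unfolding compact_filter by blast
  define F where "F = inf (filtercomap X (nhds v)) sequentially"
  have "F \<noteq> bot"
  proof
    assume "F = bot"
    then have "eventually (\<lambda>_. False) F"
      by simp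
    then obtain P Q where P: "eventually P (filtercomap X (nhds v))" and Q: "eventually Q sequentially"
      and PQ: "\<And>k. P k \<Longrightarrow> Q k \<Longrightarrow> False"
      unfolding F_def eventually_inf by blast
    obtain P' where P': "eventually P' (nhds v)" and "\<And>k. P' (X k) \<Longrightarrow> P k"
      using P unfolding eventually_filtercomap by blast
    then have "eventually (\<lambda>x. \<not> P' x) G"
      unfolding G_def eventually_filtermap using Q PQ by (metis (mono_tags, lifting) eventually_mono)
    then have "eventually (\<lambda>_. False) (inf (nhds v) G)"
      unfolding eventually_inf using P' by blast
    then show False
      using v by simp
  qed
  moreover have "F \<le> sequentially"
    by (simp add: F_def)
  moreover have "\<exists>l. (a i \<longlongrightarrow> l) F" if "bounded (range (a i))" for i
  proof -
    have "filterlim X (nhds v) F"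
      unfolding F_def by (rule filterlim_mono[OF filterlim_filtercomap order_refl inf_le1]) 
    moreover have "((\<lambda>x. x i) \<longlongrightarrow> v i) (nhds v)"
      using continuous_on_product_coordinates[of i] tendsto_at_iff_tendsto_nhds[of "\<lambda>x. x i" v]
      by (auto simp: continuous_on_def)
    ultimately have "((\<lambda>k. X k i) \<longlongrightarrow> v i) F"
      by (rule filterlim_compose[rotated])
    then show ?thesis
      using that by (auto simp: X_def b_def)
  qed
  ultimately show thesis
    using that by blast
qed


section \<open>Symmetric irreducible subshifts\<close>

definition prepend :: "'a \<Rightarrow> (nat \<Rightarrow> 'a) \<Rightarrow> nat \<Rightarrow> 'a" where
  "prepend a x = (\<lambda>j. case j of 0 \<Rightarrow> a | Suc i \<Rightarrow> x i)"

definition agree :: "nat \<Rightarrow> (nat \<Rightarrow> 'a) \<Rightarrow> (nat \<Rightarrow> 'a) \<Rightarrow> bool" where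
  "agree n x y \<longleftrightarrow> (\<forall>j<n. x j = y j)"

lemma prepend_simps [simp]:
  "prepend a x 0 = a" "prepend a x (Suc j) = x j" "shift (prepend a x) = x"
  "prepend (x 0) (shift x) = x"
  by (auto simp: prepend_def shift_def fun_eq_iff split: nat.split)

lemma shift_nth [simp]: "shift x j = x (Suc j)"
  by (simp add: shift_def)

lemma funpow_shift_nth [simp]: "(shift ^^ n) x j = x (n + j)"
  by (induction n arbitrary: x j) (auto simp: funpow_Suc_right simp del: funpow.simps)

lemma agree_Suc: "agree (Suc n) x y \<longleftrightarrow> x 0 = y 0 \<and> agree n (shift x) (shift y)"
  unfolding agree_def using less_Suc_eq_0_disj by auto

lemma agree_0 [simp]: "agree 0 x y"
  by (simp add: agree_def)

lemma agree_refl [simp]: "agree n x x"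
  by (simp add: agree_def)

lemma agree_sym: "agree n x y \<Longrightarrow> agree n y x"
  by (simp add: agree_def)

lemma agree_mono: "agree n x y \<Longrightarrow> m \<le> n \<Longrightarrow> agree m x y"
  by (simp add: agree_def)

locale symmetric_subshift =
  fixes M :: "real^'r::finite^'r" and \<Lambda> :: real
  assumes transition: "transition_matrix M"
    and irreducible: "irreducible_matrix M"
    and symmetric: "transpose M = M"
    and \<Lambda>_pos: "0 < \<Lambda>" and \<Lambda>_less_1: "\<Lambda> < 1"
begin

abbreviation S :: "(nat \<Rightarrow> 'r) set" where
  "S \<equiv> subshift M"

abbreviation d :: "(nat \<Rightarrow> 'r) \<Rightarrow> (nat \<Rightarrow> 'r) \<Rightarrow> real" where
  "d \<equiv> seq_dist \<Lambda>"

definition adj :: "'r \<Rightarrow> 'r \<Rightarrow> bool" where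
  "adj a b \<longleftrightarrow> M $ a $ b = 1"

lemma not_adj: "\<not> adj a b \<Longrightarrow> M $ a $ b = 0"
  using transition unfolding transition_matrix_def adj_def by (metis insertE singletonD)

lemma adj_sym: "adj a b \<longleftrightarrow> adj b a"
proof -
  have "transpose M $ b $ a = M $ a $ b"
    by (simp add: transpose_def)
  then show ?thesis
    by (simp add: adj_def symmetric)
qed

lemma adj_trancl: "(a, b) \<in> {(a, b). adj a b}\<^sup>+"
proof -
  have step: "\<exists>k. adj a k \<and> ((**) M ^^ n) (mat 1) $ k $ b > 0" if "((**) M ^^ Suc n) (mat 1) $ a $ b > 0" for n a
  proof -
    have "0 < (\<Sum>k\<in>UNIV. M $ a $ k * ((**) M ^^ n) (mat 1) $ k $ b)"
      using that by (simp add: matrix_matrix_mult_def[of M "((**) M ^^ n) (mat 1)"])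
    then obtain k where k: "0 < M $ a $ k * ((**) M ^^ n) (mat 1) $ k $ b"
      by (meson not_le sum_nonpos)
    then have "adj a k"
      using not_adj by fastforce
    with k show ?thesis
      by (auto simp: adj_def)
  qed
  have *: "(a, b) \<in> {(a, b). adj a b}\<^sup>*" if "((**) M ^^ n) (mat 1) $ a $ b > 0" for n a
    using that
  proof (induction n arbitrary: a)
    case 0
    then show ?case
      by (auto simp: mat_def split: if_splits)
  next
    case (Suc n)
    then show ?case
      using step by (metis (mono_tags, lifting) case_prodI converse_rtrancl_into_rtrancl mem_Collect_eq)
  qed
  obtain n where "n \<ge> 1" "((**) M ^^ n) (mat 1) $ a $ b > 0"
    using irreducible unfolding irreducible_matrix_def by blast
  then obtain m where "((**) M ^^ Suc m) (mat 1) $ a $ b > 0"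
    by (metis Suc_le_D One_nat_def)
  then show ?thesis
    using step * by (metis (mono_tags, lifting) case_prodI mem_Collect_eq rtrancl_into_trancl2)
qed

lemma adj_ex: "\<exists>b. adj a b"
  using tranclD[OF adj_trancl[of a a]] by blast

lemma mem_S: "x \<in> S \<longleftrightarrow> (\<forall>j. adj (x j) (x (Suc j)))"
  by (simp add: subshift_def adj_def)

lemma dual_S: "dual_subshift M = S"
  by (rule dual_subshift_eq[OF symmetric])

lemma prepend_in_S [simp]: "prepend a x \<in> S \<longleftrightarrow> adj a (x 0) \<and> x \<in> S"
  unfolding mem_S by (metis not0_implies_Suc prepend_simps(1,2))

lemma shift_in_S [simp]: "x \<in> S \<Longrightarrow> shift x \<in> S"
  by (simp add: mem_S)

lemma funpow_shift_in_S [simp]: "x \<in> S \<Longrightarrow> (shift ^^ n) x \<in> S"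
  by (induction n) auto

definition preds :: "(nat \<Rightarrow> 'r) \<Rightarrow> 'r set" where
  "preds x = {a. adj a (x 0)}"

lemma preds_nonempty [simp]: "preds x \<noteq> {}"
  using adj_ex adj_sym by (force simp: preds_def)

lemma finite_preds [simp]: "finite (preds x)"
  by simp

lemma preds_iff [simp]: "a \<in> preds x \<longleftrightarrow> adj a (x 0)"
  by (simp add: preds_def)

definition point :: "'r \<Rightarrow> nat \<Rightarrow> 'r" where
  "point a = (\<lambda>n. ((\<lambda>b. SOME c. adj b c) ^^ n) a)"

lemma point_in_S [simp]: "point a \<in> S" and point_0 [simp]: "point a 0 = a"
  using someI_ex[OF adj_ex] by (auto simp: mem_S point_def)

lemma S_nonempty [simp]: "S \<noteq> {}"
  using point_in_S by blast

subsection \<open>The metric\<close>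

lemma d_nonneg [simp]: "0 \<le> d x y"
  using \<Lambda>_pos by (simp add: seq_dist_def)

lemma d_self [simp]: "d x x = 0"
  by (simp add: seq_dist_def)

lemma d_sym: "d x y = d y x"
  by (simp add: seq_dist_def eq_commute)

lemma d_le: "agree n x y \<Longrightarrow> d x y \<le> \<Lambda> ^ n"
proof (cases "x = y")
  case False
  assume "agree n x y"
  moreover have "x (LEAST j. x j \<noteq> y j) \<noteq> y (LEAST j. x j \<noteq> y j)"
    using False LeastI_ex[of "\<lambda>j. x j \<noteq> y j"] by (auto simp: fun_eq_iff)
  ultimately have "n \<le> (LEAST j. x j \<noteq> y j)"
    unfolding agree_def by (meson not_le)
  then show ?thesis
    using False \<Lambda>_pos \<Lambda>_less_1 by (simp add: seq_dist_def power_decreasing)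
qed (use \<Lambda>_pos in simp)

lemma d_le_1: "d x y \<le> 1"
  using d_le[of 0 x y] by simp

lemma d_eq_1: "x 0 \<noteq> y 0 \<Longrightarrow> d x y = 1"
  by (auto simp: seq_dist_def Least_eq_0)

lemma d_less: "d x y < \<Lambda> ^ n \<Longrightarrow> agree (Suc n) x y"
proof (rule ccontr)
  assume l: "d x y < \<Lambda> ^ n" and "\<not> agree (Suc n) x y"
  then obtain j where j: "j \<le> n" "x j \<noteq> y j"
    by (auto simp: agree_def less_Suc_eq_le)
  then have "(LEAST j. x j \<noteq> y j) \<le> n"
    by (meson Least_le order_trans)
  then have "\<Lambda> ^ n \<le> d x y"
    using j \<Lambda>_pos \<Lambda>_less_1 by (auto simp: seq_dist_def intro!: power_decreasing)
  then show False
    using l by simp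
qed

lemma d_prepend [simp]: "d (prepend a x) (prepend a y) = \<Lambda> * d x y"
proof (cases "x = y")
  case False
  then obtain j where "x j \<noteq> y j"
    by blast
  then have "(LEAST j. prepend a x j \<noteq> prepend a y j) = Suc (LEAST j. x j \<noteq> y j)"
    by (subst Least_Suc[where n="Suc j"]) auto
  moreover have "prepend a x \<noteq> prepend a y"
    using False by (metis prepend_simps(3))
  ultimately show ?thesis
    using False by (simp add: seq_dist_def)
qed auto

lemma d_shift: "d (shift x) (shift y) \<le> d x y / \<Lambda>"
proof (cases "x 0 = y 0")
  case True
  have "d x y = d (prepend (x 0) (shift x)) (prepend (x 0) (shift y))"
    using True by (metis prepend_simps(4))
  also have "\<dots> = \<Lambda> * d (shift x) (shift y)"
    by (rule d_prepend)
  finally show ?thesis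
    using \<Lambda>_pos by simp
next
  case False
  then show ?thesis
    using d_le_1[of "shift x" "shift y"] \<Lambda>_pos \<Lambda>_less_1
    by (simp add: d_eq_1 field_simps mult_le_one)
qed

subsection \<open>Compactness\<close>

text \<open>
  Sequential compactness, read off the indicator sequences \<open>of_bool (X k j = b)\<close>: for each position
  \<open>j\<close> the limits of these over \<open>b\<close> add up to 1, so some letter \<open>b\<close> is eventually the \<open>j\<close>-th one.
\<close>

lemma S_cluster_point:
  assumes "\<And>k. X k \<in> S"
  obtains F x where "F \<noteq> bot" "F \<le> sequentially" "x \<in> S"
    "\<And>m. eventually (\<lambda>k::nat. agree m (X k) x) F"
proof -
  define a :: "nat \<times> 'r \<Rightarrow> nat \<Rightarrow> real" where "a = (\<lambda>(j, b) k. of_bool (X k j = b))"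
  have "bounded (range (a i))" for i
    by (rule boundedI[where B=1]) (auto simp: a_def split: prod.splits)
  then obtain F where F: "F \<noteq> bot" "F \<le> sequentially" "\<And>i. \<exists>l. (a i \<longlongrightarrow> l) F"
    using bounded_family_converges_along_filter[of a] by metis
  have "\<exists>b. eventually (\<lambda>k. X k j = b) F" for j
  proof -
    have "\<exists>b l. (a (j, b) \<longlongrightarrow> l) F \<and> l \<noteq> 0"
    proof (rule ccontr)
      assume "\<not> ?thesis"
      then have "(a (j, b) \<longlongrightarrow> 0) F" for b
        using F(3) by metis
      then have "((\<lambda>k. \<Sum>b\<in>UNIV. a (j, b) k) \<longlongrightarrow> (\<Sum>b\<in>(UNIV::'r set). 0)) F"
        by (intro tendsto_sum) auto
      moreover have "(\<lambda>k. \<Sum>b\<in>UNIV. a (j, b) k) = (\<lambda>k. 1)"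
        by (simp add: a_def of_bool_def)
      ultimately show False
        using F(1) by (simp add: tendsto_const_iff)
    qed
    then obtain b l where "(a (j, b) \<longlongrightarrow> l) F" "l \<noteq> 0"
      by blast
    then have "eventually (\<lambda>k. a (j, b) k \<noteq> 0) F"
      using tendsto_imp_eventually_ne by blast
    then show ?thesis
      by (auto simp: a_def elim!: eventually_mono)
  qed
  then obtain x where x: "\<And>j. eventually (\<lambda>k. X k j = x j) F"
    by metis
  have ag: "eventually (\<lambda>k. agree m (X k) x) F" for m
    unfolding agree_def using x by (simp add: eventually_ball_finite_distrib flip: lessThan_iff Ball_def)
  have "x \<in> S"
    unfolding mem_S
  proof
    fix j
    have "eventually (\<lambda>k. X k j = x j \<and> X k (Suc j) = x (Suc j)) F"
      using x by (simp add: eventually_conj_iff)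
    then obtain k where "X k j = x j" "X k (Suc j) = x (Suc j)"
      using F(1) eventually_happens' by blast
    then show "adj (x j) (x (Suc j))"
      using assms[of k] by (metis mem_S)
  qed
  then show thesis
    using that F ag by blast
qed

subsection \<open>Lipschitz functions\<close>

definition lip :: "real \<Rightarrow> ((nat \<Rightarrow> 'r) \<Rightarrow> real) \<Rightarrow> bool" where
  "lip K u \<longleftrightarrow> 0 \<le> K \<and> (\<forall>x\<in>S. \<forall>y\<in>S. \<bar>u x - u y\<bar> \<le> K * d x y)"

text \<open>
  Only points with the same first letter are compared. Such points have the same predecessors, so that
  transfer operators preserve this class with a fixed constant, while the oscillation between
  different letters has to be controlled by irreducibility.
\<close>

definition locally_lip :: "real \<Rightarrow> ((nat \<Rightarrow> 'r) \<Rightarrow> real) \<Rightarrow> bool" where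
  "locally_lip K u \<longleftrightarrow> 0 \<le> K \<and> (\<forall>x\<in>S. \<forall>y\<in>S. x 0 = y 0 \<longrightarrow> \<bar>u x - u y\<bar> \<le> K * d x y)"

lemma lip_imp_locally: "lip K u \<Longrightarrow> locally_lip K u"
  by (auto simp: lip_def locally_lip_def)

lemma locally_lip_bounded:
  assumes "locally_lip K u"
  obtains B where "0 \<le> B" "\<And>x. x \<in> S \<Longrightarrow> \<bar>u x\<bar> \<le> B"
proof
  let ?B = "K + (\<Sum>a\<in>UNIV. \<bar>u (point a)\<bar>)"
  have K: "0 \<le> K"
    using assms by (simp add: locally_lip_def)
  then show "0 \<le> ?B"
    by (simp add: sum_nonneg)
  fix x assume "x \<in> S"
  then have "\<bar>u x - u (point (x 0))\<bar> \<le> K * d x (point (x 0))"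
    using assms by (simp add: locally_lip_def)
  also have "\<dots> \<le> K"
    using d_le_1 K by (simp add: mult_left_le)
  finally have "\<bar>u x - u (point (x 0))\<bar> \<le> K" .
  moreover have "\<bar>u (point (x 0))\<bar> \<le> (\<Sum>a\<in>UNIV. \<bar>u (point a)\<bar>)"
    by (rule member_le_sum) auto
  ultimately show "\<bar>u x\<bar> \<le> ?B"
    by linarith
qed

lemma locally_lip_imp_lip:
  assumes "locally_lip K u"
  obtains K' where "lip K' u"
proof -
  obtain B where B: "0 \<le> B" "\<And>x. x \<in> S \<Longrightarrow> \<bar>u x\<bar> \<le> B"
    by (rule locally_lip_bounded[OF assms]) blast
  have K: "0 \<le> K"
    using assms by (simp add: locally_lip_def)
  have "\<bar>u x - u y\<bar> \<le> (K + 2 * B) * d x y" if "x \<in> S" "y \<in> S" for x y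
  proof (cases "x 0 = y 0")
    case True
    then have "\<bar>u x - u y\<bar> \<le> K * d x y"
      using assms that by (simp add: locally_lip_def)
    moreover have "0 \<le> 2 * B * d x y"
      using B by simp
    ultimately show ?thesis
      by (simp add: algebra_simps)
  next
    case False
    then show ?thesis
      using B(2)[OF that(1)] B(2)[OF that(2)] K by (simp add: d_eq_1)
  qed
  then have "lip (K + 2 * B) u"
    using K B by (simp add: lip_def)
  then show thesis
    by (rule that)
qed

lemma lip_bounded:
  assumes "lip K u"
  obtains B where "0 \<le> B" "\<And>x. x \<in> S \<Longrightarrow> \<bar>u x\<bar> \<le> B"
  by (rule locally_lip_bounded[OF lip_imp_locally[OF assms]]) (blast intro: that)

lemma lip_add: "lip K u \<Longrightarrow> lip K' v \<Longrightarrow> lip (K + K') (\<lambda>x. u x + v x)"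
  unfolding lip_def by (fastforce simp: algebra_simps intro: order_trans[OF abs_triangle_ineq4])

lemma lip_agree: "lip K u \<Longrightarrow> x \<in> S \<Longrightarrow> y \<in> S \<Longrightarrow> agree n x y \<Longrightarrow> \<bar>u x - u y\<bar> \<le> K * \<Lambda> ^ n"
  unfolding lip_def by (meson d_le mult_left_mono order_trans)

lemma lipschitz_functions_iff: "u \<in> lipschitz_functions \<Lambda> M \<longleftrightarrow> (\<exists>K. lip K u)"
proof -
  have "(\<exists>K. \<forall>x\<in>S. \<forall>y\<in>S. \<bar>u x - u y\<bar> \<le> K * d x y) \<longleftrightarrow> (\<exists>K. lip K u)" (is "?L \<longleftrightarrow> ?R")
  proof
    assume ?L
    then obtain K where K: "\<forall>x\<in>S. \<forall>y\<in>S. \<bar>u x - u y\<bar> \<le> K * d x y"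
      by blast
    have "lip \<bar>K\<bar> u"
      unfolding lip_def using K by (auto intro!: order_trans[OF K[rule_format]] mult_right_mono)
    then show ?R ..
  qed (auto simp: lip_def)
  then show ?thesis
    using \<Lambda>_pos \<Lambda>_less_1
    by (simp add: lipschitz_functions_def Lipschitz_continuous_map_def dist_real_def)
qed

lemma power_small:
  assumes "0 < e"
  obtains n where "K * \<Lambda> ^ n < e" "n > 0"
proof -
  have "(\<lambda>n. K * \<Lambda> ^ n) \<longlonglongrightarrow> K * 0"
    using \<Lambda>_pos \<Lambda>_less_1 by (intro tendsto_mult LIMSEQ_realpow_zero) auto
  then have "eventually (\<lambda>n. K * \<Lambda> ^ n < e \<and> n > 0) sequentially"
    using \<open>e > 0\<close> by (simp add: order_tendstoD(2) eventually_gt_at_top eventually_conj_iff)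
  then show thesis
    using that eventually_happens'[OF sequentially_bot] by blast
qed

lemma lip_cluster:
  assumes "lip K u" "F \<noteq> bot" "x \<in> S" "\<And>k. X k \<in> S" "\<And>m. eventually (\<lambda>k. agree m (X k) x) F"
  shows "((\<lambda>k. u (X k)) \<longlongrightarrow> u x) F"
proof (rule tendstoI)
  fix e :: real assume "e > 0"
  obtain n where n: "K * \<Lambda> ^ n < e"
    by (rule power_small[OF \<open>e > 0\<close>, of K]) blast
  show "eventually (\<lambda>k. dist (u (X k)) (u x) < e) F"
    using assms(5)[of n]
    by eventually_elim (use lip_agree[OF assms(1) assms(4) assms(3), of n] n in \<open>force simp: dist_real_def\<close>)
qed

lemma lip_attains_max:
  assumes "lip K u"
  obtains x where "x \<in> S" "\<And>y. y \<in> S \<Longrightarrow> u y \<le> u x"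
proof -
  obtain B where B: "\<And>x. x \<in> S \<Longrightarrow> \<bar>u x\<bar> \<le> B"
    by (metis lip_bounded[OF assms])
  have bdd: "bdd_above (u ` S)"
    using B by (intro bdd_aboveI2[where M=B]) fastforce
  define s where "s = (SUP y\<in>S. u y)"
  have "\<exists>x\<in>S. s - 1 / Suc k < u x" for k
    using less_cSUP_iff[OF S_nonempty bdd, of "s - 1 / Suc k"] by (auto simp: s_def)
  then obtain X where X: "\<And>k. X k \<in> S" "\<And>k. s - 1 / Suc k < u (X k)"
    by metis
  obtain F x where F: "F \<noteq> bot" "F \<le> sequentially" "x \<in> S" "\<And>m. eventually (\<lambda>k. agree m (X k) x) F"
    using S_cluster_point[of X] X(1) by blast
  have "((\<lambda>k. u (X k)) \<longlongrightarrow> u x) F"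
    by (rule lip_cluster[OF assms F(1,3) X(1) F(4)])
  moreover have "((\<lambda>k. s - 1 / Suc k) \<longlongrightarrow> s - 0) F"
    by (intro tendsto_diff tendsto_const tendsto_mono[OF F(2)] LIMSEQ_Suc lim_inverse_n')
  ultimately have "s - 0 \<le> u x"
    using X(2) F(1) by (intro tendsto_le[of F "\<lambda>k. u (X k)" "u x" "\<lambda>k. s - 1 / Suc k"])
      (auto intro!: always_eventually less_imp_le simp del: of_nat_Suc)
  then show thesis
    using that[OF F(3)] cSUP_upper[OF _ bdd] by (force simp: s_def)
qed

end

section \<open>Additive eigenfunctions of monotone operators\<close>

context symmetric_subshift
begin

text \<open>
  Total boundedness of the subshift, with words of length \<open>n\<close> in the role of balls.
\<close>

lemma finite_agree_net:
  obtains R where "finite R" "R \<subseteq> S" "\<And>x. x \<in> S \<Longrightarrow> \<exists>y\<in>R. agree n x y"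
proof
  let ?r = "\<lambda>f. SOME y. y \<in> S \<and> agree n f y"
  let ?R = "?r ` (\<Pi>\<^sub>E j\<in>{..<n}. UNIV) \<inter> S"
  show "finite ?R"
    by (intro finite_Int disjI1 finite_imageI finite_PiE) auto
  fix x assume "x \<in> S"
  define f where "f = restrict x {..<n}"
  have fx: "agree n f x"
    by (simp add: agree_def f_def)
  define y where "y = ?r f"
  have "y \<in> S \<and> agree n f y"
    unfolding y_def by (rule someI[of "\<lambda>y. y \<in> S \<and> agree n f y" x]) (rule conjI[OF \<open>x \<in> S\<close> fx])
  then have "y \<in> S" "agree n x y"
    using fx by (simp_all add: agree_def)
  moreover have "y \<in> ?r ` (\<Pi>\<^sub>E j\<in>{..<n}. UNIV)"
    unfolding y_def by (rule imageI) (auto simp: f_def split: if_splits)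
  ultimately show "\<exists>y\<in>?R. agree n x y"
    by blast
qed auto

lemma locally_lip_agree:
  assumes "locally_lip K u" "x \<in> S" "y \<in> S" "agree n x y" "n > 0"
  shows "\<bar>u x - u y\<bar> \<le> K * \<Lambda> ^ n"
proof -
  have "x 0 = y 0"
    using assms by (simp add: agree_def)
  then have "\<bar>u x - u y\<bar> \<le> K * d x y"
    using assms by (simp add: locally_lip_def)
  also have "\<dots> \<le> K * \<Lambda> ^ n"
    using assms by (intro mult_left_mono d_le) (auto simp: locally_lip_def)
  finally show ?thesis .
qed

text \<open>
  Arzela-Ascoli: pointwise limits along a filter are uniform, because equicontinuity reduces uniform
  closeness to a finite net. The additional sequence \<open>a\<close> is made to converge along the same filter.
\<close>

lemma locally_lip_compact:
  fixes v :: "nat \<Rightarrow> (nat \<Rightarrow> 'r) \<Rightarrow> real" and a :: "nat \<Rightarrow> real"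
  assumes v: "\<And>k. locally_lip K (v k)" and B: "\<And>k x. x \<in> S \<Longrightarrow> \<bar>v k x\<bar> \<le> B"
    and a: "bounded (range a)"
  obtains F w l where "F \<noteq> bot" "F \<le> sequentially" "locally_lip K w" "(a \<longlongrightarrow> l) F"
    "\<And>e. e > 0 \<Longrightarrow> eventually (\<lambda>k. \<forall>x\<in>S. \<bar>v k x - w x\<bar> \<le> e) F"
proof -
  define b where "b = (\<lambda>i k. case i of None \<Rightarrow> a k | Some x \<Rightarrow> if x \<in> S then v k x else 0)"
  have bd: "bounded (range (b i))" for i
  proof (cases i)
    case (Some x)
    then show ?thesis
      using B by (intro boundedI[where B="\<bar>B\<bar>"]) (auto simp: b_def intro: order_trans[OF B abs_ge_self] split: if_splits)
  qed (use a in \<open>simp add: b_def\<close>)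
  obtain F where F: "F \<noteq> bot" "F \<le> sequentially" "\<And>i. \<exists>l. (b i \<longlongrightarrow> l) F"
    using bounded_family_converges_along_filter[of b] bd by metis
  then obtain L where L: "\<And>i. (b i \<longlongrightarrow> L i) F"
    by metis
  define w where "w x = L (Some x)" for x
  have w: "((\<lambda>k. v k x) \<longlongrightarrow> w x) F" if "x \<in> S" for x
    using L[of "Some x"] that by (simp add: b_def w_def)
  have w_lip: "locally_lip K w"
    unfolding locally_lip_def
  proof (intro conjI ballI impI)
    show "0 \<le> K"
      using v by (simp add: locally_lip_def)
    fix x y assume xy: "x \<in> S" "y \<in> S" "x 0 = y 0"
    have "((\<lambda>k. \<bar>v k x - v k y\<bar>) \<longlongrightarrow> \<bar>w x - w y\<bar>) F"
      using xy by (intro tendsto_intros w)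
    then show "\<bar>w x - w y\<bar> \<le> K * d x y"
      using v xy by (intro tendsto_upperbound[OF _ _ F(1)]) (auto simp: locally_lip_def)
  qed
  have unif: "eventually (\<lambda>k. \<forall>x\<in>S. \<bar>v k x - w x\<bar> \<le> e) F" if "e > 0" for e
  proof -
    obtain n where n: "K * \<Lambda> ^ n < e / 3" "n > 0"
      by (rule power_small[of "e / 3" K]) (use \<open>e > 0\<close> in auto)
    obtain R where R: "finite R" "R \<subseteq> S" "\<And>x. x \<in> S \<Longrightarrow> \<exists>y\<in>R. agree n x y"
      by (rule finite_agree_net) blast
    have "eventually (\<lambda>k. \<bar>v k y - w y\<bar> < e / 3) F" if "y \<in> R" for y
      using tendstoD[OF w[of y], of "e / 3"] that R \<open>e > 0\<close> by (auto simp: dist_real_def)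
    then have "eventually (\<lambda>k. \<forall>y\<in>R. \<bar>v k y - w y\<bar> < e / 3) F"
      using R by (simp add: eventually_ball_finite_distrib)
    then show ?thesis
    proof (eventually_elim, intro ballI)
      fix k x assume k: "\<forall>y\<in>R. \<bar>v k y - w y\<bar> < e / 3" and "x \<in> S"
      then obtain y where y: "y \<in> R" "agree n x y" "y \<in> S"
        using R by blast
      have "\<bar>v k x - v k y\<bar> \<le> e / 3" "\<bar>w x - w y\<bar> \<le> e / 3"
        using locally_lip_agree[OF v \<open>x \<in> S\<close> y(3,2) n(2), of k]
          locally_lip_agree[OF w_lip \<open>x \<in> S\<close> y(3,2) n(2)] n(1) by auto
      moreover have "\<bar>v k y - w y\<bar> < e / 3"
        using k y by blast
      ultimately show "\<bar>v k x - w x\<bar> \<le> e"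
        by linarith
    qed
  qed
  have "(a \<longlongrightarrow> L None) F"
    using L[of None] by (simp add: b_def)
  then show thesis
    using that F w_lip unif by blast
qed

lemma uniform_limit_pointwise:
  assumes "\<And>e. e > 0 \<Longrightarrow> eventually (\<lambda>k. \<forall>x\<in>S. \<bar>v k x - w x\<bar> \<le> e) F" "x \<in> S"
  shows "((\<lambda>k. v k x) \<longlongrightarrow> (w x :: real)) F"
proof (rule tendstoI)
  fix e :: real assume "e > 0"
  then show "eventually (\<lambda>k. dist (v k x) (w x) < e) F"
    using assms(1)[of "e / 2"] assms(2) by (auto simp: dist_real_def elim!: eventually_mono)
qed

lemma locally_lip_scale: "locally_lip K u \<Longrightarrow> 0 \<le> c \<Longrightarrow> c \<le> 1 \<Longrightarrow> locally_lip K (\<lambda>x. c * u x)"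
  unfolding locally_lip_def
  by (auto simp: abs_mult simp flip: right_diff_distrib intro!: order_trans[OF mult_left_le_one_le])

lemma locally_lip_shift_const: "locally_lip K u \<Longrightarrow> locally_lip K (\<lambda>x. u x - c)"
  by (simp add: locally_lip_def)

text \<open>
  The operator \<open>u \<mapsto> T ((1 - e) * u)\<close> contracts the uniform distance by \<open>1 - e\<close>, so that its iterates
  \<open>u\<^sub>n\<close> starting at 0 move by at most \<open>(1 - e)\<^sup>n * b\<close>. Compactness gives a limit point, and because
  consecutive iterates get close it is a fixed point.
\<close>

lemma discounted_fixed_point:
  fixes T :: "((nat \<Rightarrow> 'r) \<Rightarrow> real) \<Rightarrow> ((nat \<Rightarrow> 'r) \<Rightarrow> real)"
  assumes K: "0 \<le> K"
    and T_lip: "\<And>u. locally_lip K u \<Longrightarrow> locally_lip K (T u)"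
    and T_nonexp: "\<And>u v c x. locally_lip K u \<Longrightarrow> locally_lip K v \<Longrightarrow>
        (\<And>x. x \<in> S \<Longrightarrow> \<bar>u x - v x\<bar> \<le> c) \<Longrightarrow> x \<in> S \<Longrightarrow> \<bar>T u x - T v x\<bar> \<le> c"
    and b: "\<And>x. x \<in> S \<Longrightarrow> \<bar>T (\<lambda>_. 0) x\<bar> \<le> b"
    and e: "0 < e" "e < 1"
  obtains u where "locally_lip K u" "\<And>x. x \<in> S \<Longrightarrow> T (\<lambda>x. (1 - e) * u x) x = u x"
    "\<And>x. x \<in> S \<Longrightarrow> \<bar>u x\<bar> \<le> b / e"
proof -
  define T' where "T' u = T (\<lambda>x. (1 - e) * u x)" for u
  define u where "u n = (T' ^^ n) (\<lambda>_. 0)" for n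
  have sc: "locally_lip K (\<lambda>x. (1 - e) * u x)" if "locally_lip K u" for u
    using locally_lip_scale[OF that] e by simp
  have T'_lip: "locally_lip K (T' u)" if "locally_lip K u" for u
    unfolding T'_def by (intro T_lip sc that)
  have T'_contr: "\<bar>T' u x - T' v x\<bar> \<le> (1 - e) * c"
    if "locally_lip K u" "locally_lip K v" "\<And>x. x \<in> S \<Longrightarrow> \<bar>u x - v x\<bar> \<le> c" "x \<in> S" for u v c x
    unfolding T'_def using e that
    by (intro T_nonexp sc) (auto simp: abs_mult simp flip: right_diff_distrib)
  have zero: "locally_lip K (\<lambda>_. 0)"
    using K by (simp add: locally_lip_def)
  have u_lip: "locally_lip K (u n)" for n
    by (induction n) (auto simp: u_def intro: zero T'_lip)
  have b0: "0 \<le> b"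
    using b[of "point undefined"] by force
  have u_step: "\<bar>u (Suc n) x - u n x\<bar> \<le> (1 - e) ^ n * b" if "x \<in> S" for n x
    using that
  proof (induction n arbitrary: x)
    case 0
    then show ?case
      using b by (simp add: u_def T'_def)
  next
    case (Suc n)
    have "\<bar>T' (u (Suc n)) x - T' (u n) x\<bar> \<le> (1 - e) * ((1 - e) ^ n * b)"
      using Suc by (intro T'_contr u_lip)
    then show ?case
      by (simp add: u_def mult.assoc)
  qed
  have u_bd: "\<bar>u n x\<bar> \<le> b / e" if "x \<in> S" for n x
    using that
  proof (induction n arbitrary: x)
    case 0
    then show ?case
      using b0 e by (simp add: u_def)
  next
    case (Suc n)
    have "\<bar>T' (u n) x - T' (\<lambda>_. 0) x\<bar> \<le> (1 - e) * (b / e)"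
      using Suc by (intro T'_contr u_lip zero) auto
    moreover have "\<bar>T' (\<lambda>_. 0) x\<bar> \<le> b"
      using b Suc.prems by (simp add: T'_def)
    moreover have "(1 - e) * (b / e) + b = b / e"
      using e by (simp add: field_simps)
    ultimately show ?case
      by (simp add: u_def)
  qed
  obtain F w where F: "F \<noteq> bot" "F \<le> sequentially" "locally_lip K w"
    and unif: "\<And>e. e > 0 \<Longrightarrow> eventually (\<lambda>k. \<forall>x\<in>S. \<bar>u k x - w x\<bar> \<le> e) F"
    by (rule locally_lip_compact[where v=u and a="\<lambda>_. 0", OF u_lip u_bd]) (auto intro: boundedI[where B=0])
  have uw: "((\<lambda>k. u k x) \<longlongrightarrow> w x) F" if "x \<in> S" for x
    using unif by (rule uniform_limit_pointwise[OF _ that])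
  show thesis
  proof
    show "locally_lip K w"
      by fact
    fix x assume x: "x \<in> S"
    show "\<bar>w x\<bar> \<le> b / e"
      using u_bd x by (intro tendsto_upperbound[OF tendsto_rabs[OF uw] _ F(1)]) auto
    have "((\<lambda>k. u (Suc k) x - u k x) \<longlongrightarrow> 0) F"
    proof (rule tendsto_mono[OF F(2)], rule Lim_null_comparison)
      show "eventually (\<lambda>k. norm (u (Suc k) x - u k x) \<le> (1 - e) ^ k * b) sequentially"
        using u_step[OF x] by simp
      show "(\<lambda>k. (1 - e) ^ k * b) \<longlonglongrightarrow> 0"
        using e by (intro tendsto_mult_left_zero LIMSEQ_realpow_zero) auto
    qed
    from tendsto_add[OF this uw[OF x]] have "((\<lambda>k. T' (u k) x) \<longlongrightarrow> w x) F"
      by (simp add: u_def)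
    moreover have "((\<lambda>k. T' (u k) x) \<longlongrightarrow> T' w x) F"
    proof (rule tendstoI)
      fix r :: real assume "r > 0"
      then have "eventually (\<lambda>k. \<forall>x\<in>S. \<bar>u k x - w x\<bar> \<le> r / 2) F"
        by (intro unif) auto
      then show "eventually (\<lambda>k. dist (T' (u k) x) (T' w x) < r) F"
      proof eventually_elim
        case (elim k)
        have "\<bar>T' (u k) x - T' w x\<bar> \<le> (1 - e) * (r / 2)"
          using elim x by (intro T'_contr u_lip F(3)) auto
        also have "\<dots> < 1 * r"
          using e \<open>r > 0\<close> by (intro mult_strict_mono) auto
        finally show ?case
          by (simp add: dist_real_def)
      qed
    qed
    ultimately show "T (\<lambda>x. (1 - e) * w x) x = w x"
      using tendsto_unique[OF F(1)] by (metis T'_def)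
  qed
qed

text \<open>
  The vanishing discount method. If \<open>u\<close> is a fixed point for the discount \<open>e\<close>, then \<open>v = u - u x\<^sub>0\<close>
  satisfies \<open>T ((1 - e) * v) = v + e * u x\<^sub>0\<close>. The functions \<open>v\<close> stay bounded by the assumption on
  oscillations, and \<open>e * u x\<^sub>0\<close> stays bounded by \<open>b\<close>, so both converge along a filter as \<open>e\<close> tends
  to 0. This argument is used for the transfer operator and then again for the nonlinear operator
  built from the pressure.
\<close>

theorem additive_eigenfunction:
  fixes T :: "((nat \<Rightarrow> 'r) \<Rightarrow> real) \<Rightarrow> ((nat \<Rightarrow> 'r) \<Rightarrow> real)"
  assumes K: "0 \<le> K"
    and T_lip: "\<And>u. locally_lip K u \<Longrightarrow> locally_lip K (T u)"
    and T_mono: "\<And>u v c x. locally_lip K u \<Longrightarrow> locally_lip K v \<Longrightarrow>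
        (\<And>x. x \<in> S \<Longrightarrow> u x \<le> v x + c) \<Longrightarrow> x \<in> S \<Longrightarrow> T u x \<le> T v x + c"
    and osc: "\<And>e u x y. 0 < e \<Longrightarrow> e < 1 \<Longrightarrow> locally_lip K u \<Longrightarrow>
        (\<And>x. x \<in> S \<Longrightarrow> T (\<lambda>x. (1 - e) * u x) x = u x) \<Longrightarrow> x \<in> S \<Longrightarrow> y \<in> S \<Longrightarrow> u x - u y \<le> B"
  obtains u c where "locally_lip K u" "\<And>x. x \<in> S \<Longrightarrow> T u x = u x + c"
proof -
  have T_nonexp: "\<bar>T u x - T v x\<bar> \<le> c" if "locally_lip K u" "locally_lip K v"
    "\<And>x. x \<in> S \<Longrightarrow> \<bar>u x - v x\<bar> \<le> c" "x \<in> S" for u v c x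
  proof -
    have "T u x \<le> T v x + c" "T v x \<le> T u x + c"
      using that by (fastforce intro!: T_mono simp: abs_le_iff)+
    then show ?thesis
      by linarith
  qed
  have zero: "locally_lip K (\<lambda>_. 0)"
    using K by (simp add: locally_lip_def)
  obtain b where b0: "0 \<le> b" and b: "\<And>x. x \<in> S \<Longrightarrow> \<bar>T (\<lambda>_. 0) x\<bar> \<le> b"
    by (rule locally_lip_bounded[OF T_lip[OF zero]]) blast
  define e where "e k = 1 / real (k + 2)" for k
  have e: "0 < e k" "e k < 1" for k
    by (auto simp: e_def)
  have "\<exists>u. locally_lip K u \<and> (\<forall>x\<in>S. T (\<lambda>x. (1 - e k) * u x) x = u x) \<and> (\<forall>x\<in>S. \<bar>u x\<bar> \<le> b / e k)" for k
    by (rule discounted_fixed_point[of K T b "e k", OF K T_lip T_nonexp b e]) blast+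
  then obtain u where u: "\<And>k. locally_lip K (u k)"
    and u_fix: "\<And>k x. x \<in> S \<Longrightarrow> T (\<lambda>x. (1 - e k) * u k x) x = u k x"
    and u_bd: "\<And>k x. x \<in> S \<Longrightarrow> \<bar>u k x\<bar> \<le> b / e k"
    by metis
  define x0 where "x0 = point (undefined :: 'r)"
  have x0: "x0 \<in> S"
    by (simp add: x0_def)
  define v where "v k x = u k x - u k x0" for k x
  define a where "a k = e k * u k x0" for k
  have v: "locally_lip K (v k)" for k
    unfolding v_def by (rule locally_lip_shift_const[OF u])
  have vB: "\<bar>v k x\<bar> \<le> B" if "x \<in> S" for k x
    using osc[OF e u u_fix that x0] osc[OF e u u_fix x0 that] by (simp add: v_def abs_le_iff)
  have v_eq: "T (\<lambda>x. (1 - e k) * v k x) x = v k x + a k" if "x \<in> S" for k x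
  proof -
    let ?c = "(1 - e k) * u k x0"
    have *: "locally_lip K (\<lambda>x. (1 - e k) * u k x)" "locally_lip K (\<lambda>x. (1 - e k) * v k x)"
      using e[of k] by (auto intro!: locally_lip_scale u v)
    have "T (\<lambda>x. (1 - e k) * u k x) x \<le> T (\<lambda>x. (1 - e k) * v k x) x + ?c"
      by (rule T_mono[OF * _ that]) (simp add: v_def algebra_simps)
    moreover have "T (\<lambda>x. (1 - e k) * v k x) x \<le> T (\<lambda>x. (1 - e k) * u k x) x + - ?c"
      by (rule T_mono[OF *(2,1) _ that]) (simp add: v_def algebra_simps)
    moreover have "u k x = v k x + u k x0" "?c = u k x0 - a k"
      by (simp_all add: v_def a_def algebra_simps)
    ultimately show ?thesis
      using u_fix[OF that, of k] by linarith
  qed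
  have "bounded (range a)"
  proof (rule boundedI[where B=b])
    fix y assume "y \<in> range a"
    then obtain k where "y = e k * u k x0"
      by (auto simp: a_def)
    then have "\<bar>y\<bar> = e k * \<bar>u k x0\<bar>"
      using e[of k] by (simp add: abs_mult)
    also have "\<dots> \<le> e k * (b / e k)"
      using e[of k] by (intro mult_left_mono u_bd x0) auto
    finally show "norm y \<le> b"
      using e[of k] by simp
  qed
  note bdd_a = this
  obtain F w c where F: "F \<noteq> bot" "F \<le> sequentially" and w: "locally_lip K w" and ac: "(a \<longlongrightarrow> c) F"
    and unif: "\<And>e. e > 0 \<Longrightarrow> eventually (\<lambda>k. \<forall>x\<in>S. \<bar>v k x - w x\<bar> \<le> e) F"
    by (rule locally_lip_compact[where v=v, OF v vB bdd_a]) blast+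
  have "T w x = w x + c" if x: "x \<in> S" for x
  proof -
    have vw: "((\<lambda>k. v k x) \<longlongrightarrow> w x) F"
      using unif by (rule uniform_limit_pointwise[OF _ x])
    have "((\<lambda>k. T (\<lambda>x. (1 - e k) * v k x) x) \<longlongrightarrow> T w x) F"
    proof (rule tendstoI)
      fix r :: real assume r: "r > 0"
      have "e \<longlonglongrightarrow> 0"
        unfolding e_def by (rule LIMSEQ_ignore_initial_segment[of "\<lambda>n. 1 / real n" 0 2, OF lim_inverse_n'])
      then have "((\<lambda>k. e k * B) \<longlongrightarrow> 0) F"
        by (intro tendsto_mult_left_zero tendsto_mono[OF F(2)])
      then have "eventually (\<lambda>k. e k * B < r / 3) F"
        using r by (intro order_tendstoD(2)) auto
      moreover have "eventually (\<lambda>k. \<forall>x\<in>S. \<bar>v k x - w x\<bar> \<le> r / 3) F"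
        using r by (intro unif) auto
      ultimately show "eventually (\<lambda>k. dist (T (\<lambda>x. (1 - e k) * v k x) x) (T w x) < r) F"
      proof eventually_elim
        case (elim k)
        have "\<bar>(1 - e k) * v k y - w y\<bar> \<le> 2 * r / 3" if "y \<in> S" for y
        proof -
          have "\<bar>e k * v k y\<bar> \<le> e k * B"
            using vB[OF that, of k] e[of k] by (simp add: abs_mult)
          moreover have "\<bar>v k y - w y\<bar> \<le> r / 3"
            using elim that by blast
          moreover have "(1 - e k) * v k y - w y = (v k y - w y) - e k * v k y"
            by (simp add: algebra_simps)
          ultimately show ?thesis
            using elim(1) by linarith
        qed
        then have "\<bar>T (\<lambda>x. (1 - e k) * v k x) x - T w x\<bar> \<le> 2 * r / 3"
          using e[of k] x by (intro T_nonexp locally_lip_scale v w) auto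
        then show ?case
          using r by (simp add: dist_real_def)
      qed
    qed
    moreover have "((\<lambda>k. T (\<lambda>x. (1 - e k) * v k x) x) \<longlongrightarrow> w x + c) F"
      unfolding v_eq[OF x] by (intro tendsto_add vw ac)
    ultimately show ?thesis
      by (rule tendsto_unique[OF F(1)])
  qed
  then show thesis
    using that w by blast
qed

end

section \<open>The transfer operator and the pressure\<close>

lemma ln_sum_exp_mono:
  fixes p q :: "'a \<Rightarrow> real"
  assumes "finite A" "A \<noteq> {}" "\<And>a. a \<in> A \<Longrightarrow> p a \<le> q a + c"
  shows "ln (\<Sum>a\<in>A. exp (p a)) \<le> ln (\<Sum>a\<in>A. exp (q a)) + c"
proof -
  have pos: "0 < (\<Sum>a\<in>A. exp (p a))" "0 < (\<Sum>a\<in>A. exp (q a))"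
    using assms by (auto intro: sum_pos)
  have "(\<Sum>a\<in>A. exp (p a)) \<le> (\<Sum>a\<in>A. exp (q a + c))"
    using assms by (intro sum_mono) auto
  also have "\<dots> = (\<Sum>a\<in>A. exp (q a)) * exp c"
    by (simp add: exp_add sum_distrib_right)
  finally have "ln (\<Sum>a\<in>A. exp (p a)) \<le> ln ((\<Sum>a\<in>A. exp (q a)) * exp c)"
    using pos by (subst ln_le_cancel_iff) auto
  then show ?thesis
    using pos by (simp add: ln_mult)
qed

lemma ln_sum_exp_eqD:
  fixes p q :: "'a \<Rightarrow> real"
  assumes "finite A" "\<And>a. a \<in> A \<Longrightarrow> p a \<le> q a + c"
    and eq: "ln (\<Sum>a\<in>A. exp (p a)) = ln (\<Sum>a\<in>A. exp (q a)) + c"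
    and a: "a \<in> A"
  shows "p a = q a + c"
proof (rule ccontr)
  assume ne: "p a \<noteq> q a + c"
  have pos: "0 < (\<Sum>a\<in>A. exp (p a))" "0 < (\<Sum>a\<in>A. exp (q a))"
    using assms(1) a by (auto intro!: sum_pos)
  have "(\<Sum>a\<in>A. exp (p a)) < (\<Sum>a\<in>A. exp (q a + c))"
    using assms(1,2) a ne by (intro sum_strict_mono_ex1) (auto intro!: bexI[OF _ a] simp: less_le)
  also have "\<dots> = (\<Sum>a\<in>A. exp (q a)) * exp c"
    by (simp add: exp_add sum_distrib_right)
  finally have "ln (\<Sum>a\<in>A. exp (p a)) < ln ((\<Sum>a\<in>A. exp (q a)) * exp c)"
    using pos by (subst ln_less_cancel_iff) auto
  then show False
    using pos eq by (simp add: ln_mult)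
qed

context symmetric_subshift
begin

text \<open>
  The Ruelle operator \<open>w \<mapsto> (\<Sum>a. exp (f (a x)) * w (a x))\<close> in the coordinate \<open>u = ln w\<close>. In this
  coordinate it is monotone and commutes with the addition of constants, and its eigenfunctions are
  solutions of \<open>log_transfer f u = u + c\<close>.
\<close>

definition log_transfer :: "((nat \<Rightarrow> 'r) \<Rightarrow> real) \<Rightarrow> ((nat \<Rightarrow> 'r) \<Rightarrow> real) \<Rightarrow> (nat \<Rightarrow> 'r) \<Rightarrow> real" where
  "log_transfer f u x = ln (\<Sum>a\<in>preds x. exp (f (prepend a x) + u (prepend a x)))"

lemma log_transfer_mono:
  assumes "\<And>x. x \<in> S \<Longrightarrow> u x \<le> v x + c" "x \<in> S"
  shows "log_transfer f u x \<le> log_transfer f v x + c"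
  unfolding log_transfer_def
  by (rule ln_sum_exp_mono) (use assms in \<open>auto simp: preds_nonempty simp del: preds_iff\<close>, simp add: assms)

text \<open>
  Prepending a letter multiplies distances by \<open>\<Lambda>\<close>, so the constant \<open>K\<close> of \<open>u\<close> turns into
  \<open>\<Lambda> * (L + K)\<close>.
\<close>

lemma log_transfer_locally_lip:
  assumes f: "lip L f" and u: "locally_lip K u" and K: "\<Lambda> * (L + K) \<le> K"
  shows "locally_lip K (log_transfer f u)"
proof -
  have K0: "0 \<le> K"
    using u by (simp add: locally_lip_def)
  have *: "log_transfer f u x \<le> log_transfer f u y + K * d x y" if "x \<in> S" "y \<in> S" "x 0 = y 0" for x y
  proof -
    have "f (prepend a x) + u (prepend a x) \<le> f (prepend a y) + u (prepend a y) + K * d x y"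
      if a: "adj a (x 0)" for a
    proof -
      have "\<bar>f (prepend a x) - f (prepend a y)\<bar> \<le> L * (\<Lambda> * d x y)"
        using f a \<open>x \<in> S\<close> \<open>y \<in> S\<close> \<open>x 0 = y 0\<close> unfolding lip_def by (metis d_prepend prepend_in_S)
      moreover have "\<bar>u (prepend a x) - u (prepend a y)\<bar> \<le> K * (\<Lambda> * d x y)"
        using u a \<open>x \<in> S\<close> \<open>y \<in> S\<close> \<open>x 0 = y 0\<close> unfolding locally_lip_def
        by (metis d_prepend prepend_in_S prepend_simps(1))
      moreover have "L * (\<Lambda> * d x y) + K * (\<Lambda> * d x y) \<le> K * d x y"
        using mult_right_mono[OF K d_nonneg[of x y]] by (simp add: algebra_simps)
      ultimately show ?thesis
        by linarith
    qed
    moreover have "preds y = preds x"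
      using that by (simp add: preds_def)
    ultimately show ?thesis
      unfolding log_transfer_def by (auto intro!: ln_sum_exp_mono)
  qed
  show ?thesis
    unfolding locally_lip_def
  proof (intro conjI ballI impI K0)
    fix x y assume "x \<in> S" "y \<in> S" "x 0 = y 0"
    then show "\<bar>log_transfer f u x - log_transfer f u y\<bar> \<le> K * d x y"
      using *[of x y] *[of y x] by (simp add: d_sym abs_le_iff)
  qed
qed

text \<open>
  Irreducibility in the form in which it bounds oscillations. A function that drops by at most \<open>C\<close>
  from a predecessor to its successor drops by at most \<open>N * C\<close> along a path of length at most \<open>N\<close>,
  and \<open>N\<close> can be chosen for all pairs of letters, all functions and all constants at once.
\<close>

lemma reach_any_letter_backwards:
  obtains N :: nat where
    "\<And>u C x a. 0 \<le> C \<Longrightarrow> (\<And>x a. x \<in> S \<Longrightarrow> adj a (x 0) \<Longrightarrow> u (prepend a x) - C \<le> u x) \<Longrightarrow> x \<in> S \<Longrightarrow>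
      \<exists>x'\<in>S. x' 0 = a \<and> u x' - real N * C \<le> u x"
proof -
  define P where "P a b n \<longleftrightarrow> (\<forall>u C x. 0 \<le> C \<longrightarrow> (\<forall>x a. x \<in> S \<longrightarrow> adj a (x 0) \<longrightarrow> u (prepend a x) - C \<le> u x) \<longrightarrow>
      x \<in> S \<longrightarrow> x 0 = b \<longrightarrow> (\<exists>x'\<in>S. x' 0 = a \<and> u x' - real n * C \<le> u x))"
    for a b and n :: nat
  have "\<exists>n. P a b n" for a b
    using adj_trancl[of a b]
  proof (induction rule: converse_trancl_induct)
    case (base a)
    have "P a b 1"
      unfolding P_def
    proof (intro allI impI)
      fix u :: "(nat \<Rightarrow> 'r) \<Rightarrow> real" and C x
      assume "\<forall>x a. x \<in> S \<longrightarrow> adj a (x 0) \<longrightarrow> u (prepend a x) - C \<le> u x" "x \<in> S" "x 0 = b"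
      then show "\<exists>x'\<in>S. x' 0 = a \<and> u x' - real 1 * C \<le> u x"
        using base by (intro bexI[of _ "prepend a x"]) auto
    qed
    then show ?case ..
  next
    case (step a c)
    then obtain n where n: "P c b n"
      by blast
    have "P a b (Suc n)"
      unfolding P_def
    proof (intro allI impI)
      fix u :: "(nat \<Rightarrow> 'r) \<Rightarrow> real" and C x
      assume u: "\<forall>x a. x \<in> S \<longrightarrow> adj a (x 0) \<longrightarrow> u (prepend a x) - C \<le> u x" and "x \<in> S" "x 0 = b" "0 \<le> C"
      then obtain y where y: "y \<in> S" "y 0 = c" "u y - real n * C \<le> u x"
        using n unfolding P_def by blast
      have "u (prepend a y) - C \<le> u y"
        using u y step(1) by auto
      then show "\<exists>x'\<in>S. x' 0 = a \<and> u x' - real (Suc n) * C \<le> u x"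
        using y step(1) by (intro bexI[of _ "prepend a y"]) (auto simp: algebra_simps)
    qed
    then show ?case ..
  qed
  then obtain n where n: "\<And>a b. P a b (n a b)"
    by metis
  define N where "N = (\<Sum>a\<in>UNIV. \<Sum>b\<in>UNIV. n a b)"
  have nN: "n a b \<le> N" for a b
  proof -
    have "n a b \<le> (\<Sum>b\<in>UNIV. n a b)"
      by (rule member_le_sum) auto
    also have "\<dots> \<le> N"
      unfolding N_def by (rule member_le_sum[of a UNIV "\<lambda>a. \<Sum>b\<in>UNIV. n a b"]) auto
    finally show ?thesis .
  qed
  show thesis
  proof (rule that[of N])
    fix u :: "(nat \<Rightarrow> 'r) \<Rightarrow> real" and C x a
    assume C: "0 \<le> C" and u: "\<And>x a. x \<in> S \<Longrightarrow> adj a (x 0) \<Longrightarrow> u (prepend a x) - C \<le> u x" and x: "x \<in> S"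
    then obtain y where y: "y \<in> S" "y 0 = a" "u y - real (n a (x 0)) * C \<le> u x"
      using n[of a "x 0"] unfolding P_def by blast
    have "real (n a (x 0)) * C \<le> real N * C"
      using nN C by (intro mult_right_mono) auto
    then show "\<exists>x'\<in>S. x' 0 = a \<and> u x' - real N * C \<le> u x"
      using y by (intro bexI[of _ y]) auto
  qed
qed

text \<open>
  Ruelle's theorem, by the vanishing discount method. Let \<open>b\<close> bound \<open>\<bar>f\<bar>\<close> and let \<open>s\<close> be the
  logarithm of the number of letters. A discounted fixed point \<open>u\<close> with maximum at \<open>m\<close> satisfies
  \<open>e * u m \<le> b + s\<close>, hence drops by at most \<open>C = 2 * b + s\<close> from a predecessor to its successor;
  walking back from any point to the first letter of \<open>m\<close> bounds its oscillation independently of \<open>e\<close>.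
\<close>

theorem log_transfer_eigenfunction:
  assumes f: "lip L f"
  obtains u c K where "lip K u" "\<And>x. x \<in> S \<Longrightarrow> log_transfer f u x = u x + c"
proof -
  \<comment> \<open>The solution of \<open>\<Lambda> * (L + K) = K\<close>.\<close>
  define K where "K = \<Lambda> * L / (1 - \<Lambda>)"
  have L: "0 \<le> L"
    using f by (simp add: lip_def)
  have K0: "0 \<le> K" and K: "\<Lambda> * (L + K) \<le> K"
    using L \<Lambda>_pos \<Lambda>_less_1 by (auto simp: K_def field_simps)
  obtain b where b0: "0 \<le> b" and b: "\<And>x. x \<in> S \<Longrightarrow> \<bar>f x\<bar> \<le> b"
    by (rule lip_bounded[OF f]) blast
  obtain N where N: "\<And>u C x a. 0 \<le> C \<Longrightarrow> (\<And>x a. x \<in> S \<Longrightarrow> adj a (x 0) \<Longrightarrow> u (prepend a x) - C \<le> u x) \<Longrightarrow> x \<in> S \<Longrightarrow>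
      \<exists>x'\<in>S. x' 0 = a \<and> u x' - real N * C \<le> u x"
    by (rule reach_any_letter_backwards) blast
  define s where "s = ln (real CARD('r))"
  have s0: "0 \<le> s"
    by (simp add: s_def)
  define C where "C = 2 * b + s"
  have osc: "u x - u y \<le> K + real N * C"
    if e: "0 < e" "e < 1" and u: "locally_lip K u"
      and fix_u: "\<And>x. x \<in> S \<Longrightarrow> log_transfer f (\<lambda>x. (1 - e) * u x) x = u x" and xy: "x \<in> S" "y \<in> S"
    for e u x y
  proof -
    obtain K' where "lip K' u"
      by (rule locally_lip_imp_lip[OF u])
    then obtain m where m: "m \<in> S" "\<And>y. y \<in> S \<Longrightarrow> u y \<le> u m"
      by (rule lip_attains_max) blast
    have "(\<Sum>a\<in>preds m. exp (f (prepend a m) + (1 - e) * u (prepend a m)))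
        \<le> (\<Sum>a\<in>preds m. exp (b + (1 - e) * u m))"
      using m b e by (intro sum_mono) (force intro!: add_mono mult_left_mono simp: abs_le_iff)
    also have "\<dots> \<le> real CARD('r) * exp (b + (1 - e) * u m)"
      by (simp add: card_mono)
    finally have "u m \<le> ln (real CARD('r) * exp (b + (1 - e) * u m))"
      unfolding fix_u[OF m(1), symmetric] log_transfer_def
      by (subst ln_le_cancel_iff) (auto intro!: sum_pos)
    then have em: "e * u m \<le> b + s"
      by (simp add: ln_mult s_def algebra_simps)
    have step: "u (prepend a x) - C \<le> u x" if "x \<in> S" "adj a (x 0)" for x a
    proof -
      let ?z = "prepend a x"
      have z: "?z \<in> S"
        using that by simp
      have "exp (f ?z + (1 - e) * u ?z) \<le> (\<Sum>a\<in>preds x. exp (f (prepend a x) + (1 - e) * u (prepend a x)))"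
        using that by (intro member_le_sum) auto
      then have "ln (exp (f ?z + (1 - e) * u ?z)) \<le> u x"
        unfolding fix_u[OF that(1), symmetric] log_transfer_def
        by (subst ln_le_cancel_iff) (auto intro!: sum_pos)
      then have "f ?z + (1 - e) * u ?z \<le> u x"
        by simp
      moreover have "e * u ?z \<le> e * u m"
        using m(2)[OF z] e by simp
      moreover have "- b \<le> f ?z"
        using b[OF z] by linarith
      ultimately show ?thesis
        using em by (simp add: C_def algebra_simps)
    qed
    have C: "0 \<le> C"
      using b0 s0 by (simp add: C_def)
    obtain z where z: "z \<in> S" "z 0 = m 0" "u z - real N * C \<le> u y"
      using N[OF C step xy(2), of "m 0"] by blast
    have "\<bar>u m - u z\<bar> \<le> K * d m z"
      using u m(1) z(1,2) by (simp add: locally_lip_def)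
    also have "\<dots> \<le> K"
      using K0 d_le_1 by (simp add: mult_left_le)
    finally show ?thesis
      using z m(2)[OF xy(1)] by linarith
  qed
  obtain u c where u: "locally_lip K u" "\<And>x. x \<in> S \<Longrightarrow> log_transfer f u x = u x + c"
  proof (rule additive_eigenfunction[of K "log_transfer f", OF K0])
    show "locally_lip K (log_transfer f u)" if "locally_lip K u" for u
      by (rule log_transfer_locally_lip[OF f that K])
    show "log_transfer f u x \<le> log_transfer f v x + c"
      if "\<And>x. x \<in> S \<Longrightarrow> u x \<le> v x + c" "x \<in> S" for u v c x
      by (rule log_transfer_mono[OF that])
  qed (use osc in blast)+
  obtain K' where "lip K' u"
    by (rule locally_lip_imp_lip[OF u(1)])
  then show thesis
    using that u(2) by blast
qed

text \<open>
  Backward orbits are dense: prepending a path that ends in the first letter of \<open>x0\<close> leads into any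
  cylinder.
\<close>

lemma agree_backward_closed:
  assumes "x0 \<in> E" "E \<subseteq> S" and closed: "\<And>x a. x \<in> E \<Longrightarrow> adj a (x 0) \<Longrightarrow> prepend a x \<in> E"
    and z: "z \<in> S"
  shows "\<exists>e\<in>E. agree (Suc n) e z"
  using z
proof (induction n arbitrary: z)
  case 0
  have "\<exists>e\<in>E. e 0 = a" for a
    using adj_trancl[of a "x0 0"]
  proof (induction rule: converse_trancl_induct)
    case (base a)
    then show ?case
      using closed[OF assms(1), of a] by (intro bexI[of _ "prepend a x0"]) auto
  next
    case (step a c)
    then obtain e where "e \<in> E" "e 0 = c"
      by blast
    then show ?case
      using step(1) closed[of e a] by (intro bexI[of _ "prepend a e"]) auto
  qed
  then show ?case
    by (auto simp: agree_def)
next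
  case (Suc n)
  then obtain e where e: "e \<in> E" "agree (Suc n) e (shift z)"
    using shift_in_S by blast
  then have "e 0 = z 1"
    by (simp add: agree_Suc)
  then have "prepend (z 0) e \<in> E"
    using Suc.prems e by (intro closed) (auto simp: mem_S)
  moreover have "agree (Suc (Suc n)) (prepend (z 0) e) z"
    using e by (subst agree_Suc) simp
  ultimately show ?case
    by blast
qed

text \<open>
  Let \<open>s = u m - v m\<close> be the maximum of \<open>u - v\<close>. At \<open>m\<close> every summand of the transfer sum for \<open>(f, u)\<close>
  is at most the one for \<open>(g, v)\<close> times \<open>exp (s + t)\<close>, which compares the eigenvalues. If the eigenvalues are equal, the
  sums are equal and therefore all summands are: \<open>f = g + t\<close> holds at the predecessors of \<open>m\<close>, and
  these are again maximum points. So \<open>f = g + t\<close> holds on the backward orbit of \<open>m\<close>, which is dense.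
\<close>

theorem eigenvalue_comparison:
  assumes f: "lip Kf f" and g: "lip Kg g" and u: "lip Ku u" and v: "lip Kv v"
    and eig_u: "\<And>x. x \<in> S \<Longrightarrow> log_transfer f u x = u x + c"
    and eig_v: "\<And>x. x \<in> S \<Longrightarrow> log_transfer g v x = v x + c'"
    and le: "\<And>x. x \<in> S \<Longrightarrow> f x \<le> g x + t"
  shows "c \<le> c' + t" and "c = c' + t \<Longrightarrow> z \<in> S \<Longrightarrow> f z = g z + t"
proof -
  have "lip (Ku + Kv) (\<lambda>x. u x + - v x)"
    using v by (intro lip_add u) (auto simp: lip_def abs_minus_commute)
  then obtain m where m: "m \<in> S" "\<And>x. x \<in> S \<Longrightarrow> u x + - v x \<le> u m + - v m"
    by (rule lip_attains_max) blast
  define s where "s = u m - v m"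
  have uv: "u x \<le> v x + s" if "x \<in> S" for x
    using m(2)[OF that] by (simp add: s_def)
  have pq: "f (prepend a x) + u (prepend a x) \<le> g (prepend a x) + v (prepend a x) + (s + t)"
    if "x \<in> S" "a \<in> preds x" for a x
    using le[of "prepend a x"] uv[of "prepend a x"] that by simp
  have "log_transfer f u m \<le> log_transfer g v m + (s + t)"
    unfolding log_transfer_def by (intro ln_sum_exp_mono pq m) auto
  then show "c \<le> c' + t"
    by (simp add: eig_u eig_v m s_def)
  assume c: "c = c' + t" and z: "z \<in> S"
  \<comment> \<open>The set of maximum points of \<open>u - v\<close>.\<close>
  define E where "E = {x \<in> S. u x = v x + s}"
  have tight: "f (prepend a x) = g (prepend a x) + t \<and> prepend a x \<in> E" if "x \<in> E" "adj a (x 0)" for x a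
  proof -
    have x: "x \<in> S" "u x = v x + s"
      using that by (auto simp: E_def)
    have eq: "log_transfer f u x = log_transfer g v x + (s + t)"
      by (simp add: eig_u eig_v x c)
    have "f (prepend a x) + u (prepend a x) = g (prepend a x) + v (prepend a x) + (s + t)"
      by (rule ln_sum_exp_eqD[OF finite_preds pq[OF x(1)] eq[unfolded log_transfer_def]]) (simp_all add: that(2))
    moreover have w: "prepend a x \<in> S"
      using x that(2) by simp
    ultimately have "f (prepend a x) = g (prepend a x) + t" "u (prepend a x) = v (prepend a x) + s"
      using le[OF w] uv[OF w] by linarith+
    then show ?thesis
      using w by (simp add: E_def)
  qed
  have mE: "m \<in> E"
    using m by (simp add: E_def s_def)
  have "\<bar>f z - (g z + t)\<bar> \<le> (Kf + Kg) * \<Lambda> ^ Suc n" for n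
  proof -
    obtain e where e: "e \<in> E" "agree (Suc n) e (shift z)"
      using agree_backward_closed[OF mE, of "shift z" n] tight z by (auto simp: E_def)
    have az: "adj (z 0) (e 0)"
      using e z by (auto simp: agree_Suc mem_S)
    let ?w = "prepend (z 0) e"
    have w: "f ?w = g ?w + t" "?w \<in> S"
      using tight[OF e(1) az] by (auto simp: E_def)
    have "agree (Suc (Suc n)) z ?w"
      using e by (subst agree_Suc) (simp add: agree_sym)
    then have "agree (Suc n) z ?w"
      by (rule agree_mono) simp
    then have "\<bar>f z - f ?w\<bar> \<le> Kf * \<Lambda> ^ Suc n" "\<bar>g z - g ?w\<bar> \<le> Kg * \<Lambda> ^ Suc n"
      using lip_agree[OF f z w(2)] lip_agree[OF g z w(2)] by blast+
    then show ?thesis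
      using w by (simp only: distrib_right)
  qed
  moreover have "(\<lambda>n. (Kf + Kg) * \<Lambda> ^ Suc n) \<longlonglongrightarrow> (Kf + Kg) * 0"
    using \<Lambda>_pos \<Lambda>_less_1 by (intro tendsto_mult tendsto_const LIMSEQ_Suc LIMSEQ_realpow_zero) auto
  ultimately have "\<bar>f z - (g z + t)\<bar> \<le> (Kf + Kg) * 0"
    by (intro tendsto_lowerbound[of _ _ sequentially]) auto
  then show "f z = g z + t"
    by simp
qed

text \<open>
  The logarithm of the leading eigenvalue of the Ruelle operator. For Lipschitz \<open>f\<close> such a number
  exists, and by the comparison of eigenvalues it is unique.
\<close>

definition pressure :: "((nat \<Rightarrow> 'r) \<Rightarrow> real) \<Rightarrow> real" where
  "pressure f = (SOME c. \<exists>K u. lip K u \<and> (\<forall>x\<in>S. log_transfer f u x = u x + c))"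

lemma pressure_eigenfunction:
  assumes "lip L f"
  obtains u K where "lip K u" "\<And>x. x \<in> S \<Longrightarrow> log_transfer f u x = u x + pressure f"
proof -
  have "\<exists>c K u. lip K u \<and> (\<forall>x\<in>S. log_transfer f u x = u x + c)"
    by (rule log_transfer_eigenfunction[OF assms]) blast
  then have "\<exists>K u. lip K u \<and> (\<forall>x\<in>S. log_transfer f u x = u x + pressure f)"
    unfolding pressure_def by (rule someI_ex)
  then show thesis
    using that by blast
qed

text \<open>
  The strict part (equal pressures force equal potentials) is what makes the solution of the nonlinear
  problem unique.
\<close>

lemma pressure_mono:
  assumes f: "lip Kf f" and g: "lip Kg g" and le: "\<And>x. x \<in> S \<Longrightarrow> f x \<le> g x + t"
  shows "pressure f \<le> pressure g + t"
    and "pressure f = pressure g + t \<Longrightarrow> z \<in> S \<Longrightarrow> f z = g z + t"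
proof -
  obtain u Ku where u: "lip Ku u" "\<And>x. x \<in> S \<Longrightarrow> log_transfer f u x = u x + pressure f"
    by (rule pressure_eigenfunction[OF f]) blast
  obtain v Kv where v: "lip Kv v" "\<And>x. x \<in> S \<Longrightarrow> log_transfer g v x = v x + pressure g"
    by (rule pressure_eigenfunction[OF g]) blast
  note cmp = eigenvalue_comparison[OF f g u(1) v(1) u(2) v(2) le]
  show "pressure f \<le> pressure g + t"
    by (rule cmp(1))
  show "pressure f = pressure g + t \<Longrightarrow> z \<in> S \<Longrightarrow> f z = g z + t"
    by (rule cmp(2))
qed

end

section \<open>The nonlinear eigenvalue problem for the pressure\<close>

context symmetric_subshift
begin

text \<open>
  At a maximum point \<open>m\<close> of \<open>\<phi> - \<psi>\<close> the potential \<open>E m + \<phi>\<close> lies below \<open>E m + \<psi> + (\<phi> m - \<psi> m)\<close>.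
  Monotonicity of the pressure gives \<open>c \<le> c'\<close>, and by symmetry \<open>c = c'\<close>; then the two pressures are
  equal, and strict monotonicity gives \<open>\<phi> = \<psi> + (\<phi> m - \<psi> m)\<close> everywhere.
\<close>

lemma pressure_problem_unique:
  assumes E: "\<And>y. y \<in> S \<Longrightarrow> \<exists>L. lip L (E y)"
    and \<phi>: "lip K \<phi>" "\<And>y. y \<in> S \<Longrightarrow> pressure (\<lambda>x. E y x + \<phi> x) = \<phi> y + c"
    and \<psi>: "lip K' \<psi>" "\<And>y. y \<in> S \<Longrightarrow> pressure (\<lambda>x. E y x + \<psi> x) = \<psi> y + c'"
  shows "c' = c \<and> (\<exists>k. \<forall>x\<in>S. \<psi> x = \<phi> x + k)"
proof -
  have *: "c \<le> c' \<and> (c = c' \<longrightarrow> (\<exists>k. \<forall>x\<in>S. \<phi> x = \<psi> x + k))"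
    if \<phi>: "lip K \<phi>" "\<And>y. y \<in> S \<Longrightarrow> pressure (\<lambda>x. E y x + \<phi> x) = \<phi> y + c"
      and \<psi>: "lip K' \<psi>" "\<And>y. y \<in> S \<Longrightarrow> pressure (\<lambda>x. E y x + \<psi> x) = \<psi> y + c'"
    for \<phi> \<psi> K K' c c'
  proof -
    have "lip (K + K') (\<lambda>x. \<phi> x + - \<psi> x)"
      using \<psi>(1) by (intro lip_add \<phi>(1)) (auto simp: lip_def abs_minus_commute)
    then obtain m where m: "m \<in> S" "\<And>x. x \<in> S \<Longrightarrow> \<phi> x + - \<psi> x \<le> \<phi> m + - \<psi> m"
      by (rule lip_attains_max) blast
    obtain L where L: "lip L (E m)"
      using E m(1) by blast
    have le: "E m x + \<phi> x \<le> E m x + \<psi> x + (\<phi> m - \<psi> m)" if "x \<in> S" for x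
      using m(2)[OF that] by simp
    note cmp = pressure_mono[OF lip_add[OF L \<phi>(1)] lip_add[OF L \<psi>(1)] le]
    have "c \<le> c'"
      using cmp(1) by (simp add: \<phi>(2) \<psi>(2) m)
    moreover have "\<phi> x = \<psi> x + (\<phi> m - \<psi> m)" if "c = c'" "x \<in> S" for x
      using cmp(2)[OF _ _ that(2)] that(1) by (simp add: \<phi>(2) \<psi>(2) m)
    ultimately show ?thesis
      by blast
  qed
  have "c \<le> c'" "c' \<le> c"
    using *[OF \<phi> \<psi>] *[OF \<psi> \<phi>] by auto
  then show ?thesis
    using *[OF \<psi> \<phi>] by auto
qed

text \<open>
  The operator \<open>T \<phi> y = pressure (E y + \<phi>)\<close> is monotone and commutes with constants. Its values are
  Lipschitz with the constant of \<open>E\<close> in \<open>y\<close> and oscillate by at most \<open>2 * B\<close>, whatever \<open>\<phi>\<close> is, so the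
  vanishing discount method applies.
\<close>

lemma pressure_problem_solvable:
  assumes E: "\<And>y. y \<in> S \<Longrightarrow> \<exists>L. lip L (E y)"
    and K: "0 \<le> K" "\<And>x y y'. x \<in> S \<Longrightarrow> y \<in> S \<Longrightarrow> y' \<in> S \<Longrightarrow> y 0 = y' 0 \<Longrightarrow> E y x \<le> E y' x + K * d y y'"
    and B: "\<And>x y. x \<in> S \<Longrightarrow> y \<in> S \<Longrightarrow> \<bar>E y x\<bar> \<le> B"
  obtains \<phi> K' c where "lip K' \<phi>" "\<And>y. y \<in> S \<Longrightarrow> pressure (\<lambda>x. E y x + \<phi> x) = \<phi> y + c"
proof -
  define T where "T \<phi> y = pressure (\<lambda>x. E y x + \<phi> x)" for \<phi> y
  have lipE: "\<exists>L. lip L (\<lambda>x. E y x + \<phi> x)" if "y \<in> S" and \<phi>: "locally_lip K \<phi>" for y \<phi>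
  proof -
    obtain L where "lip L (E y)"
      using E \<open>y \<in> S\<close> by blast
    moreover obtain L' where "lip L' \<phi>"
      by (rule locally_lip_imp_lip[OF \<phi>])
    ultimately show ?thesis
      using lip_add by blast
  qed
  have T_le: "T \<phi> y \<le> T \<psi> y' + t" if y: "y \<in> S" "y' \<in> S" and lip: "locally_lip K \<phi>" "locally_lip K \<psi>"
    and le: "\<And>x. x \<in> S \<Longrightarrow> E y x + \<phi> x \<le> E y' x + \<psi> x + t" for \<phi> \<psi> y y' t
  proof -
    obtain L1 L2 where "lip L1 (\<lambda>x. E y x + \<phi> x)" "lip L2 (\<lambda>x. E y' x + \<psi> x)"
      using lipE y lip by blast
    then show ?thesis
      unfolding T_def by (rule pressure_mono(1)) (rule le)
  qed
  obtain \<phi> c where \<phi>: "locally_lip K \<phi>" "\<And>y. y \<in> S \<Longrightarrow> T \<phi> y = \<phi> y + c"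
  proof (rule additive_eigenfunction[of K T, OF K(1)])
    fix u :: "(nat \<Rightarrow> 'r) \<Rightarrow> real" assume u: "locally_lip K u"
    show "locally_lip K (T u)"
      unfolding locally_lip_def
    proof (intro conjI ballI impI K(1))
      fix y y' assume "y \<in> S" "y' \<in> S" "y 0 = y' 0"
      then have "T u y \<le> T u y' + K * d y y'" "T u y' \<le> T u y + K * d y' y"
        using K(2) by (auto intro!: T_le u)
      then show "\<bar>T u y - T u y'\<bar> \<le> K * d y y'"
        by (simp add: d_sym abs_le_iff)
    qed
  next
    fix u v c y
    assume "locally_lip K u" "locally_lip K v" "\<And>x. x \<in> S \<Longrightarrow> u x \<le> v x + c" "y \<in> S"
    then show "T u y \<le> T v y + c"
      by (intro T_le) auto
  next
    fix e u y y'
    assume e: "0 < e" "e < 1" and u: "locally_lip K u"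
      and fix_u: "\<And>x. x \<in> S \<Longrightarrow> T (\<lambda>x. (1 - e) * u x) x = u x" and y: "y \<in> S" "y' \<in> S"
    have "T (\<lambda>x. (1 - e) * u x) y \<le> T (\<lambda>x. (1 - e) * u x) y' + 2 * B"
      using B[OF _ y(1)] B[OF _ y(2)] e
      by (intro T_le locally_lip_scale u y) (force simp: abs_le_iff)+
    then show "u y - u y' \<le> 2 * B"
      by (simp add: fix_u y)
  qed (use that in blast)
  obtain K' where "lip K' \<phi>"
    by (rule locally_lip_imp_lip[OF \<phi>(1)])
  then show thesis
    using that \<phi>(2) by (simp add: T_def)
qed

text \<open>
  Where \<open>y\<close> and \<open>x\<close> cannot be glued the extension is 0, and whether they can be glued depends on
  their first letters only; so the extension inherits the local Lipschitz bounds of \<open>A\<close> in each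
  variable.
\<close>

lemma zero_extension_lipschitz:
  assumes "Lipschitz_continuous_map (hat_metric \<Lambda> M) euclidean_metric A"
  obtains K B where "0 \<le> K" "\<And>y. y \<in> S \<Longrightarrow> \<exists>L. lip L (zero_extension M A y)"
    "\<And>x y y'. x \<in> S \<Longrightarrow> y \<in> S \<Longrightarrow> y' \<in> S \<Longrightarrow> y 0 = y' 0 \<Longrightarrow>
      zero_extension M A y x \<le> zero_extension M A y' x + K * d y y'"
    "\<And>x y. x \<in> S \<Longrightarrow> y \<in> S \<Longrightarrow> \<bar>zero_extension M A y x\<bar> \<le> B"
proof -
  have hat: "(y, x) \<in> hat_subshift M \<longleftrightarrow> y \<in> S \<and> x \<in> S \<and> adj (y 0) (x 0)" for x y
    by (simp add: hat_subshift_def dual_S adj_def)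
  obtain K0 where K0: "\<And>p q. p \<in> hat_subshift M \<Longrightarrow> q \<in> hat_subshift M \<Longrightarrow> \<bar>A p - A q\<bar> \<le> K0 * pair_dist \<Lambda> p q"
    using assms \<Lambda>_pos \<Lambda>_less_1 by (auto simp: Lipschitz_continuous_map_def dist_real_def)
  define K where "K = \<bar>K0\<bar>"
  have K: "\<bar>A (y, x) - A (y', x')\<bar> \<le> K * max (d y y') (d x x')"
    if "y \<in> S" "x \<in> S" "adj (y 0) (x 0)" "y' \<in> S" "x' \<in> S" "adj (y' 0) (x' 0)" for x y x' y'
  proof -
    have "\<bar>A (y, x) - A (y', x')\<bar> \<le> K0 * max (d y y') (d x x')"
      using K0[of "(y, x)" "(y', x')"] that by (simp add: hat pair_dist_def)
    also have "\<dots> \<le> K * max (d y y') (d x x')"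
      unfolding K_def by (intro mult_right_mono) (auto simp: le_max_iff_disj)
    finally show ?thesis .
  qed
  have K_nonneg: "0 \<le> K"
    by (simp add: K_def)
  define E where "E = zero_extension M A"
  have E: "E y x = (if adj (y 0) (x 0) then A (y, x) else 0)" for x y
    using not_adj by (auto simp: E_def zero_extension_def adj_def)
  define B where "B = K + (\<Sum>a\<in>UNIV. \<Sum>b\<in>UNIV. \<bar>A (point a, point b)\<bar>)"
  have sum_nonneg: "0 \<le> (\<Sum>a\<in>UNIV. \<Sum>b\<in>UNIV. \<bar>A (point a, point b)\<bar>)"
    by (intro sum_nonneg) auto
  have B: "\<bar>E y x\<bar> \<le> B" if "x \<in> S" "y \<in> S" for x y
  proof (cases "adj (y 0) (x 0)")
    case True
    have "\<bar>A (y, x) - A (point (y 0), point (x 0))\<bar> \<le> K * max (d y (point (y 0))) (d x (point (x 0)))"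
      using that True by (intro K) auto
    also have "\<dots> \<le> K"
      using K_nonneg d_le_1 by (simp add: mult_left_le)
    finally have "\<bar>A (y, x) - A (point (y 0), point (x 0))\<bar> \<le> K" .
    moreover have "\<bar>A (point (y 0), point (x 0))\<bar> \<le> (\<Sum>b\<in>UNIV. \<bar>A (point (y 0), point b)\<bar>)"
      by (rule member_le_sum[of "x 0" UNIV "\<lambda>b. \<bar>A (point (y 0), point b)\<bar>"]) auto
    moreover have "\<dots> \<le> (\<Sum>a\<in>UNIV. \<Sum>b\<in>UNIV. \<bar>A (point a, point b)\<bar>)"
      by (rule member_le_sum[of "y 0" UNIV "\<lambda>a. \<Sum>b\<in>UNIV. \<bar>A (point a, point b)\<bar>"]) (auto intro: Groups_Big.sum_nonneg)
    ultimately show ?thesis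
      using True by (simp add: E B_def)
  next
    case False
    then show ?thesis
      using K_nonneg sum_nonneg by (simp add: E B_def)
  qed
  show thesis
  proof (rule that[of K B, folded E_def])
    show "0 \<le> K" by fact
    show "\<bar>E y x\<bar> \<le> B" if "x \<in> S" "y \<in> S" for x y
      using B that .
    show "E y x \<le> E y' x + K * d y y'" if "x \<in> S" "y \<in> S" "y' \<in> S" "y 0 = y' 0" for x y y'
      using K[of y x y' x] that K_nonneg by (auto simp: E max_absorb1)
    show "\<exists>L. lip L (E y)" if "y \<in> S" for y
    proof -
      have "\<bar>E y x - E y x'\<bar> \<le> K * d x x'" if "x \<in> S" "x' \<in> S" "x 0 = x' 0" for x x'
        using K[of y x y x'] that \<open>y \<in> S\<close> K_nonneg by (auto simp: E max_absorb2)
      then have "locally_lip K (E y)"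
        using K_nonneg by (simp add: locally_lip_def)
      then show ?thesis
        by (metis locally_lip_imp_lip)
    qed
  qed
qed

end

section \<open>Entropy of finite-valued observables\<close>

text \<open>
  A finite partition is handled as the family of level sets of an observable. The entropy then depends
  only on the equality kernel of the observable, and joint refinements are pairs of observables.
\<close>

definition fibres :: "'a set \<Rightarrow> ('a \<Rightarrow> 'b) \<Rightarrow> 'a set set" where
  "fibres S X = (\<lambda>x. {y \<in> S. X y = X x}) ` S"

definition observable_entropy :: "'a measure \<Rightarrow> ('a \<Rightarrow> 'b) \<Rightarrow> real" where
  "observable_entropy \<mu> X = partition_entropy \<mu> (fibres (space \<mu>) X)"

definition cond_entropy :: "'a measure \<Rightarrow> ('a \<Rightarrow> 'b) \<Rightarrow> ('a \<Rightarrow> 'c) \<Rightarrow> real" where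
  "cond_entropy \<mu> X Z = observable_entropy \<mu> (\<lambda>x. (X x, Z x)) - observable_entropy \<mu> Z"

lemma observable_entropy_eq_sum:
  assumes "finite B" "X ` space \<mu> \<subseteq> B"
  shows "observable_entropy \<mu> X =
    - (\<Sum>v\<in>B. measure \<mu> {x \<in> space \<mu>. X x = v} * ln (measure \<mu> {x \<in> space \<mu>. X x = v}))"
proof -
  let ?f = "\<lambda>v. {x \<in> space \<mu>. X x = v}"
  have "fibres (space \<mu>) X = ?f ` (X ` space \<mu>)"
    by (auto simp: fibres_def)
  moreover have "inj_on ?f (X ` space \<mu>)"
    by (auto simp: inj_on_def)
  ultimately have "observable_entropy \<mu> X = - (\<Sum>v\<in>X ` space \<mu>. measure \<mu> (?f v) * ln (measure \<mu> (?f v)))"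
    by (simp add: observable_entropy_def partition_entropy_def sum.reindex)
  also have "(\<Sum>v\<in>X ` space \<mu>. measure \<mu> (?f v) * ln (measure \<mu> (?f v)))
      = (\<Sum>v\<in>B. measure \<mu> (?f v) * ln (measure \<mu> (?f v)))"
  proof (rule sum.mono_neutral_left[OF assms])
    show "\<forall>v\<in>B - X ` space \<mu>. measure \<mu> (?f v) * ln (measure \<mu> (?f v)) = 0"
    proof
      fix v assume "v \<in> B - X ` space \<mu>"
      then have "?f v = {}"
        by auto
      then show "measure \<mu> (?f v) * ln (measure \<mu> (?f v)) = 0"
        by (simp only: measure_empty mult_zero_left)
    qed
  qed
  finally show ?thesis .
qed

lemma observable_entropy_cong:
  assumes "\<And>x y. x \<in> space \<mu> \<Longrightarrow> y \<in> space \<mu> \<Longrightarrow> X x = X y \<longleftrightarrow> Y x = Y y"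
  shows "observable_entropy \<mu> X = observable_entropy \<mu> Y"
proof -
  have "fibres (space \<mu>) X = fibres (space \<mu>) Y"
    unfolding fibres_def by (rule image_cong) (use assms in auto)
  then show ?thesis
    by (simp add: observable_entropy_def)
qed

text \<open>
  At \<open>l = 0\<close>, where \<open>ln\<close> is not continuous, \<open>\<bar>t * ln t\<bar> \<le> 2 * sqrt t + t * t\<close> follows from
  \<open>ln s \<le> s - 1\<close> for \<open>s = 1 / sqrt t\<close> and for \<open>s = t\<close>.
\<close>

lemma tendsto_x_ln_x:
  fixes f :: "'a \<Rightarrow> real"
  assumes f: "(f \<longlongrightarrow> l) F" and nonneg: "\<And>x. 0 \<le> f x" and l: "0 \<le> l"
  shows "((\<lambda>x. f x * ln (f x)) \<longlongrightarrow> l * ln l) F"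
proof (cases "l = 0")
  case False
  then show ?thesis
    using l by (intro tendsto_intros f) auto
next
  case True
  have bound: "\<bar>t * ln t\<bar> \<le> 2 * sqrt t + t * t" if "0 \<le> t" for t :: real
  proof (cases "t = 0")
    case False
    define s where "s = sqrt t"
    have s: "0 < s" "t = s * s"
      using that False by (auto simp: s_def)
    have "ln (1 / s) \<le> 1 / s - 1"
      using s by (intro ln_le_minus_one) auto
    then have "- (2 * ln s) \<le> 2 * (1 / s)"
      using s by (simp add: ln_div)
    then have "t * - ln t \<le> t * (2 * (1 / s))"
      using s that by (intro mult_left_mono) (auto simp: ln_mult)
    then have "- (t * ln t) \<le> 2 * s"
      using s by simp
    moreover have "t * ln t \<le> t * t"
      using that False ln_le_minus_one[of t] by (intro mult_left_mono) auto
    moreover have "0 \<le> t * t" "0 \<le> s"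
      using s by auto
    ultimately show ?thesis
      unfolding s_def by linarith
  qed auto
  have "((\<lambda>x. 2 * sqrt (f x) + f x * f x) \<longlongrightarrow> 2 * sqrt 0 + 0 * 0) F"
    using f unfolding True by (intro tendsto_intros)
  then have lim0: "((\<lambda>x. 2 * sqrt (f x) + f x * f x) \<longlongrightarrow> 0) F"
    by simp
  have "eventually (\<lambda>x. norm (f x * ln (f x)) \<le> 2 * sqrt (f x) + f x * f x) F"
    using bound[OF nonneg] by simp
  then have "((\<lambda>x. f x * ln (f x)) \<longlongrightarrow> 0) F"
    by (rule Lim_null_comparison[OF _ lim0])
  then show ?thesis
    using True by simp
qed

lemma entropy_summand_bound:
  fixes p xz yz z :: real
  assumes "0 \<le> p" "p \<le> xz" "p \<le> yz" "xz \<le> z"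
  shows "p * (ln xz + ln yz - ln p - ln z) \<le> xz * yz / z - p"
proof (cases "p = 0")
  case True
  then show ?thesis
    using assms by simp
next
  case False
  then have pos: "0 < p" "0 < xz" "0 < yz" "0 < z"
    using assms by auto
  have "ln (xz * yz / (p * z)) \<le> xz * yz / (p * z) - 1"
    using pos by (intro ln_le_minus_one) simp
  then have "p * ln (xz * yz / (p * z)) \<le> p * (xz * yz / (p * z) - 1)"
    using pos by simp
  then show ?thesis
    using pos by (simp add: ln_mult ln_div algebra_simps)
qed

text \<open>
  Nonnegativity of conditional mutual information: the pointwise bound from \<open>ln s \<le> s - 1\<close>, summed over
  all triples, has the right-hand side \<open>(\<Sum>xz * yz / z) - (\<Sum>p) = 0\<close>.
\<close>

lemma strong_subadditivity_sum:
  fixes p :: "'a \<Rightarrow> 'b \<Rightarrow> 'c \<Rightarrow> real"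
  assumes fin: "finite A" "finite B" "finite C" and nonneg: "\<And>a b c. 0 \<le> p a b c"
    and xz: "\<And>a c. a \<in> A \<Longrightarrow> c \<in> C \<Longrightarrow> xz a c = (\<Sum>b\<in>B. p a b c)"
    and yz: "\<And>b c. b \<in> B \<Longrightarrow> c \<in> C \<Longrightarrow> yz b c = (\<Sum>a\<in>A. p a b c)"
    and z: "\<And>c. c \<in> C \<Longrightarrow> z c = (\<Sum>a\<in>A. xz a c)"
  shows "(\<Sum>a\<in>A. \<Sum>c\<in>C. xz a c * ln (xz a c)) + (\<Sum>b\<in>B. \<Sum>c\<in>C. yz b c * ln (yz b c))
    \<le> (\<Sum>a\<in>A. \<Sum>b\<in>B. \<Sum>c\<in>C. p a b c * ln (p a b c)) + (\<Sum>c\<in>C. z c * ln (z c))"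
proof -
  have z': "z c = (\<Sum>b\<in>B. yz b c)" if "c \<in> C" for c
    using that by (simp add: z xz yz sum.swap[of _ A B] cong: sum.cong)
  have bounds: "p a b c \<le> xz a c" "p a b c \<le> yz b c" "xz a c \<le> z c" "0 \<le> xz a c"
    if "a \<in> A" "b \<in> B" "c \<in> C" for a b c
  proof -
    have nn: "0 \<le> xz a c" if "a \<in> A" for a
      using that \<open>c \<in> C\<close> nonneg by (auto simp: xz intro: sum_nonneg)
    then show "0 \<le> xz a c"
      using that by blast
    show "p a b c \<le> xz a c" "p a b c \<le> yz b c"
      using that fin nonneg by (auto simp: xz yz intro: member_le_sum[of _ _ "\<lambda>b. p a b c"] member_le_sum[of _ _ "\<lambda>a. p a b c"])
    show "xz a c \<le> z c"
      using that fin nn by (auto simp: z intro: member_le_sum[of _ _ "\<lambda>a. xz a c"])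
  qed
  have total: "(\<Sum>a\<in>A. \<Sum>b\<in>B. xz a c * yz b c / z c) = (\<Sum>a\<in>A. \<Sum>b\<in>B. p a b c)" if c: "c \<in> C" for c
  proof -
    have "(\<Sum>a\<in>A. \<Sum>b\<in>B. xz a c * yz b c / z c) = (\<Sum>a\<in>A. xz a c) * (\<Sum>b\<in>B. yz b c) / z c"
      by (simp add: sum_product sum_divide_distrib)
    also have "\<dots> = z c"
      using z[OF c] z'[OF c] by simp
    also have "\<dots> = (\<Sum>a\<in>A. \<Sum>b\<in>B. p a b c)"
      using c by (simp add: z xz)
    finally show ?thesis .
  qed
  have "(\<Sum>a\<in>A. \<Sum>b\<in>B. \<Sum>c\<in>C. p a b c * (ln (xz a c) + ln (yz b c) - ln (p a b c) - ln (z c)))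
      \<le> (\<Sum>a\<in>A. \<Sum>b\<in>B. \<Sum>c\<in>C. xz a c * yz b c / z c - p a b c)"
    by (intro sum_mono entropy_summand_bound nonneg bounds)
  also have "\<dots> = (\<Sum>c\<in>C. \<Sum>a\<in>A. \<Sum>b\<in>B. xz a c * yz b c / z c - p a b c)"
    by (subst sum.swap[of _ A C], rule sum.cong[OF refl], rule sum.swap)
  also have "\<dots> = 0"
    by (rule sum.neutral) (simp add: sum_subtractf total)
  finally have le: "(\<Sum>a\<in>A. \<Sum>b\<in>B. \<Sum>c\<in>C. p a b c * (ln (xz a c) + ln (yz b c) - ln (p a b c) - ln (z c))) \<le> 0" .
  have 1: "(\<Sum>a\<in>A. \<Sum>b\<in>B. \<Sum>c\<in>C. p a b c * ln (xz a c)) = (\<Sum>a\<in>A. \<Sum>c\<in>C. xz a c * ln (xz a c))"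
    by (rule sum.cong[OF refl], subst sum.swap) (auto simp: xz sum_distrib_right intro!: sum.cong)
  have 2: "(\<Sum>a\<in>A. \<Sum>b\<in>B. \<Sum>c\<in>C. p a b c * ln (yz b c)) = (\<Sum>b\<in>B. \<Sum>c\<in>C. yz b c * ln (yz b c))"
    by (subst sum.swap, rule sum.cong[OF refl], subst sum.swap) (auto simp: yz sum_distrib_right intro!: sum.cong)
  have 3: "(\<Sum>a\<in>A. \<Sum>b\<in>B. \<Sum>c\<in>C. p a b c * ln (z c)) = (\<Sum>c\<in>C. z c * ln (z c))"
  proof -
    have "(\<Sum>a\<in>A. \<Sum>b\<in>B. \<Sum>c\<in>C. p a b c * ln (z c)) = (\<Sum>a\<in>A. \<Sum>c\<in>C. xz a c * ln (z c))"
      by (rule sum.cong[OF refl], subst sum.swap) (auto simp: xz sum_distrib_right intro!: sum.cong)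
    also have "\<dots> = (\<Sum>c\<in>C. z c * ln (z c))"
      by (subst sum.swap) (auto simp: z sum_distrib_right intro!: sum.cong)
    finally show ?thesis .
  qed
  show ?thesis
    using le by (simp add: algebra_simps sum.distrib sum_subtractf flip: 1 2 3)
qed

context prob_space
begin

lemma sum_prob_fibres:
  assumes "simple_function M Y" "finite B" "Y ` space M \<subseteq> B" "{x \<in> space M. P x} \<in> sets M"
  shows "(\<Sum>b\<in>B. prob {x \<in> space M. P x \<and> Y x = b}) = prob {x \<in> space M. P x}"
proof -
  have "{x \<in> space M. P x \<and> Y x = b} \<in> sets M" for b
  proof -
    have "{x \<in> space M. P x \<and> Y x = b} = {x \<in> space M. P x} \<inter> (Y -` {b} \<inter> space M)"
      by auto
    then show ?thesis
      using assms(1,4) by (metis sets.Int simple_functionD(2))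
  qed
  then have "prob (\<Union>b\<in>B. {x \<in> space M. P x \<and> Y x = b}) = (\<Sum>b\<in>B. prob {x \<in> space M. P x \<and> Y x = b})"
    using assms(2) by (intro finite_measure_finite_Union) (auto simp: disjoint_family_on_def)
  moreover have "(\<Union>b\<in>B. {x \<in> space M. P x \<and> Y x = b}) = {x \<in> space M. P x}"
    using assms(3) by auto
  ultimately show ?thesis
    by simp
qed

lemma simple_function_level_set [simp]: "simple_function M X \<Longrightarrow> {x \<in> space M. X x = v} \<in> sets M"
  using simple_functionD(2)[of M X "{v}"] by (simp add: vimage_def Int_def conj_commute)

text \<open>
  All rules for conditional entropies below are special cases of this inequality, for observables
  that are functions of each other.
\<close>

lemma entropy_strong_subadditive:
  assumes X: "simple_function M X" and Y: "simple_function M Y" and Z: "simple_function M Z"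
  shows "observable_entropy M (\<lambda>x. (X x, Y x, Z x)) + observable_entropy M Z
    \<le> observable_entropy M (\<lambda>x. (X x, Z x)) + observable_entropy M (\<lambda>x. (Y x, Z x))"
proof -
  let ?A = "X ` space M" and ?B = "Y ` space M" and ?C = "Z ` space M"
  have fin: "finite ?A" "finite ?B" "finite ?C"
    using X Y Z by (auto dest: simple_functionD)
  define p where "p a b c = prob {x \<in> space M. X x = a \<and> Y x = b \<and> Z x = c}" for a b c
  define xz where "xz a c = prob {x \<in> space M. X x = a \<and> Z x = c}" for a c
  define yz where "yz b c = prob {x \<in> space M. Y x = b \<and> Z x = c}" for b c
  define z where "z c = prob {x \<in> space M. Z x = c}" for c
  have XZ: "{x \<in> space M. X x = a \<and> Z x = c} \<in> sets M" for a c
    using simple_function_level_set[OF simple_function_Pair[OF X Z], of "(a, c)"] by simp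
  have YZ: "{x \<in> space M. Y x = b \<and> Z x = c} \<in> sets M" for b c
    using simple_function_level_set[OF simple_function_Pair[OF Y Z], of "(b, c)"] by simp
  have m1: "xz a c = (\<Sum>b\<in>?B. p a b c)" for a c
    using sum_prob_fibres[OF Y fin(2) order_refl XZ, of a c]
    by (simp add: xz_def p_def conj_ac)
  have m2: "yz b c = (\<Sum>a\<in>?A. p a b c)" for b c
    using sum_prob_fibres[OF X fin(1) order_refl YZ, of b c]
    by (simp add: yz_def p_def conj_ac)
  have m3: "z c = (\<Sum>a\<in>?A. xz a c)" for c
    using sum_prob_fibres[OF X fin(1) order_refl simple_function_level_set[OF Z], of c]
    by (simp add: xz_def z_def conj_ac)
  have e1: "observable_entropy M (\<lambda>x. (X x, Y x, Z x)) = - (\<Sum>a\<in>?A. \<Sum>b\<in>?B. \<Sum>c\<in>?C. p a b c * ln (p a b c))"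
    by (subst observable_entropy_eq_sum[where B="?A \<times> ?B \<times> ?C"])
      (use fin in \<open>auto simp: sum.cartesian_product p_def case_prod_beta prod_eq_iff\<close>)
  have e2: "observable_entropy M (\<lambda>x. (X x, Z x)) = - (\<Sum>a\<in>?A. \<Sum>c\<in>?C. xz a c * ln (xz a c))"
    by (subst observable_entropy_eq_sum[where B="?A \<times> ?C"])
      (use fin in \<open>auto simp: sum.cartesian_product xz_def case_prod_beta prod_eq_iff\<close>)
  have e3: "observable_entropy M (\<lambda>x. (Y x, Z x)) = - (\<Sum>b\<in>?B. \<Sum>c\<in>?C. yz b c * ln (yz b c))"
    by (subst observable_entropy_eq_sum[where B="?B \<times> ?C"])
      (use fin in \<open>auto simp: sum.cartesian_product yz_def case_prod_beta prod_eq_iff\<close>)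
  have e4: "observable_entropy M Z = - (\<Sum>c\<in>?C. z c * ln (z c))"
    by (subst observable_entropy_eq_sum[where B="?C"]) (use fin in \<open>auto simp: z_def\<close>)
  have "(\<Sum>a\<in>?A. \<Sum>c\<in>?C. xz a c * ln (xz a c)) + (\<Sum>b\<in>?B. \<Sum>c\<in>?C. yz b c * ln (yz b c))
    \<le> (\<Sum>a\<in>?A. \<Sum>b\<in>?B. \<Sum>c\<in>?C. p a b c * ln (p a b c)) + (\<Sum>c\<in>?C. z c * ln (z c))"
    by (intro strong_subadditivity_sum fin m1 m2 m3) (simp add: p_def)
  then show ?thesis
    by (simp add: e1 e2 e3 e4)
qed

lemma cond_entropy_nonneg:
  assumes X: "simple_function M X" and Z: "simple_function M Z"
  shows "0 \<le> cond_entropy M X Z"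
proof -
  have "observable_entropy M (\<lambda>x. (X x, X x, Z x)) = observable_entropy M (\<lambda>x. (X x, Z x))"
    by (rule observable_entropy_cong) auto
  then show ?thesis
    using entropy_strong_subadditive[OF X X Z] by (simp add: cond_entropy_def)
qed

lemma observable_entropy_nonneg:
  assumes "simple_function M X"
  shows "0 \<le> observable_entropy M X"
proof -
  have "measure M A * ln (measure M A) \<le> 0" for A
    by (cases "measure M A = 0") (auto intro!: mult_nonneg_nonpos simp: zero_less_measure_iff)
  then show ?thesis
    unfolding observable_entropy_def partition_entropy_def by (simp add: sum_nonpos)
qed

lemma observable_entropy_mono:
  assumes X: "simple_function M X" and Y: "simple_function M Y"
    and ref: "\<And>x y. x \<in> space M \<Longrightarrow> y \<in> space M \<Longrightarrow> X x = X y \<Longrightarrow> Y x = Y y"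
  shows "observable_entropy M Y \<le> observable_entropy M X"
proof -
  have "observable_entropy M (\<lambda>x. (X x, Y x)) = observable_entropy M X"
    by (rule observable_entropy_cong) (metis ref prod.inject)
  then show ?thesis
    using cond_entropy_nonneg[OF X Y] by (simp add: cond_entropy_def)
qed

lemma cond_entropy_antimono:
  assumes X: "simple_function M X" and Z: "simple_function M Z" and W: "simple_function M W"
    and ref: "\<And>x y. x \<in> space M \<Longrightarrow> y \<in> space M \<Longrightarrow> Z x = Z y \<Longrightarrow> W x = W y"
  shows "cond_entropy M X Z \<le> cond_entropy M X W"
proof -
  have "observable_entropy M (\<lambda>x. (X x, Z x, W x)) = observable_entropy M (\<lambda>x. (X x, Z x))"
    "observable_entropy M (\<lambda>x. (Z x, W x)) = observable_entropy M Z"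
    by (rule observable_entropy_cong, metis ref prod.inject)+
  then show ?thesis
    using entropy_strong_subadditive[OF X Z W] by (simp add: cond_entropy_def)
qed

lemma cond_entropy_mono:
  assumes X: "simple_function M X" and Y: "simple_function M Y" and Z: "simple_function M Z"
    and ref: "\<And>x y. x \<in> space M \<Longrightarrow> y \<in> space M \<Longrightarrow> X x = X y \<Longrightarrow> Y x = Y y"
  shows "cond_entropy M Y Z \<le> cond_entropy M X Z"
proof -
  have "observable_entropy M (\<lambda>x. (Y x, Z x)) \<le> observable_entropy M (\<lambda>x. (X x, Z x))"
  proof (rule observable_entropy_mono)
    show "(Y x, Z x) = (Y y, Z y)" if "x \<in> space M" "y \<in> space M" "(X x, Z x) = (X y, Z y)" for x y
      using ref[OF that(1,2)] that(3) by simp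
  qed (intro simple_function_Pair X Y Z)+
  then show ?thesis
    by (simp add: cond_entropy_def)
qed

lemma cond_entropy_pair_le:
  assumes X: "simple_function M X" and Y: "simple_function M Y" and Z: "simple_function M Z"
  shows "cond_entropy M (\<lambda>x. (X x, Y x)) Z \<le> cond_entropy M X Z + cond_entropy M Y Z"
proof -
  have "observable_entropy M (\<lambda>x. ((X x, Y x), Z x)) = observable_entropy M (\<lambda>x. (X x, Y x, Z x))"
    by (rule observable_entropy_cong) auto
  then show ?thesis
    using entropy_strong_subadditive[OF X Y Z] by (simp add: cond_entropy_def)
qed

lemma cond_entropy_triangle:
  assumes X: "simple_function M X" and Y: "simple_function M Y" and Z: "simple_function M Z"
  shows "cond_entropy M X Z \<le> cond_entropy M X Y + cond_entropy M Y Z"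
proof -
  have "observable_entropy M (\<lambda>x. (X x, Z x)) \<le> observable_entropy M (\<lambda>x. (X x, Z x, Y x))"
    by (rule observable_entropy_mono) (auto intro!: simple_function_Pair X Y Z)
  moreover have "observable_entropy M (\<lambda>x. (Z x, Y x)) = observable_entropy M (\<lambda>x. (Y x, Z x))"
    by (rule observable_entropy_cong) auto
  ultimately show ?thesis
    using entropy_strong_subadditive[OF X Z Y] by (simp add: cond_entropy_def)
qed

end

section \<open>Entropy of a partition under a measure-preserving map\<close>

definition itinerary :: "('a \<Rightarrow> 'a) \<Rightarrow> ('a \<Rightarrow> 'b) \<Rightarrow> nat \<Rightarrow> 'a \<Rightarrow> 'b list" where
  "itinerary T X n x = map (\<lambda>i. X ((T ^^ i) x)) [0..<n]"

lemma itinerary_eq_iff: "itinerary T X n x = itinerary T X n y \<longleftrightarrow> (\<forall>i<n. X ((T ^^ i) x) = X ((T ^^ i) y))"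
  by (auto simp: itinerary_def)

lemma itinerary_Suc: "itinerary T X (Suc n) x = X x # itinerary T X n (T x)"
  by (simp add: itinerary_def upt_conv_Cons map_Suc_upt[symmetric] funpow_swap1 o_def del: upt_Suc)

text \<open>
  The observable whose level sets are the blocks of \<open>P\<close>.
\<close>

definition cell :: "'a set set \<Rightarrow> 'a \<Rightarrow> 'a set" where
  "cell P x = (THE B. B \<in> P \<and> x \<in> B)"

lemma partition_on_unique_block:
  "partition_on S P \<Longrightarrow> B \<in> P \<Longrightarrow> x \<in> B \<Longrightarrow> C \<in> P \<Longrightarrow> x \<in> C \<Longrightarrow> B = C"
  by (metis IntI disjointD empty_iff partition_onD2)

lemma cell:
  assumes "partition_on S P" "x \<in> S"
  shows "cell P x \<in> P" "x \<in> cell P x"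
proof -
  have "\<exists>!B. B \<in> P \<and> x \<in> B"
    using assms partition_on_unique_block[OF assms(1)] partition_onD1[OF assms(1)] by blast
  then have "cell P x \<in> P \<and> x \<in> cell P x"
    unfolding cell_def by (rule theI')
  then show "cell P x \<in> P" "x \<in> cell P x"
    by auto
qed

lemma cell_eq: "partition_on S P \<Longrightarrow> B \<in> P \<Longrightarrow> x \<in> B \<Longrightarrow> cell P x = B"
  unfolding cell_def by (rule the_equality) (simp, metis partition_on_unique_block)

lemma dynamical_refinement_eq_fibres:
  assumes P: "partition_on S P" and T: "\<And>x. x \<in> S \<Longrightarrow> T x \<in> S"
  shows "dynamical_refinement S T P n = fibres S (itinerary T (cell P) n)"
proof -
  have Ti: "(T ^^ i) x \<in> S" if "x \<in> S" for i x
    using that by (induction i) (auto intro: T)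
  have eq: "{y \<in> S. itinerary T (cell P) n y = itinerary T (cell P) n x} = S \<inter> (\<Inter>i<n. (T ^^ i) -` B i)"
    if "\<And>i. i < n \<Longrightarrow> B i \<in> P" "\<And>i. i < n \<Longrightarrow> (T ^^ i) x \<in> B i" for x B
  proof -
    have "cell P ((T ^^ i) y) = cell P ((T ^^ i) x) \<longleftrightarrow> (T ^^ i) y \<in> B i" if "i < n" "y \<in> S" for i y
      using cell_eq[OF P] cell[OF P Ti[OF \<open>y \<in> S\<close>]] \<open>\<And>i. i < n \<Longrightarrow> B i \<in> P\<close> \<open>\<And>i. i < n \<Longrightarrow> (T ^^ i) x \<in> B i\<close> that(1)
      by metis
    then show ?thesis
      by (auto simp: itinerary_eq_iff)
  qed
  show ?thesis
  proof (intro equalityI subsetI)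
    fix C assume "C \<in> dynamical_refinement S T P n"
    then obtain B x where B: "C = S \<inter> (\<Inter>i<n. (T ^^ i) -` B i)" "\<And>i. i < n \<Longrightarrow> B i \<in> P" and x: "x \<in> C"
      unfolding dynamical_refinement_def by auto
    then have "C = {y \<in> S. itinerary T (cell P) n y = itinerary T (cell P) n x}"
      by (subst eq[of B]) auto
    then show "C \<in> fibres S (itinerary T (cell P) n)"
      using B x unfolding fibres_def by (intro image_eqI[where x=x]) auto
  next
    fix C assume "C \<in> fibres S (itinerary T (cell P) n)"
    then obtain x where x: "x \<in> S" "C = {y \<in> S. itinerary T (cell P) n y = itinerary T (cell P) n x}"
      by (auto simp: fibres_def)
    then have "C = S \<inter> (\<Inter>i<n. (T ^^ i) -` cell P ((T ^^ i) x))"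
      using eq[of "\<lambda>i. cell P ((T ^^ i) x)" x] cell[OF P Ti] by simp
    moreover have "x \<in> C"
      using x by simp
    ultimately show "C \<in> dynamical_refinement S T P n"
      unfolding dynamical_refinement_def using cell[OF P Ti[OF x(1)]]
      by (auto intro!: exI[of _ "\<lambda>i. cell P ((T ^^ i) x)"])
  qed
qed

lemma simple_function_cell:
  assumes "finite P" "P \<subseteq> sets \<mu>" "partition_on (space \<mu>) P"
  shows "simple_function \<mu> (cell P)"
  unfolding simple_function_def
proof (intro conjI ballI)
  show "finite (cell P ` space \<mu>)"
    using cell(1)[OF assms(3)] by (intro finite_subset[OF _ assms(1)]) auto
  fix B assume "B \<in> cell P ` space \<mu>"
  then have "B \<in> P"
    using cell(1)[OF assms(3)] by auto
  then have "cell P -` {B} \<inter> space \<mu> = B"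
    using cell_eq[OF assms(3)] cell(2)[OF assms(3)] partition_onD1[OF assms(3)] by auto
  then show "cell P -` {B} \<inter> space \<mu> \<in> sets \<mu>"
    using \<open>B \<in> P\<close> assms(2) by auto
qed

locale measure_preserving = prob_space +
  fixes T :: "'a \<Rightarrow> 'a"
  assumes T_measurable [measurable]: "T \<in> measurable M M" and T_invariant: "distr M M T = M"
begin

lemma T_space: "x \<in> space M \<Longrightarrow> T x \<in> space M"
  using measurable_space[OF T_measurable] .

lemma funpow_T_space: "x \<in> space M \<Longrightarrow> (T ^^ i) x \<in> space M"
  by (induction i) (auto intro: T_space)

lemma funpow_T_measurable: "T ^^ i \<in> measurable M M"
  by (induction i) (auto intro: measurable_comp[OF _ T_measurable])

lemma funpow_T_invariant: "distr M M (T ^^ i) = M"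
proof (induction i)
  case (Suc i)
  have "distr M M (T ^^ Suc i) = distr (distr M M (T ^^ i)) M T"
    by (simp add: distr_distr funpow_T_measurable)
  also have "\<dots> = M"
    by (simp only: Suc T_invariant)
  finally show ?case .
qed (simp add: distr_id2)

lemma simple_function_compose_measurable:
  assumes "simple_function M X" "T' \<in> measurable M M"
  shows "simple_function M (\<lambda>x. X (T' x))"
  unfolding simple_function_def
proof (intro conjI ballI)
  have sp: "T' x \<in> space M" if "x \<in> space M" for x
    using that measurable_space[OF assms(2)] by simp
  show "finite ((\<lambda>x. X (T' x)) ` space M)"
    using sp by (intro finite_subset[OF _ simple_functionD(1)[OF assms(1)]]) auto
  fix v
  have "(\<lambda>x. X (T' x)) -` {v} \<inter> space M = T' -` (X -` {v} \<inter> space M) \<inter> space M"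
    using sp by auto
  then show "(\<lambda>x. X (T' x)) -` {v} \<inter> space M \<in> sets M"
    using measurable_sets[OF assms(2) simple_functionD(2)[OF assms(1)]] by simp
qed

lemma simple_function_funpow: "simple_function M X \<Longrightarrow> simple_function M (\<lambda>x. X ((T ^^ i) x))"
  by (rule simple_function_compose_measurable[OF _ funpow_T_measurable])

lemma simple_function_itinerary: "simple_function M X \<Longrightarrow> simple_function M (itinerary T X n)"
proof (induction n)
  case 0
  then show ?case
    by (simp add: itinerary_def simple_function_def)
next
  case (Suc n)
  have "simple_function M ((\<lambda>(a, w). a # w) \<circ> (\<lambda>x. (X x, itinerary T X n (T x))))"
    using Suc by (intro simple_function_compose simple_function_Pair simple_function_compose_measurable[OF _ T_measurable])
  then show ?case
    by (simp add: itinerary_Suc[abs_def] comp_def)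
qed

lemma observable_entropy_funpow:
  assumes "simple_function M X"
  shows "observable_entropy M (\<lambda>x. X ((T ^^ i) x)) = observable_entropy M X"
proof -
  have *: "prob {x \<in> space M. X ((T ^^ i) x) = v} = prob {x \<in> space M. X x = v}" for v
  proof -
    have "prob {x \<in> space M. X x = v} = measure (distr M M (T ^^ i)) {x \<in> space M. X x = v}"
      by (simp add: funpow_T_invariant)
    also have "\<dots> = prob ((T ^^ i) -` {x \<in> space M. X x = v} \<inter> space M)"
      using assms by (intro measure_distr funpow_T_measurable) simp
    also have "(T ^^ i) -` {x \<in> space M. X x = v} \<inter> space M = {x \<in> space M. X ((T ^^ i) x) = v}"
      using funpow_T_space by auto
    finally show ?thesis
      by simp
  qed
  have fin: "finite (X ` space M)"
    using assms by (rule simple_functionD)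
  show ?thesis
    using observable_entropy_eq_sum[OF fin, of X M] observable_entropy_eq_sum[OF fin, of "\<lambda>x. X ((T ^^ i) x)" M]
      funpow_T_space by (auto simp: *)
qed

lemma cond_entropy_funpow:
  assumes "simple_function M X" "simple_function M Z"
  shows "cond_entropy M (\<lambda>x. X ((T ^^ i) x)) (\<lambda>x. Z ((T ^^ i) x)) = cond_entropy M X Z"
  using observable_entropy_funpow[OF simple_function_Pair[OF assms], of i] observable_entropy_funpow[OF assms(2), of i]
  by (simp add: cond_entropy_def)

text \<open>
  The increments \<open>D n = H (n + 1) - H n\<close> are conditional entropies given longer and longer itineraries,
  hence decreasing. So \<open>n * D n \<le> H n\<close>, and \<open>H n / n\<close> is decreasing from \<open>n = 1\<close> on.
\<close>

lemma entropy_rate_converges: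
  assumes X: "simple_function M X"
  shows "convergent (\<lambda>n. observable_entropy M (itinerary T X n) / real n)"
proof -
  define H where "H n = observable_entropy M (itinerary T X n)" for n
  define D where "D n = cond_entropy M X (\<lambda>x. itinerary T X n (T x))" for n
  have H_Suc: "H (Suc n) = H n + D n" for n
  proof -
    have "observable_entropy M (itinerary T X (Suc n)) = observable_entropy M (\<lambda>x. (X x, itinerary T X n (T x)))"
      by (rule observable_entropy_cong) (auto simp: itinerary_Suc)
    moreover have "observable_entropy M (\<lambda>x. itinerary T X n (T x)) = H n"
      using observable_entropy_funpow[OF simple_function_itinerary[OF X], of n 1] by (simp add: H_def)
    ultimately show ?thesis
      by (simp add: H_def D_def cond_entropy_def)
  qed
  have "D (Suc n) \<le> D n" for n
    unfolding D_def
    by (intro cond_entropy_antimono X simple_function_compose_measurable[OF simple_function_itinerary[OF X] T_measurable])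
      (auto simp: itinerary_eq_iff)
  then have D: "D n \<le> D m" if "m \<le> n" for m n
    using lift_Suc_antimono_le[of D, OF _ that] by blast
  have nonneg: "0 \<le> H n" for n
    unfolding H_def by (intro observable_entropy_nonneg simple_function_itinerary X)
  have H_sum: "H n = H 0 + (\<Sum>i<n. D i)" for n
    by (induction n) (auto simp: H_Suc)
  have nD: "real n * D n \<le> H n" for n
  proof -
    have "real n * D n = (\<Sum>i<n. D n)"
      by simp
    also have "\<dots> \<le> (\<Sum>i<n. D i)"
      by (intro sum_mono D) auto
    also have "\<dots> \<le> H n"
      using nonneg[of 0] by (subst H_sum) simp
    finally show ?thesis .
  qed
  have "decseq (\<lambda>n. H (Suc n) / real (Suc n))"
  proof (rule decseq_SucI)
    fix n
    have "real (Suc n) * H (Suc (Suc n)) \<le> real (Suc (Suc n)) * H (Suc n)"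
      using nD[of "Suc n"] by (simp add: H_Suc[of "Suc n"] algebra_simps)
    then show "H (Suc (Suc n)) / real (Suc (Suc n)) \<le> H (Suc n) / real (Suc n)"
      by (simp add: field_simps)
  qed
  then have "convergent (\<lambda>n. H (Suc n) / real (Suc n))"
    using decseq_convergent[of "\<lambda>n. H (Suc n) / real (Suc n)" 0] nonneg
    by (metis convergent_def divide_nonneg_nonneg of_nat_0_le_iff)
  then show ?thesis
    using convergent_Suc_iff[of "\<lambda>n. H n / real n"] by (simp add: H_def)
qed

lemma entropy_wrt_partition_limit:
  assumes P: "finite P" "P \<subseteq> sets M" "partition_on (space M) P"
  shows "(\<lambda>n. observable_entropy M (itinerary T (cell P) n) / real n) \<longlonglongrightarrow> entropy_wrt_partition M T P"
proof -
  have "entropy_wrt_partition M T P = lim (\<lambda>n. observable_entropy M (itinerary T (cell P) n) / real n)"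
    unfolding entropy_wrt_partition_def observable_entropy_def
    by (subst dynamical_refinement_eq_fibres[OF P(3) T_space]) auto
  then show ?thesis
    using entropy_rate_converges[OF simple_function_cell[OF P]] by (simp add: convergent_LIMSEQ_iff)
qed

end

section \<open>The Borel sets of the subshift\<close>

context symmetric_subshift
begin

definition cylinder :: "nat \<Rightarrow> (nat \<Rightarrow> 'r) \<Rightarrow> (nat \<Rightarrow> 'r) set" where
  "cylinder n z = {x \<in> S. agree n x z}"

definition determined :: "nat \<Rightarrow> (nat \<Rightarrow> 'r) set \<Rightarrow> bool" where
  "determined n A \<longleftrightarrow> A \<subseteq> S \<and> (\<forall>x\<in>S. \<forall>y\<in>S. agree n x y \<longrightarrow> x \<in> A \<longrightarrow> y \<in> A)"

definition clopens :: "(nat \<Rightarrow> 'r) set set" where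
  "clopens = {A. \<exists>n. determined n A}"

lemma determined_mono: "determined m A \<Longrightarrow> m \<le> n \<Longrightarrow> determined n A"
  unfolding determined_def using agree_mono by blast

lemma openin_subshift:
  "openin (mtopology_of (subshift_metric \<Lambda> M)) U \<longleftrightarrow> U \<subseteq> S \<and> (\<forall>x\<in>U. \<exists>n. cylinder n x \<subseteq> U)"
proof -
  interpret Metric_space S d
    by (rule Metric_space_seq_dist[OF \<Lambda>_pos \<Lambda>_less_1])
  have ball: "(\<exists>r>0. mball x r \<subseteq> U) \<longleftrightarrow> (\<exists>n. cylinder n x \<subseteq> U)" if x: "x \<in> S" for x
  proof
    assume "\<exists>r>0. mball x r \<subseteq> U"
    then obtain r where r: "r > 0" "mball x r \<subseteq> U"
      by blast
    obtain n where n: "1 * \<Lambda> ^ n < r"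
      by (rule power_small[OF r(1), of 1]) blast
    have "cylinder n x \<subseteq> mball x r"
    proof
      fix y assume "y \<in> cylinder n x"
      then have "y \<in> S" "agree n x y"
        by (auto simp: cylinder_def agree_sym)
      then show "y \<in> mball x r"
        using d_le[of n x y] n x by (simp add: in_mball)
    qed
    then show "\<exists>n. cylinder n x \<subseteq> U"
      using r by blast
  next
    assume "\<exists>n. cylinder n x \<subseteq> U"
    then obtain n where n: "cylinder n x \<subseteq> U"
      by blast
    have "mball x (\<Lambda> ^ n) \<subseteq> cylinder n x"
    proof
      fix y assume "y \<in> mball x (\<Lambda> ^ n)"
      then have "y \<in> S" "d x y < \<Lambda> ^ n"
        by (auto simp: in_mball)
      then show "y \<in> cylinder n x"
        using agree_mono[OF d_less, of x y n n] by (simp add: cylinder_def agree_sym)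
    qed
    then show "\<exists>r>0. mball x r \<subseteq> U"
      using n \<Lambda>_pos by (intro exI[of _ "\<Lambda> ^ n"]) auto
  qed
  have "mtopology_of (subshift_metric \<Lambda> M) = mtopology"
    using \<Lambda>_pos \<Lambda>_less_1 by (simp add: mtopology_of_def)
  then have "openin (mtopology_of (subshift_metric \<Lambda> M)) U \<longleftrightarrow> U \<subseteq> S \<and> (\<forall>x. x \<in> U \<longrightarrow> (\<exists>r>0. mball x r \<subseteq> U))"
    by (simp only: openin_mtopology)
  then show ?thesis
    using ball by blast
qed

lemma space_subshift_borel [simp]: "space (subshift_borel \<Lambda> M) = S"
  by (simp add: subshift_borel_def space_measure_of_conv)

lemma clopens_subset: "clopens \<subseteq> Pow S"
  by (auto simp: clopens_def determined_def)

lemma open_in_sets: 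
  assumes "U \<subseteq> S" "\<And>x. x \<in> U \<Longrightarrow> \<exists>n. cylinder n x \<subseteq> U"
  shows "U \<in> sets (subshift_borel \<Lambda> M)"
proof -
  have sub: "{U. openin (mtopology_of (subshift_metric \<Lambda> M)) U} \<subseteq> Pow S"
    by (auto simp: openin_subshift)
  have "openin (mtopology_of (subshift_metric \<Lambda> M)) U"
    using assms by (simp add: openin_subshift)
  then show ?thesis
    unfolding subshift_borel_def by (simp add: sets_measure_of[OF sub] sigma_sets.Basic)
qed

text \<open>
  An open set \<open>U\<close> is the union over \<open>n\<close> of the points whose cylinder of length \<open>n\<close> lies in \<open>U\<close>, a set
  determined by \<open>n\<close> letters.
\<close>

lemma sets_subshift_borel: "sets (subshift_borel \<Lambda> M) = sigma_sets S clopens"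
proof -
  have sub: "{U. openin (mtopology_of (subshift_metric \<Lambda> M)) U} \<subseteq> Pow S"
    by (auto simp: openin_subshift)
  have "sigma_sets S {U. openin (mtopology_of (subshift_metric \<Lambda> M)) U} = sigma_sets S clopens"
  proof (rule sigma_sets_eqI)
    fix U assume "U \<in> {U. openin (mtopology_of (subshift_metric \<Lambda> M)) U}"
    then have U: "U \<subseteq> S" "\<And>x. x \<in> U \<Longrightarrow> \<exists>n. cylinder n x \<subseteq> U"
      by (auto simp: openin_subshift)
    define V where "V n = {x \<in> S. cylinder n x \<subseteq> U}" for n
    have "determined n (V n)" for n
      unfolding determined_def V_def cylinder_def by (auto simp: agree_def)
    then have "(\<Union>n. V n) \<in> sigma_sets S clopens"
      by (intro sigma_sets.Union sigma_sets.Basic) (auto simp: clopens_def)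
    moreover have "(\<Union>n. V n) = U"
    proof
      show "(\<Union>n. V n) \<subseteq> U"
        by (auto simp: V_def cylinder_def)
      show "U \<subseteq> (\<Union>n. V n)"
        using U by (fastforce simp: V_def)
    qed
    ultimately show "U \<in> sigma_sets S clopens"
      by simp
  next
    fix A assume "A \<in> clopens"
    then obtain n where n: "determined n A"
      by (auto simp: clopens_def)
    have "cylinder n x \<subseteq> A" if "x \<in> A" for x
      using n that unfolding determined_def cylinder_def by (auto dest: agree_sym)
    then have "openin (mtopology_of (subshift_metric \<Lambda> M)) A"
      using n by (auto simp: openin_subshift determined_def)
    then show "A \<in> sigma_sets S {U. openin (mtopology_of (subshift_metric \<Lambda> M)) U}"
      by (intro sigma_sets.Basic) simp
  qed
  then show ?thesis
    unfolding subshift_borel_def by (simp add: sets_measure_of[OF sub])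
qed

lemma clopen_in_sets: "determined n A \<Longrightarrow> A \<in> sets (subshift_borel \<Lambda> M)"
  unfolding sets_subshift_borel by (intro sigma_sets.Basic) (auto simp: clopens_def)

lemma lip_measurable:
  assumes "lip K u"
  shows "u \<in> borel_measurable (subshift_borel \<Lambda> M)"
proof (rule borel_measurableI_less)
  fix a
  show "{x \<in> space (subshift_borel \<Lambda> M). u x < a} \<in> sets (subshift_borel \<Lambda> M)"
  proof (rule open_in_sets)
    fix x assume x: "x \<in> {x \<in> space (subshift_borel \<Lambda> M). u x < a}"
    then obtain n where "K * \<Lambda> ^ n < a - u x"
      using power_small[of "a - u x" K] by auto
    then have "cylinder n x \<subseteq> {x \<in> space (subshift_borel \<Lambda> M). u x < a}"
      using lip_agree[OF assms, of _ x n] x by (force simp: cylinder_def abs_le_iff)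
    then show "\<exists>n. cylinder n x \<subseteq> {x \<in> space (subshift_borel \<Lambda> M). u x < a}" ..
  qed auto
qed

lemma clopens_shift_vimage:
  assumes "A \<in> clopens"
  shows "shift -` A \<inter> S \<in> clopens"
proof -
  obtain n where n: "determined n A"
    using assms by (auto simp: clopens_def)
  have "determined (Suc n) (shift -` A \<inter> S)"
    unfolding determined_def
  proof (intro conjI ballI impI)
    fix x y assume "x \<in> S" "y \<in> S" "agree (Suc n) x y" "x \<in> shift -` A \<inter> S"
    moreover from this have "shift x \<in> S" "shift y \<in> S"
      by auto
    ultimately show "y \<in> shift -` A \<inter> S"
      using n unfolding determined_def agree_Suc by blast
  qed auto
  then show ?thesis
    by (auto simp: clopens_def)
qed

lemma shift_measurable: "shift \<in> measurable (subshift_borel \<Lambda> M) (subshift_borel \<Lambda> M)"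
proof (rule measurable_sigma_sets[OF sets_subshift_borel clopens_subset])
  show "shift \<in> space (subshift_borel \<Lambda> M) \<rightarrow> S"
    by auto
  show "shift -` A \<inter> space (subshift_borel \<Lambda> M) \<in> sets (subshift_borel \<Lambda> M)" if "A \<in> clopens" for A
    using clopens_shift_vimage[OF that] clopen_in_sets by (auto simp: clopens_def)
qed

section \<open>Birkhoff sums of a normalized potential\<close>

definition birkhoff_sum :: "((nat \<Rightarrow> 'r) \<Rightarrow> real) \<Rightarrow> nat \<Rightarrow> (nat \<Rightarrow> 'r) \<Rightarrow> real" where
  "birkhoff_sum g n x = (\<Sum>i<n. g ((shift ^^ i) x))"

text \<open>
  The constant function 1 is a fixed point of the Ruelle operator. Every Lipschitz potential becomes
  normalized after adding a coboundary and a constant.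
\<close>

definition normalized :: "((nat \<Rightarrow> 'r) \<Rightarrow> real) \<Rightarrow> bool" where
  "normalized g \<longleftrightarrow> (\<forall>x\<in>S. (\<Sum>a\<in>preds x. exp (g (prepend a x))) = 1)"

lemma agree_funpow_shift: "agree n x y \<Longrightarrow> agree (n - i) ((shift ^^ i) x) ((shift ^^ i) y)"
  by (simp add: agree_def)

lemma geometric_bound: "(\<Sum>i<n. \<Lambda> ^ (n - i)) \<le> 1 / (1 - \<Lambda>)"
proof -
  have "(\<Sum>i<n. \<Lambda> ^ (n - i)) = (\<Sum>i<n. \<Lambda> ^ Suc i)"
    by (subst sum.nat_diff_reindex[symmetric]) (auto intro!: sum.cong simp: Suc_diff_Suc)
  also have "\<dots> \<le> (\<Sum>i<n. \<Lambda> ^ i)"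
    using \<Lambda>_pos \<Lambda>_less_1 by (intro sum_mono) (auto simp: mult_left_le_one_le)
  also have "\<dots> \<le> (\<Sum>i. \<Lambda> ^ i)"
    using \<Lambda>_pos \<Lambda>_less_1 by (intro sum_le_suminf summable_geometric) auto
  also have "\<dots> = 1 / (1 - \<Lambda>)"
    using \<Lambda>_pos \<Lambda>_less_1 by (intro suminf_geometric) auto
  finally show ?thesis .
qed

lemma bounded_distortion:
  assumes g: "lip L g" and x: "x \<in> S" and y: "y \<in> S" and "agree n x y"
  shows "birkhoff_sum g n x \<le> birkhoff_sum g n y + L / (1 - \<Lambda>)"
proof -
  have "birkhoff_sum g n x - birkhoff_sum g n y = (\<Sum>i<n. g ((shift ^^ i) x) - g ((shift ^^ i) y))"
    by (simp add: birkhoff_sum_def sum_subtractf)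
  also have "\<dots> \<le> (\<Sum>i<n. L * \<Lambda> ^ (n - i))"
  proof (rule sum_mono)
    fix i
    show "g ((shift ^^ i) x) - g ((shift ^^ i) y) \<le> L * \<Lambda> ^ (n - i)"
      using lip_agree[OF g funpow_shift_in_S[OF x] funpow_shift_in_S[OF y] agree_funpow_shift[OF assms(4)], of i]
      by linarith
  qed
  also have "\<dots> \<le> L * (1 / (1 - \<Lambda>))"
    unfolding sum_distrib_left[symmetric] using g by (intro mult_left_mono geometric_bound) (simp add: lip_def)
  finally show ?thesis
    by simp
qed

lemma shift_fibre_Suc:
  assumes "x \<in> S"
  shows "{z \<in> S. (shift ^^ Suc n) z = x} = (\<Union>a\<in>preds x. {z \<in> S. (shift ^^ n) z = prepend a x})"
proof (intro equalityI subsetI)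
  fix z assume z: "z \<in> {z \<in> S. (shift ^^ Suc n) z = x}"
  then have "shift ((shift ^^ n) z) = x" "z \<in> S"
    by auto
  then have "prepend ((shift ^^ n) z 0) x = (shift ^^ n) z"
    by (metis prepend_simps(4))
  moreover from this have "(shift ^^ n) z 0 \<in> preds x"
    using \<open>z \<in> S\<close> by (metis funpow_shift_in_S prepend_in_S preds_iff)
  ultimately show "z \<in> (\<Union>a\<in>preds x. {z \<in> S. (shift ^^ n) z = prepend a x})"
    using \<open>z \<in> S\<close> by (metis (mono_tags, lifting) UN_I mem_Collect_eq)
qed auto

text \<open>
  The \<open>n\<close>-th power of the Ruelle operator, applied to 1.
\<close>

lemma birkhoff_sum_fibre:
  assumes g: "normalized g" and x: "x \<in> S"
  shows "finite {z \<in> S. (shift ^^ n) z = x} \<and> (\<Sum>z\<in>{z \<in> S. (shift ^^ n) z = x}. exp (birkhoff_sum g n z)) = 1"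
  using x
proof (induction n arbitrary: x)
  case 0
  then have "{z \<in> S. (shift ^^ 0) z = x} = {x}"
    by auto
  then show ?case
    by (simp add: birkhoff_sum_def)
next
  case (Suc n)
  let ?F = "\<lambda>x. {z \<in> S. (shift ^^ n) z = x}"
  have IH: "finite (?F (prepend a x))" "(\<Sum>z\<in>?F (prepend a x). exp (birkhoff_sum g n z)) = 1" if "a \<in> preds x" for a
  proof -
    have "prepend a x \<in> S"
      using Suc.prems that by simp
    from Suc.IH[OF this]
    show "finite (?F (prepend a x))" "(\<Sum>z\<in>?F (prepend a x). exp (birkhoff_sum g n z)) = 1"
      by blast+
  qed
  have disj: "\<forall>a\<in>preds x. \<forall>b\<in>preds x. a \<noteq> b \<longrightarrow> ?F (prepend a x) \<inter> ?F (prepend b x) = {}"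
    by (auto dest!: fun_cong[of "prepend _ x" _ 0])
  have "(\<Sum>z\<in>{z \<in> S. (shift ^^ Suc n) z = x}. exp (birkhoff_sum g (Suc n) z))
      = (\<Sum>a\<in>preds x. \<Sum>z\<in>?F (prepend a x). exp (birkhoff_sum g (Suc n) z))"
    unfolding shift_fibre_Suc[OF Suc.prems] by (rule sum.UNION_disjoint[OF finite_preds _ disj]) (use IH in blast)
  also have "\<dots> = (\<Sum>a\<in>preds x. \<Sum>z\<in>?F (prepend a x). exp (g (prepend a x)) * exp (birkhoff_sum g n z))"
    by (intro sum.cong refl) (auto simp: birkhoff_sum_def exp_add[symmetric] add_ac)
  also have "\<dots> = (\<Sum>a\<in>preds x. exp (g (prepend a x)))"
    by (rule sum.cong[OF refl]) (simp add: IH flip: sum_distrib_left)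
  also have "\<dots> = 1"
    using g Suc.prems by (simp add: normalized_def)
  finally show ?case
    using IH(1) by (simp only: shift_fibre_Suc[OF Suc.prems]) auto
qed

definition letters :: "nat \<Rightarrow> (nat \<Rightarrow> 'r) \<Rightarrow> 'r list" where
  "letters n = itinerary shift (\<lambda>x. x 0) n"

lemma letters_eq_iff: "letters n x = letters n y \<longleftrightarrow> agree n x y"
  by (simp add: letters_def itinerary_eq_iff agree_def)

lemma fibres_letters: "fibres S (letters n) = cylinder n ` S"
  by (auto simp: fibres_def cylinder_def letters_eq_iff image_def)

text \<open>
  Points of the form \<open>w p\<close>, with a word \<open>w\<close> and a tail \<open>p\<close> that depends only on the last letter of \<open>w\<close>.
  They meet every cylinder of length \<open>n\<close>, but have only \<open>CARD('r)\<close> different \<open>n\<close>-th images.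
\<close>

lemma cylinder_representative:
  obtains p :: "'r \<Rightarrow> nat \<Rightarrow> 'r" where "\<And>b. p b \<in> S"
    "\<And>x n. x \<in> S \<Longrightarrow> n > 0 \<Longrightarrow> \<exists>z\<in>cylinder n x. \<exists>b. (shift ^^ n) z = p b"
proof
  \<comment> \<open>Tails that may follow the letter \<open>b\<close>.\<close>
  define p where "p b = shift (point b)" for b
  show "p b \<in> S" for b
    by (simp add: p_def)
  fix x n assume x: "x \<in> S" and n: "n > (0::nat)"
  define z where "z j = (if j < n then x j else p (x (n - 1)) (j - n))" for j
  have "adj (z j) (z (Suc j))" for j
  proof -
    consider "Suc j < n" | "Suc j = n" | "n \<le> j"
      by linarith
    then show ?thesis
    proof cases
      case 1
      then show ?thesis
        using x by (simp add: z_def mem_S)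
    next
      case 2
      have "adj (point (x j) 0) (point (x j) 1)"
        using point_in_S[of "x j"] unfolding mem_S by (metis One_nat_def)
      then show ?thesis
        using 2 by (auto simp: z_def p_def)
    next
      case 3
      have "p (x (n - 1)) \<in> S"
        by (simp add: p_def)
      then have "adj (p (x (n - 1)) (j - n)) (p (x (n - 1)) (Suc (j - n)))"
        unfolding mem_S by blast
      then show ?thesis
        using 3 by (simp add: z_def Suc_diff_le)
    qed
  qed
  then have "z \<in> cylinder n x"
    by (simp add: cylinder_def mem_S agree_def z_def)
  moreover have "(shift ^^ n) z = p (x (n - 1))"
    by (auto simp: fun_eq_iff z_def)
  ultimately show "\<exists>z\<in>cylinder n x. \<exists>b. (shift ^^ n) z = p b"
    by blast
qed

lemma cylinder_eqI: "w \<in> cylinder n x \<Longrightarrow> cylinder n x = cylinder n w"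
  by (simp add: cylinder_def agree_def)

lemma finite_cylinders: "finite (cylinder n ` S)"
proof -
  obtain R where R: "finite R" "R \<subseteq> S" "\<And>x. x \<in> S \<Longrightarrow> \<exists>y\<in>R. agree n x y"
    by (rule finite_agree_net) blast
  have "cylinder n ` S \<subseteq> cylinder n ` R"
  proof
    fix C assume "C \<in> cylinder n ` S"
    then obtain x where x: "x \<in> S" "C = cylinder n x"
      by blast
    then obtain y where "y \<in> R" "agree n x y"
      using R(3) by blast
    moreover from this have "cylinder n x = cylinder n y"
      using R(2) by (intro cylinder_eqI) (auto simp: cylinder_def agree_sym)
    ultimately show "C \<in> cylinder n ` R"
      using x by blast
  qed
  then show ?thesis
    using R(1) finite_surj by blast
qed

lemma determined_cylinder: "determined n (cylinder n x)"
  unfolding determined_def cylinder_def by (auto simp: agree_def)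

text \<open>
  Each of the at most \<open>CARD('r)\<close> tails contributes at most 1 to the sum, by \<open>birkhoff_sum_fibre\<close>.
\<close>

lemma cylinder_sum_bound:
  assumes g: "normalized g" and n: "n > 0"
  obtains z where "\<And>C. C \<in> cylinder n ` S \<Longrightarrow> z C \<in> C"
    "(\<Sum>C\<in>cylinder n ` S. exp (birkhoff_sum g n (z C))) \<le> real CARD('r)"
proof -
  obtain p :: "'r \<Rightarrow> nat \<Rightarrow> 'r" where p: "\<And>b. p b \<in> S"
    "\<And>x n. x \<in> S \<Longrightarrow> n > 0 \<Longrightarrow> \<exists>z\<in>cylinder n x. \<exists>b. (shift ^^ n) z = p b"
    by (rule cylinder_representative) blast
  have "\<forall>C\<in>cylinder n ` S. \<exists>w. w \<in> C \<and> (\<exists>b. (shift ^^ n) w = p b)"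
    using p(2)[OF _ n] by blast
  from bchoice[OF this] obtain z where
    z: "\<And>C. C \<in> cylinder n ` S \<Longrightarrow> z C \<in> C \<and> (\<exists>b. (shift ^^ n) (z C) = p b)"
    by blast
  let ?F = "\<lambda>x. {z \<in> S. (shift ^^ n) z = x}"
  have F: "finite (?F x)" "(\<Sum>z\<in>?F x. exp (birkhoff_sum g n z)) = 1" if "x \<in> range p" for x
  proof -
    have "x \<in> S"
      using that p(1) by blast
    from birkhoff_sum_fibre[OF g this, of n]
    show "finite (?F x)" "(\<Sum>z\<in>?F x. exp (birkhoff_sum g n z)) = 1"
      by blast+
  qed
  then have fin: "finite (\<Union>x\<in>range p. ?F x)"
    by (intro finite_UN_I) simp_all
  have inj: "inj_on z (cylinder n ` S)"
  proof (rule inj_onI)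
    fix C D assume CD: "C \<in> cylinder n ` S" "D \<in> cylinder n ` S" "z C = z D"
    have "z C \<in> C" "z C \<in> D"
      using z[OF CD(1)] z[OF CD(2)] CD(3) by simp_all
    moreover obtain x y where "C = cylinder n x" "D = cylinder n y"
      using CD(1,2) by blast
    ultimately show "C = D"
      using cylinder_eqI[of "z C" n x] cylinder_eqI[of "z C" n y] by simp
  qed
  have sub: "z ` cylinder n ` S \<subseteq> (\<Union>x\<in>range p. ?F x)"
  proof
    fix w assume "w \<in> z ` cylinder n ` S"
    then obtain C where C: "C \<in> cylinder n ` S" "w = z C"
      by blast
    obtain b where "w \<in> C" "(shift ^^ n) w = p b"
      using z[OF C(1)] C(2) by auto
    moreover have "C \<subseteq> S"
      using C(1) by (auto simp: cylinder_def)
    ultimately show "w \<in> (\<Union>x\<in>range p. ?F x)"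
      by blast
  qed
  have "(\<Sum>C\<in>cylinder n ` S. exp (birkhoff_sum g n (z C))) = (\<Sum>w\<in>z ` cylinder n ` S. exp (birkhoff_sum g n w))"
    by (simp add: sum.reindex[OF inj])
  also have "\<dots> \<le> (\<Sum>w\<in>(\<Union>x\<in>range p. ?F x). exp (birkhoff_sum g n w))"
    by (rule sum_mono2[OF fin sub]) simp
  also have "\<dots> = (\<Sum>x\<in>range p. \<Sum>w\<in>?F x. exp (birkhoff_sum g n w))"
    using F(1) by (intro sum.UNION_disjoint) auto
  also have "\<dots> = real (card (range p))"
    using F(2) by simp
  also have "\<dots> \<le> real CARD('r)"
    by (simp add: card_image_le)
  finally show thesis
    using that z by blast
qed

end

section \<open>The upper bound in the variational principle\<close>

lemma gibbs_inequality:
  fixes p b :: "'i \<Rightarrow> real"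
  assumes I: "finite I" "I \<noteq> {}" and nonneg: "\<And>i. i \<in> I \<Longrightarrow> 0 \<le> p i" and total: "(\<Sum>i\<in>I. p i) = 1"
  shows "(\<Sum>i\<in>I. p i * b i) - (\<Sum>i\<in>I. p i * ln (p i)) \<le> ln (\<Sum>i\<in>I. exp (b i))"
proof -
  define Z where "Z = (\<Sum>i\<in>I. exp (b i))"
  have Z: "0 < Z"
    unfolding Z_def using I by (intro sum_pos) auto
  have "p i * b i - p i * ln (p i) - p i * ln Z \<le> exp (b i) / Z - p i" if "i \<in> I" for i
  proof (cases "p i = 0")
    case True
    then show ?thesis
      using Z by simp
  next
    case False
    then have p: "0 < p i"
      using nonneg[OF that] by simp
    have "ln (exp (b i) / (Z * p i)) \<le> exp (b i) / (Z * p i) - 1"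
      using Z p by (intro ln_le_minus_one) simp
    then have "p i * ln (exp (b i) / (Z * p i)) \<le> p i * (exp (b i) / (Z * p i) - 1)"
      using p by simp
    then show ?thesis
      using Z p by (simp add: ln_mult ln_div algebra_simps)
  qed
  then have "(\<Sum>i\<in>I. p i * b i - p i * ln (p i) - p i * ln Z) \<le> (\<Sum>i\<in>I. exp (b i) / Z - p i)"
    by (rule sum_mono)
  also have "\<dots> = 0"
    using Z by (simp add: sum_subtractf total flip: sum_divide_distrib) (simp add: Z_def)
  finally have "(\<Sum>i\<in>I. p i * b i) - (\<Sum>i\<in>I. p i * ln (p i)) - (\<Sum>i\<in>I. p i) * ln Z \<le> 0"
    by (simp add: sum_subtractf sum_distrib_right)
  then show ?thesis
    by (simp add: total Z_def)
qed

locale shift_invariant_measure = symmetric_subshift M \<Lambda> + measure_preserving \<nu> shift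
  for M :: "real^'r::finite^'r" and \<Lambda> :: real and \<nu> :: "(nat \<Rightarrow> 'r) measure" +
  assumes sets_\<nu>: "sets \<nu> = sets (subshift_borel \<Lambda> M)"
begin

lemma space_\<nu> [simp]: "space \<nu> = S"
  using sets_eq_imp_space_eq[OF sets_\<nu>] by simp

lemma determined_sets: "determined n A \<Longrightarrow> A \<in> sets \<nu>"
  unfolding sets_\<nu> by (rule clopen_in_sets)

lemma simple_function_letters: "simple_function \<nu> (letters n)"
proof -
  have "determined 1 {x \<in> S. x 0 = b}" for b
    by (auto simp: determined_def agree_def)
  then have "simple_function \<nu> (\<lambda>x. x 0)"
    unfolding simple_function_def using determined_sets
    by (auto simp: vimage_def Int_def conj_commute)
  then show ?thesis
    unfolding letters_def by (rule simple_function_itinerary)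
qed

lemma lip_integrable: 
  assumes "lip K u"
  shows "integrable \<nu> u"
proof -
  obtain B where "\<And>x. x \<in> S \<Longrightarrow> \<bar>u x\<bar> \<le> B"
    by (rule lip_bounded[OF assms]) blast
  then show ?thesis
    using lip_measurable[OF assms] measurable_cong_sets[OF sets_\<nu> refl]
    by (intro integrable_const_bound[where B=B]) auto
qed

lemma integral_funpow_shift:
  assumes "lip K u"
  shows "integrable \<nu> (\<lambda>x. u ((shift ^^ i) x))" "(\<integral>x. u ((shift ^^ i) x) \<partial>\<nu>) = (\<integral>x. u x \<partial>\<nu>)"
proof -
  have u: "u \<in> borel_measurable \<nu>"
    using lip_integrable[OF assms] by simp
  show "(\<integral>x. u ((shift ^^ i) x) \<partial>\<nu>) = (\<integral>x. u x \<partial>\<nu>)"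
    using integral_distr[OF funpow_T_measurable u, of i] by (simp add: funpow_T_invariant)
  show "integrable \<nu> (\<lambda>x. u ((shift ^^ i) x))"
    using integrable_distr_eq[OF funpow_T_measurable u, of i] lip_integrable[OF assms]
    by (simp add: funpow_T_invariant)
qed

lemma integral_birkhoff_sum:
  assumes "lip K g"
  shows "integrable \<nu> (birkhoff_sum g n)" "(\<integral>x. birkhoff_sum g n x \<partial>\<nu>) = real n * (\<integral>x. g x \<partial>\<nu>)"
proof -
  note int = integral_funpow_shift[OF assms]
  show "integrable \<nu> (birkhoff_sum g n)"
    unfolding birkhoff_sum_def[abs_def] by (rule Bochner_Integration.integrable_sum) (rule int(1))
  have "(\<integral>x. birkhoff_sum g n x \<partial>\<nu>) = (\<Sum>i<n. \<integral>x. g ((shift ^^ i) x) \<partial>\<nu>)"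
    unfolding birkhoff_sum_def by (rule Bochner_Integration.integral_sum) (rule int(1))
  also have "\<dots> = (\<Sum>i<n. \<integral>x. g x \<partial>\<nu>)"
    by (simp only: int(2))
  finally show "(\<integral>x. birkhoff_sum g n x \<partial>\<nu>) = real n * (\<integral>x. g x \<partial>\<nu>)"
    by simp
qed

lemma cylinder_indicator_sum:
  assumes "x \<in> S"
  shows "(\<Sum>C\<in>cylinder n ` S. indicator C x * c C) = (c (cylinder n x) :: real)"
proof -
  have "(\<Sum>C\<in>cylinder n ` S. indicator C x * c C) = (\<Sum>C\<in>cylinder n ` S. if C = cylinder n x then c C else 0)"
  proof (rule sum.cong[OF refl])
    fix C assume "C \<in> cylinder n ` S"
    then obtain y where C: "C = cylinder n y"
      by blast
    have "x \<in> cylinder n x"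
      using assms by (simp add: cylinder_def)
    then have "x \<in> C \<longleftrightarrow> C = cylinder n x"
      using cylinder_eqI[of x n y] unfolding C by blast
    then show "indicator C x * c C = (if C = cylinder n x then c C else 0)"
      unfolding indicator_def by simp
  qed
  then show ?thesis
    using assms by (simp add: finite_cylinders)
qed

lemma integral_cylinder_sum:
  "integrable \<nu> (\<lambda>x. \<Sum>C\<in>cylinder n ` S. indicator C x * c C)"
  "(\<integral>x. (\<Sum>C\<in>cylinder n ` S. indicator C x * c C) \<partial>\<nu>) = (\<Sum>C\<in>cylinder n ` S. prob C * (c C :: real))"
proof -
  have int: "integrable \<nu> (\<lambda>x. indicator C x * c C)" "(\<integral>x. indicator C x * c C \<partial>\<nu>) = prob C * c C"
    if "C \<in> cylinder n ` S" for C
  proof -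
    have "C \<in> sets \<nu>"
      using that determined_sets[OF determined_cylinder] by blast
    moreover have "C \<inter> S = C"
      using that by (auto simp: cylinder_def)
    ultimately show "integrable \<nu> (\<lambda>x. indicator C x * c C)" "(\<integral>x. indicator C x * c C \<partial>\<nu>) = prob C * c C"
      by (simp_all add: emeasure_eq_measure)
  qed
  show "integrable \<nu> (\<lambda>x. \<Sum>C\<in>cylinder n ` S. indicator C x * c C)"
    by (rule Bochner_Integration.integrable_sum) (rule int)
  show "(\<integral>x. (\<Sum>C\<in>cylinder n ` S. indicator C x * c C) \<partial>\<nu>) = (\<Sum>C\<in>cylinder n ` S. prob C * c C)"
  proof -
    have "(\<integral>x. (\<Sum>C\<in>cylinder n ` S. indicator C x * c C) \<partial>\<nu>) = (\<Sum>C\<in>cylinder n ` S. \<integral>x. indicator C x * c C \<partial>\<nu>)"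
      by (rule Bochner_Integration.integral_sum) (rule int(1))
    also have "\<dots> = (\<Sum>C\<in>cylinder n ` S. prob C * c C)"
      by (rule sum.cong[OF refl]) (rule int(2))
    finally show ?thesis .
  qed
qed

lemma prob_cylinders: "(\<Sum>C\<in>cylinder n ` S. prob C) = 1"
proof -
  have "(\<Sum>C\<in>cylinder n ` S. prob C * 1) = (\<integral>x. (\<Sum>C\<in>cylinder n ` S. indicator C x * 1) \<partial>\<nu>)"
    by (rule integral_cylinder_sum(2)[symmetric])
  also have "\<dots> = (\<integral>x. 1 \<partial>\<nu>)"
    by (rule Bochner_Integration.integral_cong) (simp_all only: space_\<nu> cylinder_indicator_sum)
  finally show ?thesis
    using prob_space by simp
qed

lemma observable_entropy_letters:
  "observable_entropy \<nu> (letters n) = - (\<Sum>C\<in>cylinder n ` S. prob C * ln (prob C))"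
  by (simp add: observable_entropy_def partition_entropy_def fibres_letters)

text \<open>
  Up to the distortion constant, the integral of the Birkhoff sum is the mean of its values at one point
  per cylinder, so the Gibbs inequality bounds the left-hand side by the logarithm of the sum of
  their exponentials.
\<close>

lemma entropy_letters_upper:
  assumes g: "lip L g" "normalized g" and n: "n > 0"
  shows "observable_entropy \<nu> (letters n) + real n * (\<integral>x. g x \<partial>\<nu>) \<le> ln (real CARD('r)) + L / (1 - \<Lambda>)"
proof -
  obtain z where z: "\<And>C. C \<in> cylinder n ` S \<Longrightarrow> z C \<in> C"
    and sum_z: "(\<Sum>C\<in>cylinder n ` S. exp (birkhoff_sum g n (z C))) \<le> real CARD('r)"
    by (rule cylinder_sum_bound[OF g(2) n]) blast
  let ?D = "L / (1 - \<Lambda>)" and ?b = "\<lambda>C. birkhoff_sum g n (z C)"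
  have "real n * (\<integral>x. g x \<partial>\<nu>) = (\<integral>x. birkhoff_sum g n x \<partial>\<nu>)"
    by (simp add: integral_birkhoff_sum[OF g(1)])
  also have "\<dots> \<le> (\<integral>x. (\<Sum>C\<in>cylinder n ` S. indicator C x * (?b C + ?D)) \<partial>\<nu>)"
  proof (rule integral_mono[OF integral_birkhoff_sum(1)[OF g(1)] integral_cylinder_sum(1)])
    fix x assume "x \<in> space \<nu>"
    then have x: "x \<in> S"
      by simp
    then have "z (cylinder n x) \<in> cylinder n x"
      using z by blast
    then have "z (cylinder n x) \<in> S" "agree n x (z (cylinder n x))"
      by (auto simp: cylinder_def agree_sym)
    then show "birkhoff_sum g n x \<le> (\<Sum>C\<in>cylinder n ` S. indicator C x * (?b C + ?D))"
      unfolding cylinder_indicator_sum[OF x] by (intro bounded_distortion[OF g(1) x])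
  qed
  also have "\<dots> = (\<Sum>C\<in>cylinder n ` S. prob C * (?b C + ?D))"
    by (rule integral_cylinder_sum(2))
  also have "\<dots> = (\<Sum>C\<in>cylinder n ` S. prob C * ?b C) + (\<Sum>C\<in>cylinder n ` S. prob C) * ?D"
    by (simp only: distrib_left sum.distrib sum_distrib_right)
  also have "\<dots> = (\<Sum>C\<in>cylinder n ` S. prob C * ?b C) + ?D"
    by (simp add: prob_cylinders)
  finally have int: "real n * (\<integral>x. g x \<partial>\<nu>) \<le> (\<Sum>C\<in>cylinder n ` S. prob C * ?b C) + ?D" .
  have "(\<Sum>C\<in>cylinder n ` S. prob C * ?b C) - (\<Sum>C\<in>cylinder n ` S. prob C * ln (prob C))
      \<le> ln (\<Sum>C\<in>cylinder n ` S. exp (?b C))"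
    by (rule gibbs_inequality) (simp_all add: finite_cylinders prob_cylinders)
  also have "\<dots> \<le> ln (real CARD('r))"
    using sum_z by (subst ln_le_cancel_iff) (auto intro!: sum_pos simp: finite_cylinders)
  finally show ?thesis
    using int by (simp add: observable_entropy_letters)
qed

subsection \<open>Approximation by cylinders\<close>

lemma cond_entropy_zero:
  assumes "\<And>x y. x \<in> space \<nu> \<Longrightarrow> y \<in> space \<nu> \<Longrightarrow> Z x = Z y \<Longrightarrow> X x = X y"
  shows "cond_entropy \<nu> X Z = 0"
proof -
  have "observable_entropy \<nu> (\<lambda>x. (X x, Z x)) = observable_entropy \<nu> Z"
    by (rule observable_entropy_cong) (metis assms prod.inject)
  then show ?thesis
    by (simp add: cond_entropy_def)
qed

lemma simple_function_indicator_set: "A \<in> sets \<nu> \<Longrightarrow> simple_function \<nu> (\<lambda>x. x \<in> A)"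
proof -
  assume A: "A \<in> sets \<nu>"
  have *: "A \<inter> space \<nu> \<in> sets \<nu>" "space \<nu> - A \<in> sets \<nu>"
    using A by (blast intro: sets.Int sets.top)+
  have "(\<lambda>x. x \<in> A) -` {b} \<inter> space \<nu> \<in> sets \<nu>" for b
  proof -
    have "(\<lambda>x. x \<in> A) -` {b} \<inter> space \<nu> = (if b then A \<inter> space \<nu> else space \<nu> - A)"
      by auto
    then show ?thesis
      using * by presburger
  qed
  then show ?thesis
    unfolding simple_function_def by (simp add: finite_subset[of _ UNIV])
qed

lemma cond_entropy_letters_antimono:
  "simple_function \<nu> X \<Longrightarrow> m \<le> n \<Longrightarrow> cond_entropy \<nu> X (letters n) \<le> cond_entropy \<nu> X (letters m)"
  by (rule cond_entropy_antimono) (auto simp: simple_function_letters letters_eq_iff intro: agree_mono)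

lemma cond_entropy_nested:
  assumes B: "B \<in> sets \<nu>" and U: "U \<in> sets \<nu>" and "B \<subseteq> U"
  shows "cond_entropy \<nu> (\<lambda>x. x \<in> U) (\<lambda>x. x \<in> B) =
    (1 - prob B) * ln (1 - prob B) - (prob U - prob B) * ln (prob U - prob B) - (1 - prob U) * ln (1 - prob U)"
proof -
  have US: "U \<subseteq> S" "B \<subseteq> S"
    using U B sets.sets_into_space by fastforce+
  have s1: "{x \<in> S. x \<in> B} = B" "{x \<in> S. x \<in> U \<and> x \<in> B} = B" "{x \<in> S. x \<notin> U \<and> x \<in> B} = {}"
    "{x \<in> S. x \<in> U \<and> x \<notin> B} = U - B" "{x \<in> S. x \<notin> U \<and> x \<notin> B} = S - U" "{x \<in> S. x \<notin> B} = S - B"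
    using assms(3) US by auto
  have "observable_entropy \<nu> (\<lambda>x. (x \<in> U, x \<in> B)) =
      - (\<Sum>(a, b)\<in>UNIV \<times> UNIV. prob {x \<in> S. (x \<in> U) = a \<and> (x \<in> B) = b} * ln (prob {x \<in> S. (x \<in> U) = a \<and> (x \<in> B) = b}))"
    by (subst observable_entropy_eq_sum[where B="UNIV \<times> UNIV"]) (auto simp: case_prod_beta prod_eq_iff)
  also have "\<dots> = - (prob B * ln (prob B) + (prob U - prob B) * ln (prob U - prob B) + (1 - prob U) * ln (1 - prob U))"
    unfolding sum.cartesian_product[symmetric]
    by (simp add: UNIV_bool s1 finite_measure_Diff[OF U B assms(3)] prob_compl[OF U, unfolded space_\<nu>])
  finally have e1: "observable_entropy \<nu> (\<lambda>x. (x \<in> U, x \<in> B)) = \<dots>" .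
  have "observable_entropy \<nu> (\<lambda>x. x \<in> B) =
      - (\<Sum>b\<in>UNIV. prob {x \<in> S. (x \<in> B) = b} * ln (prob {x \<in> S. (x \<in> B) = b}))"
    by (subst observable_entropy_eq_sum[where B=UNIV]) auto
  also have "\<dots> = - (prob B * ln (prob B) + (1 - prob B) * ln (1 - prob B))"
    by (simp add: UNIV_bool s1 prob_compl[OF B, unfolded space_\<nu>])
  finally show ?thesis
    using e1 by (simp add: cond_entropy_def)
qed

lemma cond_entropy_increasing_union:
  assumes B: "\<And>k. B k \<in> sets \<nu>" and "incseq B"
  shows "(\<lambda>k. cond_entropy \<nu> (\<lambda>x. x \<in> (\<Union>k. B k)) (\<lambda>x. x \<in> B k)) \<longlonglongrightarrow> 0"
proof -
  let ?U = "\<Union>k. B k"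
  have U: "?U \<in> sets \<nu>"
    using B by auto
  have lim: "(\<lambda>k. prob (B k)) \<longlonglongrightarrow> prob ?U"
    using B assms(2) by (intro finite_Lim_measure_incseq) auto
  have sub: "B k \<subseteq> ?U" for k
    by blast
  have le: "prob (B k) \<le> prob ?U" for k
    by (rule finite_measure_mono[OF sub U])
  have "(\<lambda>k. (1 - prob (B k)) * ln (1 - prob (B k)) - (prob ?U - prob (B k)) * ln (prob ?U - prob (B k))
      - (1 - prob ?U) * ln (1 - prob ?U))
    \<longlonglongrightarrow> (1 - prob ?U) * ln (1 - prob ?U) - (prob ?U - prob ?U) * ln (prob ?U - prob ?U) - (1 - prob ?U) * ln (1 - prob ?U)"
    using le by (intro tendsto_diff tendsto_x_ln_x tendsto_const lim) auto
  then show ?thesis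
    unfolding cond_entropy_nested[OF B U sub] by simp
qed

text \<open>
  The sets \<open>A\<close> with this property form a sigma-algebra: complements have the same level sets, finite
  unions are functions of pairs, and an increasing union is approximated in entropy by its terms.
  It contains the sets determined by finitely many letters, hence all Borel sets.
\<close>

lemma cond_entropy_set_small:
  assumes "A \<in> sets \<nu>" "e > 0"
  shows "\<exists>m. cond_entropy \<nu> (\<lambda>x. x \<in> A) (letters m) < e"
proof -
  have "A \<in> sigma_sets S clopens"
    using assms(1) by (simp add: sets_\<nu> sets_subshift_borel)
  then show ?thesis
    using assms(2)
  proof (induction A arbitrary: e rule: sigma_sets.induct)
    case (Basic A)
    then obtain n where n: "determined n A"
      by (auto simp: clopens_def)
    have "cond_entropy \<nu> (\<lambda>x. x \<in> A) (letters n) = 0"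
      by (rule cond_entropy_zero) (use n in \<open>auto simp: letters_eq_iff determined_def dest: agree_sym\<close>)
    then show ?case
      using Basic by metis
  next
    case Empty
    have "cond_entropy \<nu> (\<lambda>x. x \<in> {}) (letters 0) = 0"
      by (rule cond_entropy_zero) simp
    then show ?case
      using Empty by metis
  next
    case (Compl A)
    have "cond_entropy \<nu> (\<lambda>x. x \<in> S - A) (letters m) = cond_entropy \<nu> (\<lambda>x. x \<in> A) (letters m)" for m
    proof -
      have "observable_entropy \<nu> (\<lambda>x. (x \<in> S - A, letters m x)) = observable_entropy \<nu> (\<lambda>x. (x \<in> A, letters m x))"
        by (rule observable_entropy_cong) auto
      then show ?thesis
        by (simp add: cond_entropy_def)
    qed
    then show ?case
      using Compl.IH[OF Compl.prems] by simp
  next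
    case (Union A)
    have A: "A k \<in> sets \<nu>" for k
      using Union.hyps by (simp add: sets_\<nu> sets_subshift_borel)
    define B where "B k = (\<Union>i<k. A i)" for k
    have B: "B k \<in> sets \<nu>" for k
      using A by (auto simp: B_def)
    have fin: "\<exists>m. cond_entropy \<nu> (\<lambda>x. x \<in> B k) (letters m) < e" if "e > 0" for k e
      using that
    proof (induction k arbitrary: e)
      case 0
      have "cond_entropy \<nu> (\<lambda>x. x \<in> B 0) (letters 0) = 0"
        by (rule cond_entropy_zero) (simp add: B_def)
      then show ?case
        using 0 by metis
    next
      case (Suc k)
      obtain m1 where m1: "cond_entropy \<nu> (\<lambda>x. x \<in> B k) (letters m1) < e / 2"
        using Suc.IH[of "e / 2"] Suc.prems by auto
      obtain m2 where m2: "cond_entropy \<nu> (\<lambda>x. x \<in> A k) (letters m2) < e / 2"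
        using Union.IH[of "e / 2" k] Suc.prems by auto
      note sf = simple_function_indicator_set[OF B] simple_function_indicator_set[OF A]
      let ?m = "max m1 m2"
      have "cond_entropy \<nu> (\<lambda>x. x \<in> B (Suc k)) (letters ?m) \<le> cond_entropy \<nu> (\<lambda>x. (x \<in> B k, x \<in> A k)) (letters ?m)"
      proof (rule cond_entropy_mono)
        fix x y assume "(x \<in> B k, x \<in> A k) = (y \<in> B k, y \<in> A k)"
        then show "(x \<in> B (Suc k)) = (y \<in> B (Suc k))"
          by (auto simp: B_def lessThan_Suc)
      qed (intro simple_function_Pair sf simple_function_letters)+
      also have "\<dots> \<le> cond_entropy \<nu> (\<lambda>x. x \<in> B k) (letters ?m) + cond_entropy \<nu> (\<lambda>x. x \<in> A k) (letters ?m)"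
        by (intro cond_entropy_pair_le sf simple_function_letters)
      also have "\<dots> \<le> cond_entropy \<nu> (\<lambda>x. x \<in> B k) (letters m1) + cond_entropy \<nu> (\<lambda>x. x \<in> A k) (letters m2)"
        by (intro add_mono cond_entropy_letters_antimono sf) auto
      also have "\<dots> < e"
        using m1 m2 by simp
      finally show ?case
        by blast
    qed
    have U: "(\<Union>k. A k) = (\<Union>k. B k)"
      by (auto simp: B_def)
    have inc: "incseq B"
      unfolding B_def incseq_def by (intro allI impI UN_mono) auto
    have "eventually (\<lambda>k. cond_entropy \<nu> (\<lambda>x. x \<in> (\<Union>k. B k)) (\<lambda>x. x \<in> B k) < e / 2) sequentially"
      by (rule order_tendstoD(2)[OF cond_entropy_increasing_union[OF B inc]]) (use Union.prems in simp)
    then obtain k where k: "cond_entropy \<nu> (\<lambda>x. x \<in> (\<Union>k. B k)) (\<lambda>x. x \<in> B k) < e / 2"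
      by (auto simp: eventually_sequentially)
    obtain m where m: "cond_entropy \<nu> (\<lambda>x. x \<in> B k) (letters m) < e / 2"
      using fin[of "e / 2" k] Union.prems by auto
    have UB: "(\<Union>k. B k) \<in> sets \<nu>"
      using B by auto
    have "cond_entropy \<nu> (\<lambda>x. x \<in> (\<Union>k. B k)) (letters m)
        \<le> cond_entropy \<nu> (\<lambda>x. x \<in> (\<Union>k. B k)) (\<lambda>x. x \<in> B k) + cond_entropy \<nu> (\<lambda>x. x \<in> B k) (letters m)"
      by (rule cond_entropy_triangle[OF simple_function_indicator_set[OF UB] simple_function_indicator_set[OF B] simple_function_letters])
    then show ?case
      unfolding U using k m by (intro exI[of _ m]) linarith
  qed
qed

text \<open>
  An observable with finitely many values is built up from the indicators of its level sets, one value
  at a time.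
\<close>

lemma cond_entropy_letters_small:
  assumes X: "simple_function \<nu> X" and "e > 0"
  shows "\<exists>m. cond_entropy \<nu> X (letters m) < e"
proof -
  define XV where "XV V x = (if X x \<in> V then Some (X x) else None)" for V x
  have sf: "simple_function \<nu> (XV V)" for V
    using simple_function_compose[OF X, of "\<lambda>v. if v \<in> V then Some v else None"] by (simp add: XV_def[abs_def] comp_def)
  have sfv: "simple_function \<nu> (\<lambda>x. X x = v)" for v
    using simple_function_compose[OF X, of "\<lambda>w. w = v"] by (simp add: comp_def)
  have "\<exists>m. cond_entropy \<nu> (XV V) (letters m) < e" if "finite V" "e > 0" for V e
    using that
  proof (induction V arbitrary: e rule: finite_induct)
    case empty
    have "cond_entropy \<nu> (XV {}) (letters 0) = 0"
      by (rule cond_entropy_zero) (simp add: XV_def)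
    then show ?case
      using empty by metis
  next
    case (insert v V)
    obtain m1 where m1: "cond_entropy \<nu> (XV V) (letters m1) < e / 2"
      using insert.IH[of "e / 2"] insert.prems by auto
    obtain m2 where m2: "cond_entropy \<nu> (\<lambda>x. x \<in> {x \<in> space \<nu>. X x = v}) (letters m2) < e / 2"
      using cond_entropy_set_small[OF simple_function_level_set[OF X], of "e / 2" v] insert.prems by auto
    have "observable_entropy \<nu> (\<lambda>x. (x \<in> {x \<in> space \<nu>. X x = v}, letters m2 x)) = observable_entropy \<nu> (\<lambda>x. (X x = v, letters m2 x))"
      by (rule observable_entropy_cong) auto
    then have m2: "cond_entropy \<nu> (\<lambda>x. X x = v) (letters m2) < e / 2"
      using m2 by (simp add: cond_entropy_def)
    let ?m = "max m1 m2"
    have "cond_entropy \<nu> (XV (insert v V)) (letters ?m) \<le> cond_entropy \<nu> (\<lambda>x. (XV V x, X x = v)) (letters ?m)"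
    proof (rule cond_entropy_mono)
      fix x y assume "(XV V x, X x = v) = (XV V y, X y = v)"
      then show "XV (insert v V) x = XV (insert v V) y"
        by (auto simp: XV_def split: if_splits)
    qed (intro simple_function_Pair sf sfv simple_function_letters)+
    also have "\<dots> \<le> cond_entropy \<nu> (XV V) (letters ?m) + cond_entropy \<nu> (\<lambda>x. X x = v) (letters ?m)"
      by (intro cond_entropy_pair_le sf sfv simple_function_letters)
    also have "\<dots> \<le> cond_entropy \<nu> (XV V) (letters m1) + cond_entropy \<nu> (\<lambda>x. X x = v) (letters m2)"
      by (intro add_mono cond_entropy_letters_antimono sf sfv) auto
    also have "\<dots> < e"
      using m1 m2 by simp
    finally show ?case
      by blast
  qed
  then obtain m where "cond_entropy \<nu> (XV (X ` space \<nu>)) (letters m) < e"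
    using simple_functionD(1)[OF X] assms(2) by blast
  moreover have "cond_entropy \<nu> X (letters m) \<le> cond_entropy \<nu> (XV (X ` space \<nu>)) (letters m)"
    by (rule cond_entropy_mono[OF sf X simple_function_letters]) (auto simp: XV_def split: if_splits)
  ultimately show ?thesis
    by (intro exI[of _ m]) linarith
qed

lemma cond_entropy_itinerary_letters:
  assumes X: "simple_function \<nu> X" and e: "cond_entropy \<nu> X (letters m) \<le> e" and "n + m \<le> N"
  shows "cond_entropy \<nu> (itinerary shift X n) (letters N) \<le> real n * e"
  using assms(3)
proof (induction n)
  case 0
  have "cond_entropy \<nu> (itinerary shift X 0) (letters N) = 0"
    by (rule cond_entropy_zero) (simp add: itinerary_def)
  then show ?case
    by (simp only: of_nat_0 mult_zero_left order_refl)
next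
  case (Suc n)
  note sf = simple_function_itinerary[OF X] simple_function_funpow[OF X] simple_function_letters
    simple_function_funpow[OF simple_function_letters]
  have "cond_entropy \<nu> (itinerary shift X (Suc n)) (letters N)
      \<le> cond_entropy \<nu> (\<lambda>x. (itinerary shift X n x, X ((shift ^^ n) x))) (letters N)"
  proof (rule cond_entropy_mono)
    fix x y assume "(itinerary shift X n x, X ((shift ^^ n) x)) = (itinerary shift X n y, X ((shift ^^ n) y))"
    then show "itinerary shift X (Suc n) x = itinerary shift X (Suc n) y"
      by (auto simp: itinerary_eq_iff less_Suc_eq)
  qed (intro simple_function_Pair sf)+
  also have "\<dots> \<le> cond_entropy \<nu> (itinerary shift X n) (letters N) + cond_entropy \<nu> (\<lambda>x. X ((shift ^^ n) x)) (letters N)"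
    by (intro cond_entropy_pair_le sf)
  also have "cond_entropy \<nu> (\<lambda>x. X ((shift ^^ n) x)) (letters N)
      \<le> cond_entropy \<nu> (\<lambda>x. X ((shift ^^ n) x)) (\<lambda>x. letters m ((shift ^^ n) x))"
  proof (rule cond_entropy_antimono)
    fix x y assume "letters N x = letters N y"
    then show "letters m ((shift ^^ n) x) = letters m ((shift ^^ n) y)"
      using Suc.prems by (simp add: letters_eq_iff agree_def)
  qed (intro sf)+
  also have "\<dots> \<le> e"
    using e by (simp add: cond_entropy_funpow X simple_function_letters)
  finally have "cond_entropy \<nu> (itinerary shift X (Suc n)) (letters N)
      \<le> cond_entropy \<nu> (itinerary shift X n) (letters N) + e"
    by (simp del: shift_nth)
  moreover have "cond_entropy \<nu> (itinerary shift X n) (letters N) \<le> real n * e"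
    by (rule Suc.IH) (use Suc.prems in simp)
  moreover have "real (Suc n) * e = real n * e + e"
    by (simp add: algebra_simps)
  ultimately show ?case
    by linarith
qed

text \<open>
  This includes the Kolmogorov-Sinai theorem for the partition into letters: the itinerary of length
  \<open>n\<close> of an arbitrary finite partition is determined by the first \<open>n + m\<close> letters up to an error \<open>n * e\<close>
  in entropy, so its entropy rate is at most that of the letters plus \<open>e\<close>.
\<close>

theorem ks_entropy_upper:
  assumes g: "lip L g" "normalized g"
  shows "ks_entropy \<nu> shift \<le> ereal (- (\<integral>x. g x \<partial>\<nu>))"
  unfolding ks_entropy_def
proof (rule SUP_least)
  fix P assume "P \<in> {P. finite P \<and> P \<subseteq> sets \<nu> \<and> partition_on (space \<nu>) P}"
  then have P: "finite P" "P \<subseteq> sets \<nu>" "partition_on (space \<nu>) P"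
    by auto
  let ?X = "cell P" and ?I = "\<integral>x. g x \<partial>\<nu>"
  define c where "c = ln (real CARD('r)) + L / (1 - \<Lambda>)"
  have X: "simple_function \<nu> ?X"
    by (rule simple_function_cell[OF P])
  have "entropy_wrt_partition \<nu> shift P \<le> - ?I + e" if e: "e > 0" for e
  proof -
    obtain m where m: "cond_entropy \<nu> ?X (letters m) < e"
      using cond_entropy_letters_small[OF X e] by blast
    have bound: "observable_entropy \<nu> (itinerary shift ?X n) / real n \<le> e + c / real n - ?I - real m * ?I / real n"
      if n: "n > 0" for n
    proof -
      have "observable_entropy \<nu> (itinerary shift ?X n) \<le> observable_entropy \<nu> (\<lambda>x. (itinerary shift ?X n x, letters (n + m) x))"
        by (rule observable_entropy_mono)
          (auto intro!: simple_function_Pair simple_function_letters simple_function_itinerary X)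
      also have "\<dots> = cond_entropy \<nu> (itinerary shift ?X n) (letters (n + m)) + observable_entropy \<nu> (letters (n + m))"
        by (simp add: cond_entropy_def)
      also have "\<dots> \<le> real n * e + (c - real (n + m) * ?I)"
        using cond_entropy_itinerary_letters[OF X less_imp_le[OF m] order_refl, of n]
          entropy_letters_upper[OF g, of "n + m", folded c_def] n by simp
      finally have "observable_entropy \<nu> (itinerary shift ?X n) / real n \<le> (real n * e + (c - real (n + m) * ?I)) / real n"
        by (intro divide_right_mono) auto
      also have "\<dots> = e + c / real n - ?I - real m * ?I / real n"
        using n by (simp add: field_simps)
      finally show ?thesis .
    qed
    have "(\<lambda>n. e + c / real n - ?I - real m * ?I / real n) \<longlonglongrightarrow> e + 0 - ?I - 0"
      by (intro tendsto_intros lim_const_over_n)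
    then have "entropy_wrt_partition \<nu> shift P \<le> e + 0 - ?I - 0"
      using bound by (intro LIMSEQ_le[OF entropy_wrt_partition_limit[OF P]]) (auto intro!: exI[of _ 1])
    then show ?thesis
      by simp
  qed
  then show "ereal (entropy_wrt_partition \<nu> shift P) \<le> ereal (- ?I)"
    by (simp add: field_le_epsilon)
qed

end

section \<open>The lower bound in the variational principle\<close>

context symmetric_subshift
begin

abbreviation bounded_on_S :: "((nat \<Rightarrow> 'r) \<Rightarrow> real) \<Rightarrow> bool" where
  "bounded_on_S u \<equiv> bounded (u ` S)"

definition transfer :: "((nat \<Rightarrow> 'r) \<Rightarrow> real) \<Rightarrow> ((nat \<Rightarrow> 'r) \<Rightarrow> real) \<Rightarrow> (nat \<Rightarrow> 'r) \<Rightarrow> real" where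
  "transfer g u x = (\<Sum>a\<in>preds x. exp (g (prepend a x)) * u (prepend a x))"

lemma transfer_add: "transfer g (\<lambda>x. u x + v x) = (\<lambda>x. transfer g u x + transfer g v x)"
  by (simp add: transfer_def distrib_left sum.distrib fun_eq_iff)

lemma transfer_scale: "transfer g (\<lambda>x. c * u x) = (\<lambda>x. c * transfer g u x)"
  by (simp add: transfer_def sum_distrib_left mult.left_commute fun_eq_iff)

lemma transfer_mono: "(\<And>x. x \<in> S \<Longrightarrow> u x \<le> v x) \<Longrightarrow> x \<in> S \<Longrightarrow> transfer g u x \<le> transfer g v x"
  unfolding transfer_def by (intro sum_mono mult_left_mono) auto

lemma transfer_cong: "(\<And>x. x \<in> S \<Longrightarrow> u x = v x) \<Longrightarrow> x \<in> S \<Longrightarrow> transfer g u x = transfer g v x"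
  by (intro antisym transfer_mono) simp_all

lemma transfer_const: "normalized g \<Longrightarrow> x \<in> S \<Longrightarrow> transfer g (\<lambda>_. c) x = c"
  by (simp add: transfer_def normalized_def flip: sum_distrib_right)

lemma transfer_power_add: "(transfer g ^^ k) (\<lambda>x. u x + v x) = (\<lambda>x. (transfer g ^^ k) u x + (transfer g ^^ k) v x)"
  by (induction k) (simp_all add: transfer_add)

lemma transfer_power_scale: "(transfer g ^^ k) (\<lambda>x. c * u x) = (\<lambda>x. c * (transfer g ^^ k) u x)"
  by (induction k) (simp_all add: transfer_scale)

lemma transfer_power_mono:
  assumes "\<And>x. x \<in> S \<Longrightarrow> u x \<le> v x"
  shows "x \<in> S \<Longrightarrow> (transfer g ^^ k) u x \<le> (transfer g ^^ k) v x"
  by (induction k arbitrary: x) (auto intro: assms transfer_mono)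

lemma transfer_power_const:
  assumes g: "normalized g"
  shows "x \<in> S \<Longrightarrow> (transfer g ^^ k) (\<lambda>_. c) x = c"
proof (induction k arbitrary: x)
  case (Suc k)
  have "transfer g ((transfer g ^^ k) (\<lambda>_. c)) x = transfer g (\<lambda>_. c) x"
    using Suc by (intro transfer_cong) simp_all
  then show ?case
    using transfer_const[OF g Suc.prems] by simp
qed simp

text \<open>
  A limit of the means \<open>(\<Sum>k<N. T\<^sup>k u x\<^sub>0) / N\<close>, where \<open>T\<close> is the transfer operator, along a filter on which
  they converge for all bounded \<open>u\<close> simultaneously. Replacing \<open>u\<close> by \<open>T u\<close> changes the mean by at most
  \<open>2 * B / N\<close>.
\<close>

lemma transfer_invariant_mean:
  assumes g: "normalized g"
  obtains m :: "((nat \<Rightarrow> 'r) \<Rightarrow> real) \<Rightarrow> real" where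
    "\<And>u v. bounded_on_S u \<Longrightarrow> bounded_on_S v \<Longrightarrow> m (\<lambda>x. u x + v x) = m u + m v"
    "\<And>u c. bounded_on_S u \<Longrightarrow> m (\<lambda>x. c * u x) = c * m u"
    "\<And>u v. bounded_on_S u \<Longrightarrow> bounded_on_S v \<Longrightarrow> (\<And>x. x \<in> S \<Longrightarrow> u x \<le> v x) \<Longrightarrow> m u \<le> m v"
    "m (\<lambda>_. 1) = 1"
    "\<And>u. bounded_on_S u \<Longrightarrow> m (transfer g u) = m u"
proof -
  define x0 where "x0 = point (undefined :: 'r)"
  have x0: "x0 \<in> S"
    by (simp add: x0_def)
  define t where "t u k = (transfer g ^^ k) u x0" for u k
  define a where "a u N = (\<Sum>k<N. t u k) / real N" for u and N :: nat
  have t_bound: "\<bar>t u k\<bar> \<le> B" if "\<And>x. x \<in> S \<Longrightarrow> \<bar>u x\<bar> \<le> B" for u k B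
  proof -
    have "t u k \<le> (transfer g ^^ k) (\<lambda>_. B) x0"
      unfolding t_def by (rule transfer_power_mono[OF _ x0]) (use that in \<open>force simp: abs_le_iff\<close>)
    moreover have "(transfer g ^^ k) (\<lambda>_. - B) x0 \<le> t u k"
      unfolding t_def by (rule transfer_power_mono[OF _ x0]) (use that in \<open>force simp: abs_le_iff\<close>)
    ultimately show ?thesis
      by (simp add: transfer_power_const[OF g x0] abs_le_iff)
  qed
  have "bounded (range (a u))" if u: "bounded_on_S u" for u
  proof -
    obtain B where B: "\<And>x. x \<in> S \<Longrightarrow> \<bar>u x\<bar> \<le> B"
      using u unfolding bounded_real by blast
    have "\<bar>a u N\<bar> \<le> B" for N
    proof (cases "N = 0")
      case True
      then show ?thesis
        using B[OF x0] by (simp add: a_def)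
    next
      case False
      have "\<bar>\<Sum>k<N. t u k\<bar> \<le> (\<Sum>k<N. B)"
        using t_bound[OF B] by (intro order_trans[OF sum_abs] sum_mono)
      then show ?thesis
        using False by (simp add: a_def field_simps)
    qed
    then show ?thesis
      by (intro boundedI[where B=B]) auto
  qed
  moreover obtain F where F: "F \<noteq> bot" "F \<le> sequentially" "\<And>u. bounded (range (a u)) \<Longrightarrow> \<exists>l. (a u \<longlongrightarrow> l) F"
    by (rule bounded_family_converges_along_filter[of a]) blast
  ultimately have "\<forall>u. \<exists>l. bounded_on_S u \<longrightarrow> (a u \<longlongrightarrow> l) F"
    by blast
  then obtain m where m: "\<And>u. bounded_on_S u \<Longrightarrow> (a u \<longlongrightarrow> m u) F"
    by metis
  have lim_eq: "m u = l" if "bounded_on_S u" "(a u \<longlongrightarrow> l) F" for u l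
    using tendsto_unique[OF F(1) m[OF that(1)] that(2)] .
  show thesis
  proof (rule that[of m])
    fix u v assume uv: "bounded_on_S u" "bounded_on_S v"
    have "a (\<lambda>x. u x + v x) = (\<lambda>N. a u N + a v N)"
      by (simp add: a_def t_def transfer_power_add sum.distrib add_divide_distrib fun_eq_iff)
    then show "m (\<lambda>x. u x + v x) = m u + m v"
      using uv by (intro lim_eq bounded_plus_comp) (auto intro!: tendsto_add m)
  next
    fix u c assume u: "bounded_on_S u"
    have "a (\<lambda>x. c * u x) = (\<lambda>N. c * a u N)"
      by (simp add: a_def t_def transfer_power_scale sum_distrib_left fun_eq_iff)
    then show "m (\<lambda>x. c * u x) = c * m u"
      using u bounded_scaleR_comp[of u S c] by (intro lim_eq) (auto intro!: tendsto_mult_left m)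
  next
    fix u v assume uv: "bounded_on_S u" "bounded_on_S v" and le: "\<And>x. x \<in> S \<Longrightarrow> u x \<le> v x"
    have "a u N \<le> a v N" for N
      unfolding a_def t_def by (intro divide_right_mono sum_mono transfer_power_mono le x0) auto
    then show "m u \<le> m v"
      by (intro tendsto_le[OF F(1) m[OF uv(2)] m[OF uv(1)]]) simp
  next
    have "eventually (\<lambda>N. a (\<lambda>_. 1) N = 1) F"
      using F(2) eventually_gt_at_top[of 0]
      by (rule filter_leD[THEN eventually_mono]) (simp add: a_def t_def transfer_power_const[OF g x0])
    then show "m (\<lambda>_. 1) = 1"
      by (intro lim_eq tendsto_eventually) (auto simp: image_constant_conv)
  next
    fix u assume u: "bounded_on_S u"
    obtain B where B: "\<And>x. x \<in> S \<Longrightarrow> \<bar>u x\<bar> \<le> B"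
      using u unfolding bounded_real by blast
    have "\<bar>transfer g u x\<bar> \<le> B" if "x \<in> S" for x
    proof -
      have "transfer g u x \<le> transfer g (\<lambda>_. B) x"
        by (rule transfer_mono[OF _ that]) (use B in \<open>force simp: abs_le_iff\<close>)
      moreover have "transfer g (\<lambda>_. - B) x \<le> transfer g u x"
        by (rule transfer_mono[OF _ that]) (use B in \<open>force simp: abs_le_iff\<close>)
      ultimately show ?thesis
        by (simp add: transfer_const[OF g that] abs_le_iff)
    qed
    then have bdd: "bounded_on_S (transfer g u)"
      unfolding bounded_real by blast
    have t_Suc: "t (transfer g u) k = t u (Suc k)" for k
      unfolding t_def by (simp only: funpow_Suc_right o_def)
    have diff: "a (transfer g u) N = a u N + (t u N - t u 0) / real N" for N
    proof -
      have "(\<Sum>k<N. t u (Suc k)) = (\<Sum>k<N. t u k) + (t u N - t u 0)"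
        using sum_lessThan_telescope[of "t u" N] by (simp add: sum_subtractf)
      then show ?thesis
        by (simp add: a_def t_Suc add_divide_distrib)
    qed
    have "((\<lambda>N. (t u N - t u 0) / real N) \<longlongrightarrow> 0) F"
    proof (rule tendsto_mono[OF F(2)], rule Lim_null_comparison)
      have "\<bar>t u N - t u 0\<bar> \<le> 2 * B" for N
        using t_bound[where u=u and k=N, OF B] t_bound[where u=u and k=0, OF B] by linarith
      then show "eventually (\<lambda>N. norm ((t u N - t u 0) / real N) \<le> 2 * B / real N) sequentially"
        by (auto simp: divide_right_mono)
      show "(\<lambda>N. 2 * B / real N) \<longlonglongrightarrow> 0"
        by (rule lim_const_over_n)
    qed
    then have "((\<lambda>N. a u N + (t u N - t u 0) / real N) \<longlongrightarrow> m u + 0) F"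
      by (intro tendsto_add m u)
    then have "(a (transfer g u) \<longlongrightarrow> m u) F"
      by (simp add: diff[abs_def])
    then show "m (transfer g u) = m u"
      by (rule lim_eq[OF bdd])
  qed
qed

lemma bounded_on_S_indicator [simp]: "bounded_on_S (indicator A)"
  unfolding bounded_real by (intro exI[of _ 1]) (auto simp: indicator_def)

lemma algebra_clopens: "algebra S clopens"
  unfolding algebra_iff_Int
proof (intro conjI ballI)
  show "clopens \<subseteq> Pow S"
    by (rule clopens_subset)
  show "{} \<in> clopens"
    by (auto simp: clopens_def determined_def)
  fix A assume "A \<in> clopens"
  then obtain n where n: "determined n A"
    by (auto simp: clopens_def)
  have "determined n (S - A)"
    using n unfolding determined_def by (blast intro: agree_sym)
  then show "S - A \<in> clopens"
    by (auto simp: clopens_def)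
  fix B assume "B \<in> clopens"
  then obtain k where k: "determined k B"
    by (auto simp: clopens_def)
  have "determined (max n k) A" "determined (max n k) B"
    using n k by (auto intro: determined_mono)
  then have "determined (max n k) (A \<inter> B)"
    unfolding determined_def by blast
  then show "A \<inter> B \<in> clopens"
    by (auto simp: clopens_def)
qed

text \<open>
  The compactness that makes every additive set function on the clopen sets countably additive.
\<close>

lemma clopens_compact:
  assumes A: "\<And>i::nat. A i \<in> clopens" and dec: "decseq A" and empty: "(\<Inter>i. A i) = {}"
  shows "\<exists>i. A i = {}"
proof (rule ccontr)
  assume "\<not> ?thesis"
  then have "\<forall>i. \<exists>x. x \<in> A i"
    by blast
  then obtain X where X: "\<And>i. X i \<in> A i"
    by metis
  have AS: "A i \<subseteq> S" for i
    using A[of i] clopens_subset by blast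
  obtain F x where F: "F \<noteq> bot" "F \<le> sequentially" "x \<in> S" "\<And>m. eventually (\<lambda>k. agree m (X k) x) F"
    by (rule S_cluster_point[of X]) (use X AS in blast)+
  have "x \<in> A i" for i
  proof -
    obtain n where n: "determined n (A i)"
      using A[of i] by (auto simp: clopens_def)
    have "eventually (\<lambda>k. k \<ge> i) F"
      using filter_leD[OF F(2)] eventually_ge_at_top by blast
    then have "eventually (\<lambda>k. agree n (X k) x \<and> k \<ge> i) F"
      using F(4) by (simp add: eventually_conj_iff)
    then obtain k where k: "agree n (X k) x" "k \<ge> i"
      using eventually_happens'[OF F(1)] by blast
    then have "X k \<in> A i"
      using X[of k] decseqD[OF dec k(2)] by blast
    then show ?thesis
      using n k(1) F(3) AS unfolding determined_def by blast
  qed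
  then show False
    using empty by blast
qed

text \<open>
  The invariant mean \<open>m\<close>, restricted to indicators of clopen sets, extends to a measure by
  Caratheodory's theorem. It is shift invariant since \<open>T (u \<circ> shift) = u * T 1 = u\<close> for the transfer operator
  \<open>T\<close>. This operator maps the indicator of the cylinder of \<open>z\<close> of length \<open>n + 1\<close> below \<open>exp (g z + L * \<Lambda>\<^bsup>n + 1\<^esup>)\<close>
  times that of the cylinder of \<open>shift z\<close> of length \<open>n\<close>; iterating this gives the upper Gibbs bound.
\<close>

lemma gibbs_measure_exists:
  assumes g: "lip L g" "normalized g"
  obtains \<nu> where "shift_invariant_measure M \<Lambda> \<nu>"
    "\<And>n z. z \<in> S \<Longrightarrow> measure \<nu> (cylinder n z) \<le> exp (birkhoff_sum g n z + L / (1 - \<Lambda>))"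
proof -
  obtain m :: "((nat \<Rightarrow> 'r) \<Rightarrow> real) \<Rightarrow> real" where
    m_add: "\<And>u v. bounded_on_S u \<Longrightarrow> bounded_on_S v \<Longrightarrow> m (\<lambda>x. u x + v x) = m u + m v"
    and m_scale: "\<And>u c. bounded_on_S u \<Longrightarrow> m (\<lambda>x. c * u x) = c * m u"
    and m_mono: "\<And>u v. bounded_on_S u \<Longrightarrow> bounded_on_S v \<Longrightarrow> (\<And>x. x \<in> S \<Longrightarrow> u x \<le> v x) \<Longrightarrow> m u \<le> m v"
    and m_1: "m (\<lambda>_. 1) = 1"
    and m_transfer: "\<And>u. bounded_on_S u \<Longrightarrow> m (transfer g u) = m u"
    by (rule transfer_invariant_mean[OF g(2)]) blast
  have m_cong: "m u = m v" if "bounded_on_S u" "bounded_on_S v" "\<And>x. x \<in> S \<Longrightarrow> u x = v x" for u v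
    using m_mono[of u v] m_mono[of v u] that by (simp add: antisym)
  have m_0: "m (\<lambda>_. 0) = 0"
    using m_scale[of "\<lambda>_. 1" 0] by (simp add: image_constant_conv)
  \<comment> \<open>A finitely additive probability on all subsets.\<close>
  define p where "p A = m (indicator A)" for A
  have p_nonneg: "0 \<le> p A" for A
    using m_mono[of "\<lambda>_. 0" "indicator A"] by (simp add: p_def m_0 image_constant_conv)
  have p_empty: "p {} = 0"
    by (simp add: p_def indicator_def[abs_def] m_0)
  have p_S: "p S = 1"
  proof -
    have "m (indicator S) = m (\<lambda>_. 1)"
      by (rule m_cong) (simp_all add: image_constant_conv)
    then show ?thesis
      by (simp add: p_def m_1)
  qed
  have p_Un: "p (A \<union> B) = p A + p B" if "A \<inter> B = {}" for A B
  proof -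
    have "indicator (A \<union> B) = (\<lambda>x. indicator A x + indicator B x :: real)"
      using that by (auto simp: indicator_def fun_eq_iff)
    then show ?thesis
      by (simp add: p_def m_add)
  qed
  have p_shift: "p (shift -` A \<inter> S) = p A" for A
  proof -
    have "p (shift -` A \<inter> S) = m (transfer g (indicator (shift -` A \<inter> S)))"
      by (simp add: p_def m_transfer)
    also have "\<dots> = m (indicator A)"
    proof (rule m_cong)
      have *: "transfer g (indicator (shift -` A \<inter> S)) x = indicator A x" if "x \<in> S" for x
      proof -
        have "transfer g (indicator (shift -` A \<inter> S)) x = transfer g (\<lambda>_. indicator A x) x"
          unfolding transfer_def using that by (intro sum.cong) (auto simp: indicator_def)
        then show ?thesis
          using transfer_const[OF g(2) that] by simp
      qed
      then show "transfer g (indicator (shift -` A \<inter> S)) x = indicator A x" if "x \<in> S" for x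
        using that .
      show "bounded_on_S (transfer g (indicator (shift -` A \<inter> S)))"
        unfolding bounded_real by (intro exI[of _ 1]) (auto simp: * indicator_def)
    qed simp
    finally show ?thesis
      by (simp add: p_def)
  qed
  have p_cylinder: "p (cylinder n z) \<le> exp (birkhoff_sum g n z + L * (\<Sum>i<n. \<Lambda> ^ (n - i)))" if "z \<in> S" for n z
    using that
  proof (induction n arbitrary: z)
    case 0
    have "cylinder 0 z = S"
      by (auto simp: cylinder_def)
    then show ?case
      by (simp add: p_S birkhoff_sum_def)
  next
    case (Suc n)
    define c where "c = exp (g z + L * \<Lambda> ^ Suc n)"
    have le: "transfer g (indicator (cylinder (Suc n) z)) x \<le> c * indicator (cylinder n (shift z)) x"
      and nonneg: "0 \<le> transfer g (indicator (cylinder (Suc n) z)) x" if x: "x \<in> S" for x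
    proof -
      show "0 \<le> transfer g (indicator (cylinder (Suc n) z)) x"
        unfolding transfer_def by (intro sum_nonneg) auto
      have "exp (g (prepend a x)) * indicator (cylinder (Suc n) z) (prepend a x)
          \<le> (if a = z 0 then c * indicator (cylinder n (shift z)) x else 0)" if a: "a \<in> preds x" for a
      proof (cases "prepend a x \<in> cylinder (Suc n) z")
        case True
        then have ag: "agree (Suc n) (prepend a x) z" and inS: "prepend a x \<in> S"
          by (auto simp: cylinder_def)
        then have "a = z 0" "x \<in> cylinder n (shift z)"
          using x by (auto simp: agree_Suc cylinder_def)
        moreover have "g (prepend a x) \<le> g z + L * \<Lambda> ^ Suc n"
          using lip_agree[OF g(1) inS Suc.prems ag] by linarith
        ultimately show ?thesis
          using True by (simp add: c_def)
      next
        case False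
        then show ?thesis
          by (simp add: c_def)
      qed
      then have "transfer g (indicator (cylinder (Suc n) z)) x
          \<le> (\<Sum>a\<in>preds x. if a = z 0 then c * indicator (cylinder n (shift z)) x else 0)"
        unfolding transfer_def by (rule sum_mono)
      also have "\<dots> \<le> c * indicator (cylinder n (shift z)) x"
        by (simp add: sum.delta c_def)
      finally show "transfer g (indicator (cylinder (Suc n) z)) x \<le> c * indicator (cylinder n (shift z)) x" .
    qed
    have bdd: "bounded_on_S (transfer g (indicator (cylinder (Suc n) z)))"
    proof (rule boundedI[where B=c], clarify)
      fix x assume "x \<in> S"
      have "c * indicator (cylinder n (shift z)) x \<le> c"
        by (simp add: c_def indicator_def)
      then show "norm (transfer g (indicator (cylinder (Suc n) z)) x) \<le> c"
        using le[OF \<open>x \<in> S\<close>] nonneg[OF \<open>x \<in> S\<close>] unfolding real_norm_def by linarith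
    qed
    have bdd': "bounded_on_S (\<lambda>x. c * indicator (cylinder n (shift z)) x)"
      unfolding bounded_real by (intro exI[of _ c]) (auto simp: c_def indicator_def)
    have "p (cylinder (Suc n) z) = m (transfer g (indicator (cylinder (Suc n) z)))"
      by (simp add: p_def m_transfer)
    also have "\<dots> \<le> m (\<lambda>x. c * indicator (cylinder n (shift z)) x)"
      by (rule m_mono[OF bdd bdd' le])
    also have "\<dots> = c * p (cylinder n (shift z))"
      by (simp add: m_scale p_def)
    also have "\<dots> \<le> c * exp (birkhoff_sum g n (shift z) + L * (\<Sum>i<n. \<Lambda> ^ (n - i)))"
      by (rule mult_left_mono[OF Suc.IH[OF shift_in_S[OF Suc.prems]]]) (simp add: c_def)
    also have "\<dots> = exp (birkhoff_sum g (Suc n) z + L * (\<Sum>i<Suc n. \<Lambda> ^ (Suc n - i)))"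
    proof -
      have "birkhoff_sum g (Suc n) z = g z + birkhoff_sum g n (shift z)"
        unfolding birkhoff_sum_def by (subst sum.lessThan_Suc_shift) (simp add: funpow_swap1)
      moreover have "(\<Sum>i<Suc n. \<Lambda> ^ (Suc n - i)) = \<Lambda> ^ Suc n + (\<Sum>i<n. \<Lambda> ^ (n - i))"
        by (subst sum.lessThan_Suc_shift) simp
      ultimately show ?thesis
        by (simp add: c_def exp_add[symmetric] algebra_simps del: power_Suc)
    qed
    finally show ?case .
  qed
  interpret algebra S clopens
    by (rule algebra_clopens)
  have "\<exists>\<mu> :: (nat \<Rightarrow> 'r) set \<Rightarrow> ennreal. (\<forall>A\<in>clopens. \<mu> A = ennreal (p A)) \<and> measure_space S (sigma_sets S clopens) \<mu>"
  proof (rule caratheodory_empty_continuous)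
    show "positive clopens (\<lambda>A. ennreal (p A))"
      by (simp add: positive_def p_empty)
    show "additive clopens (\<lambda>A. ennreal (p A))"
      by (simp add: additive_def p_Un ennreal_plus p_nonneg)
    show "ennreal (p A) \<noteq> \<infinity>" for A
      by simp
    fix A :: "nat \<Rightarrow> (nat \<Rightarrow> 'r) set"
    assume A: "range A \<subseteq> clopens" "decseq A" "(\<Inter>i. A i) = {}"
    then obtain i where i: "A i = {}"
      using clopens_compact[of A] by blast
    have "A j = {}" if "j \<ge> i" for j
      using decseqD[OF A(2) that] i by blast
    then have "eventually (\<lambda>j. ennreal (p (A j)) = 0) sequentially"
      unfolding eventually_sequentially by (intro exI[of _ i]) (simp add: p_empty)
    then show "(\<lambda>j. ennreal (p (A j))) \<longlonglongrightarrow> 0"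
      by (rule tendsto_eventually)
  qed
  then obtain \<mu> :: "(nat \<Rightarrow> 'r) set \<Rightarrow> ennreal" where \<mu>: "\<And>A. A \<in> clopens \<Longrightarrow> \<mu> A = ennreal (p A)"
    "measure_space S (sigma_sets S clopens) \<mu>"
    by blast
  define \<nu> where "\<nu> = measure_of S clopens \<mu>"
  have sets_\<nu>: "sets \<nu> = sigma_sets S clopens"
    unfolding \<nu>_def by (rule sets_measure_of[OF clopens_subset])
  have space_\<nu>: "space \<nu> = S"
    unfolding \<nu>_def by (rule space_measure_of[OF clopens_subset])
  have em: "emeasure \<nu> A = ennreal (p A)" if "A \<in> clopens" for A
    unfolding \<nu>_def emeasure_measure_of_conv using that \<mu> by (auto intro: sigma_sets.Basic)
  have sets_eq: "sets \<nu> = sets (subshift_borel \<Lambda> M)"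
    by (simp add: sets_\<nu> sets_subshift_borel)
  have shift_meas: "shift \<in> measurable \<nu> \<nu>"
    using shift_measurable measurable_cong_sets[OF sets_eq sets_eq] by simp
  have S_clopen: "S \<in> clopens"
    by (rule top)
  have prob: "prob_space \<nu>"
    by (rule prob_spaceI) (simp add: space_\<nu> em[OF S_clopen] p_S)
  have shift_S: "shift -` S \<inter> S = S"
    by auto
  have inv: "distr \<nu> \<nu> shift = \<nu>"
  proof (rule measure_eqI_generator_eq[where E=clopens and \<Omega>=S and A="\<lambda>_. S"])
    show "Int_stable clopens"
      by (auto simp: Int_stable_def)
    fix A assume A: "A \<in> clopens"
    then have "shift -` A \<inter> S \<in> clopens"
      by (rule clopens_shift_vimage)
    moreover have "A \<in> sets \<nu>"
      using A by (simp add: sets_\<nu> sigma_sets.Basic)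
    ultimately show "emeasure (distr \<nu> \<nu> shift) A = emeasure \<nu> A"
      using A by (simp add: emeasure_distr[OF shift_meas] space_\<nu> em p_shift)
  qed (use clopens_subset S_clopen in \<open>auto simp: sets_\<nu> emeasure_distr[OF shift_meas] sigma_sets.Basic
      sigma_sets_top space_\<nu> em p_S shift_S\<close>)
  show thesis
  proof (rule that[of \<nu>])
    interpret prob_space \<nu> by (rule prob)
    show "shift_invariant_measure M \<Lambda> \<nu>"
      by unfold_locales (use shift_meas inv sets_eq in auto)
    fix n z assume z: "z \<in> S"
    have "cylinder n z \<in> clopens"
      using determined_cylinder by (auto simp: clopens_def)
    then have "measure \<nu> (cylinder n z) = p (cylinder n z)"
      by (simp add: measure_def em p_nonneg)
    also have "\<dots> \<le> exp (birkhoff_sum g n z + L * (\<Sum>i<n. \<Lambda> ^ (n - i)))"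
      by (rule p_cylinder[OF z])
    also have "\<dots> \<le> exp (birkhoff_sum g n z + L / (1 - \<Lambda>))"
      using mult_left_mono[OF geometric_bound[of n], of L] g(1) by (simp add: lip_def)
    finally show "measure \<nu> (cylinder n z) \<le> exp (birkhoff_sum g n z + L / (1 - \<Lambda>))" .
  qed
qed

end

context shift_invariant_measure
begin

text \<open>
  The Gibbs bound says \<open>- ln (prob C) \<ge> - birkhoff_sum g n x - D\<close> for all \<open>x\<close> in a cylinder \<open>C\<close> of
  positive measure; integration gives the claim.
\<close>

lemma entropy_letters_lower:
  assumes g: "lip L g"
    and gibbs: "\<And>n z. z \<in> S \<Longrightarrow> prob (cylinder n z) \<le> exp (birkhoff_sum g n z + D)" and D: "0 \<le> D"
  shows "- real n * (\<integral>x. g x \<partial>\<nu>) - D \<le> observable_entropy \<nu> (letters n)"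
proof -
  obtain B where B: "\<And>x. x \<in> S \<Longrightarrow> \<bar>g x\<bar> \<le> B"
    by (rule lip_bounded[OF g]) blast
  \<comment> \<open>As \<open>ln 0 = 0\<close>, cells of measure zero get a value below all Birkhoff sums.\<close>
  define c where "c C = (if prob C = 0 then - (real n * B) else ln (prob C))" for C
  have "(\<Sum>C\<in>cylinder n ` S. prob C * ln (prob C)) = (\<Sum>C\<in>cylinder n ` S. prob C * c C)"
    by (rule sum.cong) (auto simp: c_def)
  also have "\<dots> = (\<integral>x. (\<Sum>C\<in>cylinder n ` S. indicator C x * c C) \<partial>\<nu>)"
    by (rule integral_cylinder_sum(2)[symmetric])
  also have "\<dots> \<le> (\<integral>x. birkhoff_sum g n x + D \<partial>\<nu>)"
  proof (rule integral_mono[OF integral_cylinder_sum(1)])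
    show "integrable \<nu> (\<lambda>x. birkhoff_sum g n x + D)"
      by (intro Bochner_Integration.integrable_add integral_birkhoff_sum[OF g]) simp
    fix x assume "x \<in> space \<nu>"
    then have x: "x \<in> S"
      by simp
    have "c (cylinder n x) \<le> birkhoff_sum g n x + D"
    proof (cases "prob (cylinder n x) = 0")
      case True
      have "- (real n * B) = (\<Sum>i<n. - B)"
        by simp
      also have "\<dots> \<le> birkhoff_sum g n x"
        unfolding birkhoff_sum_def
      proof (rule sum_mono)
        fix i
        show "- B \<le> g ((shift ^^ i) x)"
          using B[OF funpow_shift_in_S[OF x], of i] by linarith
      qed
      finally show ?thesis
        using True D by (simp add: c_def)
    next
      case False
      then have pos: "0 < prob (cylinder n x)"
        by (simp add: zero_less_measure_iff)
      then have "ln (prob (cylinder n x)) \<le> ln (exp (birkhoff_sum g n x + D))"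
        using gibbs[OF x] by (subst ln_le_cancel_iff) auto
      then show ?thesis
        using False by (simp add: c_def)
    qed
    then show "(\<Sum>C\<in>cylinder n ` S. indicator C x * c C) \<le> birkhoff_sum g n x + D"
      by (simp only: cylinder_indicator_sum[OF x])
  qed
  also have "\<dots> = real n * (\<integral>x. g x \<partial>\<nu>) + D"
    using integral_birkhoff_sum[OF g, of n] by (simp add: prob_space[unfolded space_\<nu>])
  finally show ?thesis
    by (simp add: observable_entropy_letters)
qed

theorem ks_entropy_lower:
  assumes g: "lip L g"
    and gibbs: "\<And>n z. z \<in> S \<Longrightarrow> prob (cylinder n z) \<le> exp (birkhoff_sum g n z + D)" and D: "0 \<le> D"
  shows "ereal (- (\<integral>x. g x \<partial>\<nu>)) \<le> ks_entropy \<nu> shift"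
proof -
  let ?P = "cylinder 1 ` S" and ?I = "\<integral>x. g x \<partial>\<nu>"
  have self: "x \<in> cylinder 1 x" if "x \<in> S" for x
    using that by (simp add: cylinder_def)
  have P: "finite ?P" "?P \<subseteq> sets \<nu>" "partition_on (space \<nu>) ?P"
  proof -
    show "finite ?P"
      by (rule finite_cylinders)
    show "?P \<subseteq> sets \<nu>"
      using determined_sets[OF determined_cylinder] by blast
    show "partition_on (space \<nu>) ?P"
      unfolding partition_on_def
    proof (intro conjI)
      show "\<Union>?P = space \<nu>"
        using self by (auto simp: cylinder_def)
      show "{} \<notin> ?P"
        using self by blast
      show "disjoint ?P"
        by (rule disjointI) (metis (no_types, lifting) IntE cylinder_eqI equals0I imageE)
    qed
  qed
  have cell_x: "cell ?P x = cylinder 1 x" if "x \<in> S" for x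
    using cell_eq[OF P(3), of "cylinder 1 x" x] that self by blast
  have cell_iff: "cell ?P x = cell ?P y \<longleftrightarrow> x 0 = y 0" if "x \<in> S" "y \<in> S" for x y
  proof
    assume "cell ?P x = cell ?P y"
    then have "x \<in> cylinder 1 y"
      using self[OF that(1)] cell_x[OF that(1)] cell_x[OF that(2)] by metis
    then show "x 0 = y 0"
      by (simp add: cylinder_def agree_def)
  next
    assume "x 0 = y 0"
    then have "x \<in> cylinder 1 y"
      using that by (simp add: cylinder_def agree_def)
    then show "cell ?P x = cell ?P y"
      using cylinder_eqI cell_x[OF that(1)] cell_x[OF that(2)] by metis
  qed
  have same: "observable_entropy \<nu> (itinerary shift (cell ?P) n) = observable_entropy \<nu> (letters n)" for n
  proof (rule observable_entropy_cong)
    fix x y assume "x \<in> space \<nu>" "y \<in> space \<nu>"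
    then have "x \<in> S" "y \<in> S"
      by simp_all
    then show "itinerary shift (cell ?P) n x = itinerary shift (cell ?P) n y \<longleftrightarrow> letters n x = letters n y"
      unfolding letters_def itinerary_eq_iff using cell_iff funpow_shift_in_S by blast
  qed
  have "- ?I - D / real n \<le> observable_entropy \<nu> (letters n) / real n" if n: "n > 0" for n
  proof -
    have "- ?I - D / real n = (- real n * ?I - D) / real n"
      using n by (simp add: field_simps)
    also have "\<dots> \<le> observable_entropy \<nu> (letters n) / real n"
      using entropy_letters_lower[OF g gibbs D] by (intro divide_right_mono) auto
    finally show ?thesis .
  qed
  moreover have "(\<lambda>n. - ?I - D / real n) \<longlonglongrightarrow> - ?I - 0"
    by (intro tendsto_diff tendsto_const lim_const_over_n)
  ultimately have "- ?I - 0 \<le> entropy_wrt_partition \<nu> shift ?P"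
    using entropy_wrt_partition_limit[OF P] unfolding same
    by (intro LIMSEQ_le[where X="\<lambda>n. - ?I - D / real n"]) (auto intro!: exI[of _ 1])
  then have "ereal (- ?I) \<le> ereal (entropy_wrt_partition \<nu> shift ?P)"
    by simp
  also have "\<dots> \<le> ks_entropy \<nu> shift"
    unfolding ks_entropy_def by (rule SUP_upper) (use P in simp)
  finally show ?thesis .
qed

end

section \<open>The variational principle and the eigenvalue problem\<close>

context symmetric_subshift
begin

lemma invariant_measures_iff: "\<nu> \<in> invariant_measures \<Lambda> M \<longleftrightarrow> shift_invariant_measure M \<Lambda> \<nu>"
proof
  assume "\<nu> \<in> invariant_measures \<Lambda> M"
  then have \<nu>: "prob_space \<nu>" "sets \<nu> = sets (subshift_borel \<Lambda> M)" "shift \<in> measurable \<nu> \<nu>" "distr \<nu> \<nu> shift = \<nu>"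
    by (auto simp: invariant_measures_def)
  interpret prob_space \<nu> by (rule \<nu>(1))
  show "shift_invariant_measure M \<Lambda> \<nu>"
    by unfold_locales (use \<nu> in auto)
next
  assume "shift_invariant_measure M \<Lambda> \<nu>"
  then interpret shift_invariant_measure M \<Lambda> \<nu> .
  show "\<nu> \<in> invariant_measures \<Lambda> M"
    using T_measurable T_invariant sets_\<nu> prob_space_axioms by (simp add: invariant_measures_def)
qed

text \<open>
  With the eigenfunction \<open>u\<close> of \<open>f\<close>, the potential \<open>g = f + u - u \<circ> shift - pressure f\<close> is normalized, and
  its integral with respect to an invariant measure is that of \<open>f\<close> minus the pressure. So both
  bounds reduce to those for normalized potentials.
\<close>

theorem variational_principle:
  assumes f: "lip K f"
  shows "(SUP \<nu>\<in>invariant_measures \<Lambda> M. ereal (\<integral>x. f x \<partial>\<nu>) + ks_entropy \<nu> shift) = ereal (pressure f)"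
proof -
  obtain u Ku where u: "lip Ku u" "\<And>x. x \<in> S \<Longrightarrow> log_transfer f u x = u x + pressure f"
    by (rule pressure_eigenfunction[OF f]) blast
  have us: "lip (Ku / \<Lambda>) (\<lambda>x. - u (shift x))"
    unfolding lip_def
  proof (intro conjI ballI)
    show "0 \<le> Ku / \<Lambda>"
      using u(1) \<Lambda>_pos by (simp add: lip_def)
    fix x y assume "x \<in> S" "y \<in> S"
    then have "\<bar>u (shift x) - u (shift y)\<bar> \<le> Ku * d (shift x) (shift y)"
      using u(1) unfolding lip_def by (meson shift_in_S)
    also have "\<dots> \<le> Ku * (d x y / \<Lambda>)"
      using u(1) by (intro mult_left_mono d_shift) (simp add: lip_def)
    finally show "\<bar>- u (shift x) - - u (shift y)\<bar> \<le> Ku / \<Lambda> * d x y"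
      by (simp add: abs_minus_commute)
  qed
  have const: "lip 0 (\<lambda>_. - pressure f)"
    by (simp add: lip_def)
  define g where "g x = ((f x + u x) + - u (shift x)) + - pressure f" for x
  obtain L where L: "lip L g"
    using lip_add[OF lip_add[OF lip_add[OF f u(1)] us] const] by (auto simp: g_def[abs_def])
  have norm: "normalized g"
    unfolding normalized_def
  proof
    fix x assume x: "x \<in> S"
    have pos: "0 < (\<Sum>a\<in>preds x. exp (f (prepend a x) + u (prepend a x)))"
      by (rule sum_pos) auto
    have "(\<Sum>a\<in>preds x. exp (g (prepend a x)))
        = (\<Sum>a\<in>preds x. exp (f (prepend a x) + u (prepend a x)) * exp (- (u x + pressure f)))"
      by (intro sum.cong refl) (simp add: g_def exp_add[symmetric])
    also have "\<dots> = exp (log_transfer f u x) * exp (- (u x + pressure f))"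
      using pos by (simp add: log_transfer_def sum_distrib_right)
    also have "\<dots> = 1"
      by (simp add: u(2)[OF x] exp_add[symmetric])
    finally show "(\<Sum>a\<in>preds x. exp (g (prepend a x))) = 1" .
  qed
  have int: "(\<integral>x. f x \<partial>\<nu>) = (\<integral>x. g x \<partial>\<nu>) + pressure f" if \<nu>: "shift_invariant_measure M \<Lambda> \<nu>" for \<nu>
  proof -
    interpret shift_invariant_measure M \<Lambda> \<nu> by (rule \<nu>)
    have i: "integrable \<nu> f" "integrable \<nu> u" "integrable \<nu> (\<lambda>x. u (shift x))"
      "(\<integral>x. u (shift x) \<partial>\<nu>) = (\<integral>x. u x \<partial>\<nu>)"
      using integral_funpow_shift[OF u(1), of 1] lip_integrable[OF f] lip_integrable[OF u(1)]
      by (simp_all del: shift_nth)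
    then show ?thesis
      by (simp add: g_def prob_space[unfolded space_\<nu>] del: shift_nth)
  qed
  show ?thesis
  proof (rule antisym)
    show "(SUP \<nu>\<in>invariant_measures \<Lambda> M. ereal (\<integral>x. f x \<partial>\<nu>) + ks_entropy \<nu> shift) \<le> ereal (pressure f)"
    proof (rule SUP_least)
      fix \<nu> assume "\<nu> \<in> invariant_measures \<Lambda> M"
      then have \<nu>: "shift_invariant_measure M \<Lambda> \<nu>"
        by (simp add: invariant_measures_iff)
      have "ereal (\<integral>x. f x \<partial>\<nu>) + ks_entropy \<nu> shift \<le> ereal (\<integral>x. f x \<partial>\<nu>) + ereal (- (\<integral>x. g x \<partial>\<nu>))"
        by (intro add_left_mono shift_invariant_measure.ks_entropy_upper[OF \<nu> L norm])
      also have "\<dots> = ereal (pressure f)"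
        by (simp add: int[OF \<nu>])
      finally show "ereal (\<integral>x. f x \<partial>\<nu>) + ks_entropy \<nu> shift \<le> ereal (pressure f)" .
    qed
    obtain \<nu> where \<nu>: "shift_invariant_measure M \<Lambda> \<nu>"
      and gibbs: "\<And>n z. z \<in> S \<Longrightarrow> measure \<nu> (cylinder n z) \<le> exp (birkhoff_sum g n z + L / (1 - \<Lambda>))"
      by (rule gibbs_measure_exists[OF L norm]) blast
    have D: "0 \<le> L / (1 - \<Lambda>)"
      using L \<Lambda>_less_1 by (simp add: lip_def)
    have "ereal (pressure f) = ereal (\<integral>x. f x \<partial>\<nu>) + ereal (- (\<integral>x. g x \<partial>\<nu>))"
      by (simp add: int[OF \<nu>])
    also have "\<dots> \<le> ereal (\<integral>x. f x \<partial>\<nu>) + ks_entropy \<nu> shift"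
      by (intro add_left_mono shift_invariant_measure.ks_entropy_lower[OF \<nu> L gibbs D])
    also have "\<dots> \<le> (SUP \<nu>\<in>invariant_measures \<Lambda> M. ereal (\<integral>x. f x \<partial>\<nu>) + ks_entropy \<nu> shift)"
      using \<nu> by (intro SUP_upper) (simp add: invariant_measures_iff)
    finally show "ereal (pressure f) \<le> (SUP \<nu>\<in>invariant_measures \<Lambda> M. ereal (\<integral>x. f x \<partial>\<nu>) + ks_entropy \<nu> shift)" .
  qed
qed

lemma G_plus_solution_iff:
  assumes E: "\<And>y. y \<in> S \<Longrightarrow> \<exists>L. lip L (zero_extension M A y)"
  shows "G_plus_solution \<Lambda> M A \<phi> c \<longleftrightarrow>
    (\<exists>K. lip K \<phi>) \<and> (\<forall>y\<in>S. pressure (\<lambda>x. zero_extension M A y x + \<phi> x) = \<phi> y + c)"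
proof -
  have "G_plus \<Lambda> M A \<phi> y = ereal (pressure (\<lambda>x. zero_extension M A y x + \<phi> x))"
    if "y \<in> S" and \<phi>: "lip K \<phi>" for y K
  proof -
    obtain L where "lip L (zero_extension M A y)"
      using E \<open>y \<in> S\<close> by blast
    from variational_principle[OF lip_add[OF this \<phi>]] show ?thesis
      by (simp add: G_plus_def)
  qed
  then show ?thesis
    unfolding G_plus_solution_def lipschitz_functions_iff dual_S by auto
qed

end

theorem theorem1:
  fixes M :: "real^'r^'r"
    and \<Lambda> :: real
    and A :: "(nat \<Rightarrow> 'r) \<times> (nat \<Rightarrow> 'r) \<Rightarrow> real"
  assumes "transition_matrix M"
    and "irreducible_matrix M"
    and "transpose M = M"
    and "0 < \<Lambda>" and "\<Lambda> < 1"
    and "Lipschitz_continuous_map (hat_metric \<Lambda> M) euclidean_metric A"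
  shows "\<exists>\<phi> c. G_plus_solution \<Lambda> M A \<phi> c \<and>
           (\<forall>\<psi> c'. G_plus_solution \<Lambda> M A \<psi> c' \<longrightarrow>
              c' = c \<and> (\<exists>k. \<forall>x \<in> subshift M. \<psi> x = \<phi> x + k))"
proof -
  interpret symmetric_subshift M \<Lambda>
    by (rule symmetric_subshift.intro[OF assms(1-5)])
  obtain K B where K: "0 \<le> K" and E: "\<And>y. y \<in> S \<Longrightarrow> \<exists>L. lip L (zero_extension M A y)"
    and EK: "\<And>x y y'. x \<in> S \<Longrightarrow> y \<in> S \<Longrightarrow> y' \<in> S \<Longrightarrow> y 0 = y' 0 \<Longrightarrow>
      zero_extension M A y x \<le> zero_extension M A y' x + K * d y y'"
    and EB: "\<And>x y. x \<in> S \<Longrightarrow> y \<in> S \<Longrightarrow> \<bar>zero_extension M A y x\<bar> \<le> B"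
    by (rule zero_extension_lipschitz[OF assms(6)]) blast
  obtain \<phi> K' c where \<phi>: "lip K' \<phi>"
    "\<And>y. y \<in> S \<Longrightarrow> pressure (\<lambda>x. zero_extension M A y x + \<phi> x) = \<phi> y + c"
    by (rule pressure_problem_solvable[of "zero_extension M A", OF E K EK EB]) blast+
  show ?thesis
  proof (rule exI[of _ \<phi>], rule exI[of _ c], intro conjI allI impI)
    show "G_plus_solution \<Lambda> M A \<phi> c"
      using \<phi> by (auto simp: G_plus_solution_iff[OF E])
    fix \<psi> c' assume "G_plus_solution \<Lambda> M A \<psi> c'"
    then obtain K'' where \<psi>: "lip K'' \<psi>"
      "\<And>y. y \<in> S \<Longrightarrow> pressure (\<lambda>x. zero_extension M A y x + \<psi> x) = \<psi> y + c'"
      by (auto simp: G_plus_solution_iff[OF E])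
    from pressure_problem_unique[OF E \<phi> \<psi>]
    show "c' = c" "\<exists>k. \<forall>x\<in>S. \<psi> x = \<phi> x + k"
      by blast+
  qed
qed

end
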